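(* Let $X$ be a real Banach space. Suppose that $X$ is a weak Asplund space. Then the product space $X\times\mathbb{R}$ is a weak Asplund space.
   Context: A real-valued continuous convex function $f$ on a nonempty open convex subset $O$ of a real Banach space $Z$ is Gâteaux differentiable at $x\in O$ if there is a functional $df(x)\in Z^{*}$ such that $\lim_{t\to 0}\left|\frac{f(x+ty)-f(x)}{t}-\langle df(x),y\rangle\right|=0$ for every $y\in Z$. A real Banach space $Z$ is called a weak Asplund space if for every nonempty open convex subset $O$ of $Z$ and every continuous convex function $f:O\to\mathbb{R}$ there exists a dense $G_\delta$-subset $G$ of $O$ such that $f$ is Gâteaux differentiable at every point of $G$. The space $X\times\mathbb{R}$ is a Banach space with the norm $\|(x,y)\|=\max\{\|x\|,|y|\}$. *)

theory Defs
  imports "HOL-Analysis.Analysis"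
begin

section \<open>The product of two normed spaces with the maximum norm\<close>

text \<open>
  The library norm on \<open>'a \<times> 'b\<close> is Euclidean,
  \<open>norm (x, y) = sqrt ((norm x)\<^sup>2 + (norm y)\<^sup>2)\<close>. The type below is a copy of the
  product, with the componentwise linear structure, that carries the norm
  \<open>max (norm x) (norm y)\<close> instead. For \<open>y :: real\<close>, \<open>norm y = \<bar>y\<bar>\<close>.
\<close>

typedef ('a, 'b) max_prod = "UNIV :: ('a \<times> 'b) set"
  morphisms pair_of MaxProd ..

setup_lifting type_definition_max_prod

instantiation max_prod :: (real_vector, real_vector) real_vector
begin

lift_definition zero_max_prod :: "('a, 'b) max_prod" is 0 .
lift_definition plus_max_prod :: "('a, 'b) max_prod \<Rightarrow> ('a, 'b) max_prod \<Rightarrow> ('a, 'b) max_prod"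
  is "(+)" .
lift_definition minus_max_prod :: "('a, 'b) max_prod \<Rightarrow> ('a, 'b) max_prod \<Rightarrow> ('a, 'b) max_prod"
  is "(-)" .
lift_definition uminus_max_prod :: "('a, 'b) max_prod \<Rightarrow> ('a, 'b) max_prod"
  is uminus .
lift_definition scaleR_max_prod :: "real \<Rightarrow> ('a, 'b) max_prod \<Rightarrow> ('a, 'b) max_prod"
  is "(*\<^sub>R)" .

instance
  by standard (transfer; simp add: algebra_simps)+

end

instantiation max_prod :: (real_normed_vector, real_normed_vector) real_normed_vector
begin

lift_definition norm_max_prod :: "('a, 'b) max_prod \<Rightarrow> real"
  is "\<lambda>(x, y). max (norm x) (norm y)" .

definition dist_max_prod :: "('a, 'b) max_prod \<Rightarrow> ('a, 'b) max_prod \<Rightarrow> real"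
  where "dist_max_prod p q = norm (p - q)"

definition sgn_max_prod :: "('a, 'b) max_prod \<Rightarrow> ('a, 'b) max_prod"
  where "sgn_max_prod p = inverse (norm p) *\<^sub>R p"

definition uniformity_max_prod :: "(('a, 'b) max_prod \<times> ('a, 'b) max_prod) filter"
  where "uniformity_max_prod = (INF e\<in>{0<..}. principal {(p, q). dist p q < e})"

definition open_max_prod :: "('a, 'b) max_prod set \<Rightarrow> bool"
  where "open_max_prod U \<longleftrightarrow> (\<forall>p\<in>U. \<forall>\<^sub>F (p', q) in uniformity. p' = p \<longrightarrow> q \<in> U)"

instance
proof
  fix r :: real and p q :: "('a, 'b) max_prod"
  show "norm p = 0 \<longleftrightarrow> p = 0"
    by transfer (auto simp: max_def zero_prod_def split: if_splits)
  show "norm (p + q) \<le> norm p + norm q"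
    by transfer (auto simp: intro!: norm_triangle_le add_mono)
  show "norm (r *\<^sub>R p) = \<bar>r\<bar> * norm p"
    by transfer (auto simp: max_mult_distrib_left)
qed (simp_all add: dist_max_prod_def sgn_max_prod_def uniformity_max_prod_def open_max_prod_def)

end

lemma norm_MaxProd: "norm (MaxProd (x, y)) = max (norm x) (norm y)"
  by (simp add: norm_max_prod.rep_eq MaxProd_inverse)

lemma norm_max_prod_le: "norm p \<le> norm (pair_of p)"
  by transfer (auto simp: norm_prod_def intro: real_le_rsqrt)

lemma norm_pair_of_le: "norm (pair_of p) \<le> 2 * norm p"
proof transfer
  fix p :: "'a \<times> 'b"
  have "norm p \<le> norm (fst p) + norm (snd p)"
    using norm_Pair_le[of "fst p" "snd p"] by simp
  then show "norm p \<le> 2 * (case p of (x, y) \<Rightarrow> max (norm x) (norm y))"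
    by (auto simp: split_beta)
qed

lemma bounded_linear_pair_of:
  "bounded_linear (pair_of :: ('a::real_normed_vector, 'b::real_normed_vector) max_prod \<Rightarrow> 'a \<times> 'b)"
  by (rule bounded_linear_intro[where K = 2])
    (use norm_pair_of_le in \<open>auto simp: plus_max_prod.rep_eq scaleR_max_prod.rep_eq mult.commute\<close>)

lemma bounded_linear_MaxProd:
  "bounded_linear (MaxProd :: 'a::real_normed_vector \<times> 'b::real_normed_vector \<Rightarrow> ('a, 'b) max_prod)"
proof (rule bounded_linear_intro[where K = 1])
  fix p q :: "'a \<times> 'b" and r :: real
  show "MaxProd (p + q) = MaxProd p + MaxProd q"
    by (simp add: plus_max_prod.abs_eq)
  show "MaxProd (r *\<^sub>R p) = r *\<^sub>R MaxProd p"
    by (simp add: scaleR_max_prod.abs_eq)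
  show "norm (MaxProd p) \<le> norm p * 1"
    using norm_max_prod_le[of "MaxProd p"] by (simp add: MaxProd_inverse)
qed

instance max_prod :: (banach, banach) banach
proof
  fix X :: "nat \<Rightarrow> ('a, 'b) max_prod"
  assume "Cauchy X"
  then have "Cauchy (\<lambda>n. pair_of (X n))"
    by (rule bounded_linear.Cauchy[OF bounded_linear_pair_of])
  then obtain l where "(\<lambda>n. pair_of (X n)) \<longlonglongrightarrow> l"
    using Cauchy_convergent convergent_def by blast
  then have "(\<lambda>n. MaxProd (pair_of (X n))) \<longlonglongrightarrow> MaxProd l"
    by (rule bounded_linear.tendsto[OF bounded_linear_MaxProd])
  then show "convergent X"
    by (auto simp: pair_of_inverse convergent_def)
qed


section \<open>Weak Asplund spaces\<close>

text \<open>
  Functions on an open set \<open>U\<close> are represented by total functions; their values outside \<open>U\<close>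
  are irrelevant, since \<open>x + t *\<^sub>R y \<in> U\<close> for \<open>x \<in> U\<close> and all sufficiently small \<open>t\<close>.
\<close>

definition gateaux_differentiable_at :: "('a::real_normed_vector \<Rightarrow> real) \<Rightarrow> 'a \<Rightarrow> bool"
  where "gateaux_differentiable_at f x \<longleftrightarrow>
    (\<exists>df :: 'a \<Rightarrow>\<^sub>L real. \<forall>y.
      ((\<lambda>t. \<bar>(f (x + t *\<^sub>R y) - f x) / t - blinfun_apply df y\<bar>) \<longlongrightarrow> 0) (at 0))"

definition weak_asplund :: "'a::banach itself \<Rightarrow> bool"
  where "weak_asplund _ \<longleftrightarrow>
    (\<forall>(U :: 'a set) (f :: 'a \<Rightarrow> real).
      U \<noteq> {} \<and> open U \<and> convex U \<and> continuous_on U f \<and> convex_on U f \<longrightarrow>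
      (\<exists>G. gdelta_in (top_of_set U) G \<and> U \<subseteq> closure G \<and>
        (\<forall>x\<in>G. gateaux_differentiable_at f x)))"

end

theory Submission
  imports Defs
begin

text \<open>
  Let \<open>X\<close> be a weak Asplund space and \<open>f\<close> a continuous convex function on an open convex
  subset of \<open>X \<times> \<real>\<close>. The max norm and the Euclidean norm of the product are equivalent, and near
  each point \<open>f\<close> agrees with a globally Lipschitz convex function
  (\<open>convex_on_extension\<close>), so by \<open>comeagre_in_local\<close> and Baire's theorem it is enough that a
  globally Lipschitz \<open>f\<close> is Gateaux differentiable on a comeagre subset of \<open>'a \<times> real\<close>. For a
  Lipschitz convex function this means that the second differences \<open>f (p + t h) + f (p - t h) - 2 f p\<close>
  are \<open>o(t)\<close> in every direction \<open>h\<close>, and the directions with this property form a linear space. The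
  vertical direction \<open>(0, 1)\<close> is harmless, being a matter of convex functions of one variable
  (\<open>comeagre_smooth_along\<close>). The horizontal directions \<open>(k, 0)\<close> are the difficulty, because the
  hypothesis yields smooth points \<open>x\<close> of each slice \<open>f (_, y)\<close> for one \<open>y\<close> at a time only.

  Slices can be treated simultaneously by taking a supremum \<open>g = (SUP v. F v)\<close> of functions on \<open>X\<close>,
  each of which is a horizontally and vertically translated slice of \<open>f\<close> plus an affine function. If
  \<open>g\<close> is smooth at \<open>x\<close> and \<open>F v x\<close> is close to \<open>g x\<close>, then \<open>F v \<le> g\<close> bounds the second differences of
  \<open>F v\<close> at \<open>x\<close>, and so the horizontal ones of \<open>f\<close> at the point of \<open>X \<times> \<real>\<close> that the copy \<open>v\<close> puts over
  \<open>x\<close> (\<open>smooth_along_limit\<close>). The question is how to arrange that the points visited by winning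
  copies are as many as required. There are two cases.

  Suppose first that every Lipschitz convex function on \<open>X\<close> has a dense set of Frechet smooth points.
  The maximum over \<open>y\<close> near \<open>y0\<close> of \<open>f (x, y) - K (y - y0)^2\<close> has a Frechet smooth point \<open>x\<close>, and with a
  maximising \<open>y\<close> the point \<open>(x, y)\<close> is Frechet smooth for \<open>f\<close>. Such points are therefore dense, and the
  sets that approximate Frechet smoothness are open (\<open>comeagre_smooth_of_frechet\<close>).

  Otherwise some Lipschitz convex \<open>\<phi>\<close> on \<open>X\<close> has second differences of size \<open>e d\<close> at every radius \<open>d\<close>
  and every point of some ball (\<open>rough_ball\<close>). Its gradients at the dense set of points of Gateaux
  differentiability are weakly-star continuous but stay far apart in norm, even from the convex hull of
  finitely many given ones (\<open>separated_gradient\<close>). They can be arranged in a tree \<open>\<xi>\<close> on the natural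
  numbers such that each \<open>\<xi> j\<close> exceeds by a constant, on some \<open>h j\<close> in the unit ball, all \<open>\<xi> w\<close> outside the
  subtree of \<open>j\<close>, while the children of a node converge to it weakly-star (\<open>gradient_tree_exists\<close>).
  These functionals serve as the affine terms of the copies: over a suitable point, a child \<open>j\<close> of a
  nearly winning copy \<open>v\<close> wins against all copies outside its own subtree, and it can be chosen with
  any small horizontal and vertical displacement from \<open>v\<close> (\<open>steer\<close>). Each displacement has a cost, so
  the descendants that win along with \<open>j\<close> are hardly displaced from \<open>j\<close>. Thus any open set near the
  point visited by \<open>v\<close> can be entered by winners, which is the winning strategy in a game of
  Banach-Mazur type for the set of horizontally smooth points of \<open>f\<close>
  (\<open>comeagre_in_by_play\<close>, \<open>comeagre_smooth_horizontally\<close>).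
\<close>

section \<open>Comeagre sets\<close>

text \<open>The open sets belong to the whole space and need only be dense in \<open>U\<close>; so no subspace topology
  is involved and \<open>U\<close> can be shrunk freely.\<close>

definition comeagre_in :: "'z::topological_space set \<Rightarrow> 'z set \<Rightarrow> bool"
  where "comeagre_in U D \<longleftrightarrow>
    (\<exists>W :: nat \<Rightarrow> 'z set. (\<forall>n. open (W n) \<and> U \<subseteq> closure (W n)) \<and> U \<inter> (\<Inter>n. W n) \<subseteq> D)"

lemma comeagre_inE:
  assumes "comeagre_in U D"
  obtains W :: "nat \<Rightarrow> 'z::topological_space set"
  where "\<And>n. open (W n)" "\<And>n. U \<subseteq> closure (W n)" "U \<inter> (\<Inter>n. W n) \<subseteq> D"
  using assms unfolding comeagre_in_def by metis

lemma comeagre_in_mono: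
  assumes "comeagre_in U D" "U' \<subseteq> U" "U' \<inter> D \<subseteq> D'"
  shows "comeagre_in U' D'"
proof -
  obtain W where W: "\<And>n::nat. open (W n)" "\<And>n. U \<subseteq> closure (W n)" "U \<inter> (\<Inter>n. W n) \<subseteq> D"
    using assms(1) by (rule comeagre_inE) (rule that)
  have "U' \<inter> (\<Inter>n. W n) \<subseteq> D'"
    using W(3) assms(2,3) by (meson Int_greatest Int_lower1 Int_mono order_refl subset_trans)
  moreover have "U' \<subseteq> closure (W n)" for n
    using W(2) assms(2) by (rule subset_trans[rotated])
  ultimately show ?thesis
    unfolding comeagre_in_def by (intro exI[of _ W]) (simp add: W(1))
qed

lemma comeagre_in_Int:
  assumes "comeagre_in U A" "comeagre_in U B"
  shows "comeagre_in U (A \<inter> B)"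
proof -
  obtain W where W: "\<And>n::nat. open (W n)" "\<And>n. U \<subseteq> closure (W n)" "U \<inter> (\<Inter>n. W n) \<subseteq> A"
    using assms(1) by (rule comeagre_inE) (rule that)
  obtain W' where W': "\<And>n::nat. open (W' n)" "\<And>n. U \<subseteq> closure (W' n)" "U \<inter> (\<Inter>n. W' n) \<subseteq> B"
    using assms(2) by (rule comeagre_inE) (rule that)
  define X where "X n = (if even n then W (n div 2) else W' (n div 2))" for n :: nat
  have "X (2 * n) = W n" "X (2 * n + 1) = W' n" for n
    by (simp_all add: X_def)
  then have "(\<Inter>n. X n) \<subseteq> (\<Inter>n. W n)" "(\<Inter>n. X n) \<subseteq> (\<Inter>n. W' n)"
    by (metis INT_greatest INT_lower UNIV_I)+
  then have "U \<inter> (\<Inter>n. X n) \<subseteq> A" "U \<inter> (\<Inter>n. X n) \<subseteq> B"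
    using W(3) W'(3) by (meson Int_mono order_refl subset_trans)+
  then have "U \<inter> (\<Inter>n. X n) \<subseteq> A \<inter> B"
    by simp
  moreover have "open (X n)" "U \<subseteq> closure (X n)" for n
    using W(1,2)[of "n div 2"] W'(1,2)[of "n div 2"] by (simp_all add: X_def)
  ultimately show ?thesis
    unfolding comeagre_in_def by (intro exI[of _ X]) simp
qed

text \<open>A maximal disjoint subfamily, which exists by Zorn's lemma, leaves no gap: a gap would be a
  nonempty open set and would contain a further member of the family.\<close>

lemma disjoint_dense_subfamily:
  fixes V :: "'s \<Rightarrow> 'z::topological_space set"
  assumes op: "\<And>s. s \<in> C \<Longrightarrow> open (V s) \<and> V s \<noteq> {}"
    and "open U"
    and fine: "\<And>W. open W \<Longrightarrow> W \<noteq> {} \<Longrightarrow> W \<subseteq> U \<Longrightarrow> \<exists>s\<in>C. V s \<subseteq> W"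
  obtains S where "S \<subseteq> C" "\<And>s t. s \<in> S \<Longrightarrow> t \<in> S \<Longrightarrow> s \<noteq> t \<Longrightarrow> V s \<inter> V t = {}"
    "U \<subseteq> closure (\<Union>s\<in>S. V s)"
proof -
  define \<A> where "\<A> = {S. S \<subseteq> C \<and> (\<forall>s\<in>S. \<forall>t\<in>S. s \<noteq> t \<longrightarrow> V s \<inter> V t = {})}"
  have "\<Union>\<C> \<in> \<A>" if ch: "subset.chain \<A> \<C>" for \<C>
  proof -
    have "V s \<inter> V t = {}" if "s \<in> S" "S \<in> \<C>" "t \<in> T" "T \<in> \<C>" "s \<noteq> t" for s t S T
    proof -
      have "S \<subseteq> T \<or> T \<subseteq> S"
        using subset.chain_total[OF ch] that by blast
      then have "\<exists>R\<in>\<C>. s \<in> R \<and> t \<in> R"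
        using that(1-4) by (elim disjE) blast+
      then obtain R where "R \<in> \<C>" "s \<in> R" "t \<in> R"
        by blast
      moreover have "R \<in> \<A>"
        using ch \<open>R \<in> \<C>\<close> by (auto simp: subset.chain_def)
      ultimately show ?thesis
        using that by (auto simp: \<A>_def)
    qed
    then show ?thesis
      using ch by (auto simp: \<A>_def subset.chain_def)
  qed
  then obtain S where S: "S \<in> \<A>" "\<And>X. X \<in> \<A> \<Longrightarrow> S \<subseteq> X \<Longrightarrow> X = S"
    using subset_Zorn'[of \<A>] by metis
  have "U \<subseteq> closure (\<Union>s\<in>S. V s)"
  proof (rule ccontr)
    assume "\<not> ?thesis"
    define W where "W = U - closure (\<Union>s\<in>S. V s)"
    have "open W" "W \<noteq> {}" "W \<subseteq> U"
      using \<open>open U\<close> \<open>\<not> _\<close> by (auto simp: W_def intro: open_Diff)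
    then obtain s where s: "s \<in> C" "V s \<subseteq> W"
      using fine by blast
    have disj: "V s \<inter> V t = {}" if "t \<in> S" for t
      using s(2) that closure_subset[of "\<Union>s\<in>S. V s"] by (auto simp: W_def)
    have "insert s S \<in> \<A>"
      using S(1) s(1) disj by (auto simp: \<A>_def Int_commute)
    then have "s \<in> S"
      using S(2)[of "insert s S"] by blast
    then show False
      using disj[of s] op[OF s(1)] by auto
  qed
  then show ?thesis
    using that[of S] S(1) by (auto simp: \<A>_def)
qed

text \<open>This is the Banach category theorem. Although uncountably many neighbourhoods may be needed,
  a disjoint family of them is dense in \<open>U\<close>, and on disjoint open sets the \<open>n\<close>-th dense open sets can
  be glued for each \<open>n\<close> without spoiling one another.\<close>

lemma comeagre_in_local:
  assumes "open U" and loc: "\<And>p. p \<in> U \<Longrightarrow> \<exists>V. open V \<and> p \<in> V \<and> comeagre_in V D"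
  shows "comeagre_in U D"
proof -
  define C where "C = {V. open V \<and> V \<noteq> {} \<and> comeagre_in V D}"
  have fine: "\<exists>V\<in>C. id V \<subseteq> W" if W: "open W" "W \<noteq> {}" "W \<subseteq> U" for W
  proof -
    obtain p where "p \<in> W" using W by blast
    then obtain V where V: "open V" "p \<in> V" "comeagre_in V D"
      using loc W by blast
    then have "comeagre_in (V \<inter> W) D"
      by (rule_tac comeagre_in_mono[of V D]) auto
    then show ?thesis
      using V W \<open>p \<in> W\<close> by (intro bexI[of _ "V \<inter> W"]) (auto simp: C_def)
  qed
  have opC: "open (id V) \<and> id V \<noteq> {}" if "V \<in> C" for V
    using that by (simp add: C_def)
  obtain S where S: "S \<subseteq> C" "\<And>V V'. V \<in> S \<Longrightarrow> V' \<in> S \<Longrightarrow> V \<noteq> V' \<Longrightarrow> id V \<inter> id V' = {}"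
    "U \<subseteq> closure (\<Union>V\<in>S. id V)"
    by (rule disjoint_dense_subfamily[of C id U, OF opC \<open>open U\<close> fine]) auto
  have "\<exists>W. (\<forall>n::nat. open (W n) \<and> V \<subseteq> closure (W n)) \<and> V \<inter> (\<Inter>n. W n) \<subseteq> D" if "V \<in> S" for V
    using S(1) that by (auto simp: C_def comeagre_in_def)
  then obtain W where W: "\<And>V n. V \<in> S \<Longrightarrow> open (W V n)" "\<And>V n. V \<in> S \<Longrightarrow> V \<subseteq> closure (W V n)"
      "\<And>V. V \<in> S \<Longrightarrow> V \<inter> (\<Inter>n::nat. W V n) \<subseteq> D"
    by metis
  define X where "X n = (\<Union>V\<in>S. V \<inter> W V n)" for n
  have opX: "open (X n)" for n
    unfolding X_def using W(1) S(1) by (intro open_UN ballI open_Int) (auto simp: C_def)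
  have "V \<subseteq> closure (V \<inter> W V n)" if "V \<in> S" for V n
  proof -
    have "open V" using that S(1) by (auto simp: C_def)
    then have "V \<inter> closure (W V n) \<subseteq> closure (V \<inter> W V n)"
      by (rule open_Int_closure_subset)
    then show ?thesis using W(2)[OF that, of n] by blast
  qed
  moreover have "closure (V \<inter> W V n) \<subseteq> closure (X n)" if "V \<in> S" for V n
    unfolding X_def by (rule closure_mono) (use that in blast)
  ultimately have "V \<subseteq> closure (X n)" if "V \<in> S" for V n
    using that by (meson subset_trans)
  then have "(\<Union>V\<in>S. id V) \<subseteq> closure (X n)" for n
    by (simp add: Sup_least)
  then have "closure (\<Union>V\<in>S. id V) \<subseteq> closure (X n)" for n
    by (simp only: closure_minimal closed_closure)
  then have dX: "U \<subseteq> closure (X n)" for n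
    using S(3) by (meson subset_trans)
  have "p \<in> D" if p: "p \<in> (\<Inter>n. X n)" for p
  proof -
    obtain V where V: "V \<in> S" "p \<in> V" using p by (auto simp: X_def)
    have "p \<in> W V n" for n
    proof -
      obtain V' where "V' \<in> S" "p \<in> V' \<inter> W V' n" using p by (auto simp: X_def)
      then show ?thesis using S(2)[of V V'] V by auto
    qed
    then show ?thesis using W(3)[OF V(1)] V(2) by blast
  qed
  then show ?thesis
    unfolding comeagre_in_def using opX dX by (intro exI[of _ X]) auto
qed

text \<open>A strategy in the Banach-Mazur game. A position \<open>s\<close> controls the open set \<open>V s\<close>; the opponent
  picks a nonempty open \<open>W\<close> inside it and is answered by a position whose open set lies in \<open>W\<close>. The
  positions that occur at round \<open>n\<close> are thinned out to a family with disjoint and jointly dense open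
  sets, so a point that lies in the union for every \<open>n\<close> singles out one infinite play.\<close>

lemma comeagre_in_by_play:
  fixes V :: "'s \<Rightarrow> 'z::topological_space set"
  assumes start: "ok s0"
    and op: "\<And>s. ok s \<Longrightarrow> open (V s) \<and> V s \<noteq> {}"
    and answer: "\<And>s W. ok s \<Longrightarrow> open W \<Longrightarrow> W \<noteq> {} \<Longrightarrow> W \<subseteq> V s \<Longrightarrow> \<exists>t. ok t \<and> move s t \<and> V t \<subseteq> W"
    and win: "\<And>\<sigma> p. \<sigma> 0 = s0 \<Longrightarrow> (\<And>n. ok (\<sigma> n)) \<Longrightarrow> (\<And>n. move (\<sigma> n) (\<sigma> (Suc n))) \<Longrightarrow>
       (\<And>n. p \<in> V (\<sigma> n)) \<Longrightarrow> p \<in> D"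
  shows "comeagre_in (V s0) D"
proof -
  define P where "P n S \<longleftrightarrow> (\<forall>s\<in>S. ok s) \<and> (\<forall>s\<in>S. \<forall>t\<in>S. s \<noteq> t \<longrightarrow> V s \<inter> V t = {}) \<and>
     V s0 \<subseteq> closure (\<Union>s\<in>S. V s) \<and> (n = 0 \<longrightarrow> S = {s0})" for n :: nat and S
  define Q where "Q S T \<longleftrightarrow> (\<forall>t\<in>T. \<exists>s\<in>S. move s t \<and> V t \<subseteq> V s)" for S T
  have "\<exists>F. \<forall>n. P n (F n) \<and> Q (F n) (F (Suc n))"
  proof (rule dependent_nat_choice)
    show "\<exists>S. P 0 S"
      using start closure_subset by (intro exI[of _ "{s0}"]) (auto simp: P_def)
  next
    fix S n assume PS: "P n S"
    define C where "C = {t. ok t \<and> (\<exists>s\<in>S. move s t \<and> V t \<subseteq> V s)}"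
    have opC: "open (V t) \<and> V t \<noteq> {}" if "t \<in> C" for t
      using that op by (simp add: C_def)
    have fine: "\<exists>t\<in>C. V t \<subseteq> W" if W: "open W" "W \<noteq> {}" "W \<subseteq> V s0" for W
    proof -
      have "W \<inter> closure (\<Union>s\<in>S. V s) \<noteq> {}"
        using W PS by (auto simp: P_def)
      then obtain s where s: "s \<in> S" "W \<inter> V s \<noteq> {}"
        using open_Int_closure_eq_empty[OF W(1)] by blast
      have "ok s" using PS s by (auto simp: P_def)
      then obtain t where "ok t" "move s t" "V t \<subseteq> W \<inter> V s"
        using answer[of s "W \<inter> V s"] op[of s] W(1) s(2) open_Int[of W "V s"] by blast
      then show ?thesis
        using s by (intro bexI[of _ t]) (auto simp: C_def)
    qed
    have "open (V s0)" using op start by blast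
    obtain T where "T \<subseteq> C" "\<And>s t. s \<in> T \<Longrightarrow> t \<in> T \<Longrightarrow> s \<noteq> t \<Longrightarrow> V s \<inter> V t = {}"
      "V s0 \<subseteq> closure (\<Union>s\<in>T. V s)"
      by (rule disjoint_dense_subfamily[of C V "V s0", OF opC \<open>open (V s0)\<close> fine]) auto
    then show "\<exists>T. P (Suc n) T \<and> Q S T"
      by (intro exI[of _ T]) (auto simp: P_def Q_def C_def)
  qed
  then obtain F where P: "\<And>n. P n (F n)" and Q: "\<And>n. Q (F n) (F (Suc n))"
    by blast
  have "p \<in> D" if p: "p \<in> (\<Inter>n. \<Union>s\<in>F n. V s)" for p
  proof -
    have "\<forall>n. \<exists>s. s \<in> F n \<and> p \<in> V s" using p by auto
    then obtain \<sigma> where \<sigma>: "\<And>n. \<sigma> n \<in> F n" "\<And>n. p \<in> V (\<sigma> n)" by metis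
    have "move (\<sigma> n) (\<sigma> (Suc n))" for n
    proof -
      obtain s where s: "s \<in> F n" "move s (\<sigma> (Suc n))" "V (\<sigma> (Suc n)) \<subseteq> V s"
        using Q[of n] \<sigma>(1)[of "Suc n"] by (auto simp: Q_def)
      (* By disjointness the predecessor of the next position is the position already singled out. *)
      have "s = \<sigma> n"
      proof (rule ccontr)
        assume "s \<noteq> \<sigma> n"
        then have "V s \<inter> V (\<sigma> n) = {}"
          using P[of n] s(1) \<sigma>(1)[of n] by (auto simp: P_def)
        then show False using s(3) \<sigma>(2)[of n] \<sigma>(2)[of "Suc n"] by blast
      qed
      then show ?thesis using s by simp
    qed
    moreover have "\<sigma> 0 = s0" using P[of 0] \<sigma>(1)[of 0] by (auto simp: P_def)
    moreover have "ok (\<sigma> n)" for n using P[of n] \<sigma>(1)[of n] by (auto simp: P_def)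
    ultimately show ?thesis by (intro win[of \<sigma>] \<sigma>(2))
  qed
  moreover have "open (\<Union>s\<in>F n. V s)" "V s0 \<subseteq> closure (\<Union>s\<in>F n. V s)" for n
    using P[of n] op by (auto simp: P_def)
  ultimately show ?thesis
    unfolding comeagre_in_def
    by (intro exI[of _ "\<lambda>n. \<Union>s\<in>F n. V s"] conjI allI subsetI) (simp_all, blast?)
qed

text \<open>The exterior of \<open>U\<close> is added to the sets in order to make them dense in the whole space.\<close>

lemma Baire_dense_sequence:
  fixes W :: "nat \<Rightarrow> 'z::{complete_space} set"
  assumes "open U" and W: "\<And>n. open (W n)" "\<And>n. U \<subseteq> closure (W n)"
  shows "U \<subseteq> closure (U \<inter> (\<Inter>n. W n))"
proof -
  define X where "X n = W n \<union> - closure U" for n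
  have "euclidean closure_of \<Inter>(range X) = topspace (euclidean :: 'z topology)"
  proof (rule Baire_category)
    fix T assume "T \<in> range X"
    then obtain n where n: "T = X n" by blast
    have "U \<subseteq> closure (X n)"
      using W(2)[of n] closure_mono[of "W n" "X n"] by (auto simp: X_def)
    then have "closure U \<subseteq> closure (X n)" by (simp add: closure_minimal)
    moreover have "- closure U \<subseteq> closure (X n)"
      using closure_subset[of "X n"] by (auto simp: X_def)
    ultimately have "closure (X n) = UNIV" by blast
    then show "openin euclidean T \<and> euclidean closure_of T = topspace euclidean"
      using W(1) n by (auto simp: X_def open_Compl)
  qed (auto simp: completely_metrizable_space_euclidean)
  then have "U \<subseteq> U \<inter> closure (\<Inter>n. X n)" by simp
  also have "\<dots> \<subseteq> closure (U \<inter> (\<Inter>n. X n))"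
    by (rule open_Int_closure_subset[OF \<open>open U\<close>])
  also have "U \<inter> (\<Inter>n. X n) \<subseteq> U \<inter> (\<Inter>n. W n)"
    using closure_subset[of U] by (auto simp: X_def)
  then have "closure (U \<inter> (\<Inter>n. X n)) \<subseteq> closure (U \<inter> (\<Inter>n. W n))" by (rule closure_mono)
  finally show ?thesis .
qed

lemma comeagre_in_imp_dense_gdelta:
  fixes U :: "'z::complete_space set"
  assumes "open U" "comeagre_in U D"
  obtains G where "gdelta_in (top_of_set U) G" "U \<subseteq> closure G" "G \<subseteq> D"
proof -
  obtain W where W: "\<And>n::nat. open (W n)" "\<And>n. U \<subseteq> closure (W n)" "U \<inter> (\<Inter>n. W n) \<subseteq> D"
    using assms(2) by (rule comeagre_inE) (rule that)
  have "gdelta_in (top_of_set U) (\<Inter>n. U \<inter> W n)"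
    by (rule gdelta_in_Inter) (auto intro!: open_imp_gdelta_in W openin_open_Int)
  moreover have "(\<Inter>n. U \<inter> W n) = U \<inter> (\<Inter>n. W n)" by auto
  ultimately show ?thesis
    using that[of "U \<inter> (\<Inter>n. W n)"] W(3) Baire_dense_sequence[OF \<open>open U\<close> W(1,2)] by auto
qed

lemma dense_gdelta_imp_open_sequence:
  assumes "gdelta_in euclidean G" "closure G = UNIV"
  obtains O' :: "nat \<Rightarrow> 'z::topological_space set"
  where "\<And>n. open (O' n)" "\<And>n. closure (O' n) = UNIV" "(\<Inter>n. O' n) = G"
proof -
  obtain C :: "nat \<Rightarrow> 'z set" where C: "\<And>n. open (C n)" "(\<Inter>n. C n) = G"
    using assms(1) by (auto simp: gdelta_in_descending)
  have "closure (C n) = UNIV" for n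
    using closure_mono[of G "C n"] C(2) assms(2) by auto
  then show ?thesis using that C by blast
qed

section \<open>Second differences and smoothness along directions\<close>

definition lipschitz_convex :: "real \<Rightarrow> ('z::real_normed_vector \<Rightarrow> real) \<Rightarrow> bool"
  where "lipschitz_convex L \<phi> \<longleftrightarrow> convex_on UNIV \<phi> \<and> (\<forall>x y. \<phi> x - \<phi> y \<le> L * norm (x - y))"

definition second_diff :: "('z::real_vector \<Rightarrow> real) \<Rightarrow> 'z \<Rightarrow> 'z \<Rightarrow> real"
  where "second_diff \<phi> x h = \<phi> (x + h) + \<phi> (x - h) - 2 * \<phi> x"

text \<open>One \<open>t\<close> for each \<open>e\<close> is enough: for a convex function the quotient of
  \<open>second_diff \<phi> x (t *\<^sub>R h)\<close> by \<open>t\<close> is nonnegative and nondecreasing in \<open>t > 0\<close>.\<close>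

definition smooth_along :: "('z::real_vector \<Rightarrow> real) \<Rightarrow> 'z \<Rightarrow> 'z \<Rightarrow> bool"
  where "smooth_along \<phi> x h \<longleftrightarrow> (\<forall>e>0. \<exists>t>0. second_diff \<phi> x (t *\<^sub>R h) \<le> e * t)"

text \<open>A subgradient that is also the Gateaux derivative. For convex \<open>\<phi>\<close> the difference quotients
  decrease as \<open>t\<close> decreases to \<open>0\<close>, so that again a single \<open>t\<close> for each \<open>e\<close> is enough.\<close>

definition gradient_at :: "('z::real_normed_vector \<Rightarrow> real) \<Rightarrow> 'z \<Rightarrow> ('z \<Rightarrow>\<^sub>L real) \<Rightarrow> bool"
  where "gradient_at \<phi> x \<xi> \<longleftrightarrow> (\<forall>y. \<phi> x + \<xi> (y - x) \<le> \<phi> y) \<and>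
    (\<forall>h. \<forall>e>0. \<exists>t>0. \<phi> (x + t *\<^sub>R h) - \<phi> x \<le> t * (\<xi> h + e))"

lemma lipschitz_convexD:
  assumes "lipschitz_convex L \<phi>"
  shows "convex_on UNIV \<phi>" "\<phi> x - \<phi> y \<le> L * norm (x - y)" "\<bar>\<phi> x - \<phi> y\<bar> \<le> L * norm (x - y)"
proof -
  show "convex_on UNIV \<phi>" "\<phi> x - \<phi> y \<le> L * norm (x - y)"
    using assms by (auto simp: lipschitz_convex_def)
  have "\<phi> y - \<phi> x \<le> L * norm (x - y)"
    using assms norm_minus_commute[of x y] by (auto simp: lipschitz_convex_def)
  then show "\<bar>\<phi> x - \<phi> y\<bar> \<le> L * norm (x - y)"
    using \<open>\<phi> x - \<phi> y \<le> L * norm (x - y)\<close> by linarith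
qed

lemma lipschitz_convex_mono:
  assumes "lipschitz_convex L \<phi>" "L \<le> L'"
  shows "lipschitz_convex L' \<phi>"
  unfolding lipschitz_convex_def
proof (intro conjI allI)
  fix x y
  have "\<phi> x - \<phi> y \<le> L * norm (x - y)" using lipschitz_convexD(2)[OF assms(1)] .
  also have "\<dots> \<le> L' * norm (x - y)" using assms(2) by (simp add: mult_right_mono)
  finally show "\<phi> x - \<phi> y \<le> L' * norm (x - y)" .
qed (rule lipschitz_convexD(1)[OF assms(1)])

lemma lipschitz_convex_continuous:
  assumes "lipschitz_convex L \<phi>"
  shows "continuous_on S \<phi>"
proof (rule continuous_on_subset[of UNIV])
  have "\<bar>L\<bar>-lipschitz_on UNIV \<phi>"
    unfolding lipschitz_on_def dist_norm real_norm_def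
    using lipschitz_convexD(3)[OF lipschitz_convex_mono[OF assms, of "\<bar>L\<bar>"]] by auto
  then show "continuous_on UNIV \<phi>" by (rule lipschitz_on_continuous_on)
qed auto

lemma convex_on_UNIV_combination:
  assumes "convex_on UNIV \<phi>" "0 \<le> t" "t \<le> 1"
  shows "\<phi> ((1 - t) *\<^sub>R x + t *\<^sub>R y) \<le> (1 - t) * \<phi> x + t * \<phi> y"
  using convex_onD[OF assms(1), of t x y] assms by simp

lemma convex_on_UNIV_midpoint:
  assumes "convex_on UNIV (\<phi> :: 'z::real_vector \<Rightarrow> real)"
  shows "2 * \<phi> x \<le> \<phi> (x + h) + \<phi> (x - h)"
proof -
  have "(1 - 1/2) *\<^sub>R (x + h) + (1/2) *\<^sub>R (x - h) = x"
    by (simp add: algebra_simps flip: scaleR_add_left)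
  then show ?thesis
    using convex_on_UNIV_combination[OF assms, of "1/2" "x + h" "x - h"] by simp
qed

lemma second_diff_nonneg:
  assumes "convex_on UNIV \<phi>"
  shows "0 \<le> second_diff \<phi> x h"
  using convex_on_UNIV_midpoint[OF assms, of x h] by (simp add: second_diff_def)

lemma increment_scale_le:
  assumes "convex_on UNIV \<phi>" "0 \<le> s" "s \<le> 1"
  shows "\<phi> (x + s *\<^sub>R h) - \<phi> x \<le> s * (\<phi> (x + h) - \<phi> x)"
proof -
  have "(1 - s) *\<^sub>R x + s *\<^sub>R (x + h) = x + s *\<^sub>R h"
    by (simp add: algebra_simps)
  then show ?thesis
    using convex_on_UNIV_combination[OF assms, of x "x + h"] by (simp add: algebra_simps)
qed

lemma second_diff_scale_le:
  assumes "convex_on UNIV \<phi>" "0 \<le> s" "s \<le> 1"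
  shows "second_diff \<phi> x (s *\<^sub>R h) \<le> s * second_diff \<phi> x h"
  using increment_scale_le[OF assms, of x h] increment_scale_le[OF assms, of x "- h"]
  by (simp add: second_diff_def algebra_simps)

text \<open>The point \<open>x + (h + k)\<close> is the midpoint of \<open>x + 2 h\<close> and \<open>x + 2 k\<close>. Because of this, the smooth
  directions of a convex function at a point form a linear space.\<close>

lemma second_diff_add_le:
  assumes "convex_on UNIV \<phi>"
  shows "second_diff \<phi> x (h + k) \<le> (second_diff \<phi> x (2 *\<^sub>R h) + second_diff \<phi> x (2 *\<^sub>R k)) / 2"
proof -
  have *: "2 * \<phi> (x + (a + b)) \<le> \<phi> (x + 2 *\<^sub>R a) + \<phi> (x + 2 *\<^sub>R b)" for a b
    using convex_on_UNIV_midpoint[OF assms, of "x + (a + b)" "a - b"]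
    by (simp add: algebra_simps scaleR_2)
  show ?thesis
    using *[of h k] *[of "- h" "- k"]
    by (simp add: second_diff_def field_simps)
qed

lemma second_diff_perturb:
  assumes "lipschitz_convex L \<phi>"
  shows "second_diff \<phi> x h \<le> second_diff \<phi> y h + 4 * L * norm (x - y)"
  using lipschitz_convexD(3)[OF assms, of "x + h" "y + h"]
    lipschitz_convexD(3)[OF assms, of "x - h" "y - h"] lipschitz_convexD(3)[OF assms, of x y]
  by (simp add: second_diff_def abs_le_iff)

lemma smooth_alongD:
  assumes "convex_on UNIV \<phi>" "smooth_along \<phi> x h" "e > 0"
  obtains d where "d > 0" "\<And>t. 0 \<le> t \<Longrightarrow> t \<le> d \<Longrightarrow> second_diff \<phi> x (t *\<^sub>R h) \<le> e * t"
proof -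
  obtain d where d: "d > 0" "second_diff \<phi> x (d *\<^sub>R h) \<le> e * d"
    using assms by (auto simp: smooth_along_def)
  have "second_diff \<phi> x (t *\<^sub>R h) \<le> e * t" if "0 \<le> t" "t \<le> d" for t
  proof -
    have "second_diff \<phi> x ((t / d) *\<^sub>R d *\<^sub>R h) \<le> (t / d) * second_diff \<phi> x (d *\<^sub>R h)"
      by (rule second_diff_scale_le) (use assms d that in auto)
    also have "\<dots> \<le> (t / d) * (e * d)"
      using d that by (intro mult_left_mono) auto
    finally show ?thesis using d by (simp add: mult.commute)
  qed
  then show ?thesis using that d by blast
qed

lemma smooth_along_add:
  assumes cvx: "convex_on UNIV \<phi>" and h: "smooth_along \<phi> x h" and k: "smooth_along \<phi> x k"
  shows "smooth_along \<phi> x (h + k)"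
  unfolding smooth_along_def
proof (intro allI impI)
  fix e :: real assume "e > 0"
  obtain d where d: "d > 0" "\<And>t. 0 \<le> t \<Longrightarrow> t \<le> d \<Longrightarrow> second_diff \<phi> x (t *\<^sub>R h) \<le> (e/2) * t"
    using smooth_alongD[OF cvx h, of "e/2"] \<open>e > 0\<close> by auto
  obtain d' where d': "d' > 0" "\<And>t. 0 \<le> t \<Longrightarrow> t \<le> d' \<Longrightarrow> second_diff \<phi> x (t *\<^sub>R k) \<le> (e/2) * t"
    using smooth_alongD[OF cvx k, of "e/2"] \<open>e > 0\<close> by auto
  define t where "t = min d d' / 2"
  have t: "t > 0" "2 * t \<le> d" "2 * t \<le> d'" using d d' by (auto simp: t_def)
  have "second_diff \<phi> x (t *\<^sub>R (h + k)) \<le> (second_diff \<phi> x ((2 * t) *\<^sub>R h) + second_diff \<phi> x ((2 * t) *\<^sub>R k)) / 2"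
    using second_diff_add_le[OF cvx, of x "t *\<^sub>R h" "t *\<^sub>R k"] by (simp add: scaleR_add_right)
  also have "\<dots> \<le> e * t"
    using d(2)[of "2 * t"] d'(2)[of "2 * t"] t by simp
  finally show "\<exists>t>0. second_diff \<phi> x (t *\<^sub>R (h + k)) \<le> e * t" using t by blast
qed

lemma smooth_along_scaleR:
  assumes "smooth_along \<phi> x v"
  shows "smooth_along \<phi> x (s *\<^sub>R v)"
  unfolding smooth_along_def
proof (intro allI impI)
  fix e :: real assume "e > 0"
  show "\<exists>t>0. second_diff \<phi> x (t *\<^sub>R s *\<^sub>R v) \<le> e * t"
  proof (cases "s = 0")
    case True
    then show ?thesis using \<open>e > 0\<close> by (intro exI[of _ 1]) (simp add: second_diff_def)
  next
    case False
    then obtain t where t: "t > 0" "second_diff \<phi> x (t *\<^sub>R v) \<le> (e / \<bar>s\<bar>) * t"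
      using assms \<open>e > 0\<close> unfolding smooth_along_def by (metis divide_pos_pos zero_less_abs_iff)
    have "(t / \<bar>s\<bar>) *\<^sub>R s *\<^sub>R v = t *\<^sub>R v \<or> (t / \<bar>s\<bar>) *\<^sub>R s *\<^sub>R v = - (t *\<^sub>R v)"
      using False by (cases "s > 0") auto
    then have "second_diff \<phi> x ((t / \<bar>s\<bar>) *\<^sub>R s *\<^sub>R v) = second_diff \<phi> x (t *\<^sub>R v)"
      by (auto simp: second_diff_def)
    then show ?thesis using t False by (intro exI[of _ "t / \<bar>s\<bar>"]) auto
  qed
qed

lemma gateaux_imp_gradient:
  assumes cvx: "convex_on UNIV \<phi>" and "gateaux_differentiable_at \<phi> x"
  obtains \<xi> where "gradient_at \<phi> x \<xi>"
proof -
  obtain \<xi> :: "'a \<Rightarrow>\<^sub>L real"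
    where \<xi>: "\<And>y. ((\<lambda>t. \<bar>(\<phi> (x + t *\<^sub>R y) - \<phi> x) / t - \<xi> y\<bar>) \<longlongrightarrow> 0) (at 0)"
    using assms(2) by (auto simp: gateaux_differentiable_at_def)
  have ev: "\<exists>d>0. \<forall>t. 0 < t \<and> t < d \<longrightarrow> \<bar>(\<phi> (x + t *\<^sub>R y) - \<phi> x) / t - \<xi> y\<bar> < e" if "e > 0" for e y
  proof -
    have "\<forall>\<^sub>F t in at 0. \<bar>(\<phi> (x + t *\<^sub>R y) - \<phi> x) / t - \<xi> y\<bar> < e"
      using order_tendstoD(2)[OF \<xi>[of y] that] .
    then obtain d where "d > 0" "\<And>t. t \<noteq> 0 \<Longrightarrow> dist t 0 < d \<Longrightarrow> \<bar>(\<phi> (x + t *\<^sub>R y) - \<phi> x) / t - \<xi> y\<bar> < e"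
      by (auto simp: eventually_at)
    then show ?thesis by (intro exI[of _ d]) auto
  qed
  have 1: "\<phi> x + \<xi> (y - x) \<le> \<phi> y" for y
  proof (rule field_le_epsilon)
    fix e :: real assume "e > 0"
    then obtain d where d: "d > 0" "\<And>t. 0 < t \<Longrightarrow> t < d \<Longrightarrow> \<bar>(\<phi> (x + t *\<^sub>R (y - x)) - \<phi> x) / t - \<xi> (y - x)\<bar> < e"
      using ev[of e "y - x"] by blast
    define t where "t = min 1 (d / 2)"
    have t: "0 < t" "t < d" "t \<le> 1" using d by (auto simp: t_def)
    have "\<phi> (x + t *\<^sub>R (y - x)) - \<phi> x \<le> t * (\<phi> y - \<phi> x)"
      using increment_scale_le[OF cvx, of t x "y - x"] t by simp
    then have "(\<phi> (x + t *\<^sub>R (y - x)) - \<phi> x) / t \<le> \<phi> y - \<phi> x"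
      using t by (simp add: field_simps)
    then show "\<phi> x + \<xi> (y - x) \<le> \<phi> y + e"
      using d(2)[OF t(1,2)] by linarith
  qed
  have 2: "\<exists>t>0. \<phi> (x + t *\<^sub>R h) - \<phi> x \<le> t * (\<xi> h + e)" if "e > 0" for h e
  proof -
    obtain d where d: "d > 0" "\<And>t. 0 < t \<Longrightarrow> t < d \<Longrightarrow> \<bar>(\<phi> (x + t *\<^sub>R h) - \<phi> x) / t - \<xi> h\<bar> < e"
      using ev[of e h] \<open>e > 0\<close> by blast
    then have "(\<phi> (x + (d/2) *\<^sub>R h) - \<phi> x) / (d/2) < \<xi> h + e"
      using d(2)[of "d/2"] by fastforce
    then have "\<phi> (x + (d/2) *\<^sub>R h) - \<phi> x \<le> (d/2) * (\<xi> h + e)"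
      using d(1) by (simp add: field_simps)
    then show ?thesis using d(1) by (intro exI[of _ "d/2"]) auto
  qed
  show ?thesis
    using that[of \<xi>] 1 2 by (auto simp: gradient_at_def)
qed

lemma gradient_imp_smooth_along:
  assumes cvx: "convex_on UNIV \<phi>" and \<xi>: "gradient_at \<phi> x \<xi>"
  shows "smooth_along \<phi> x h"
  unfolding smooth_along_def
proof (intro allI impI)
  fix e :: real assume "e > 0"
  obtain t where t: "t > 0" "\<phi> (x + t *\<^sub>R h) - \<phi> x \<le> t * (\<xi> h + e/2)"
    using \<xi> \<open>e > 0\<close> unfolding gradient_at_def by (meson half_gt_zero)
  obtain s where s: "s > 0" "\<phi> (x + s *\<^sub>R (- h)) - \<phi> x \<le> s * (\<xi> (- h) + e/2)"
    using \<xi> \<open>e > 0\<close> unfolding gradient_at_def by (meson half_gt_zero)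
  define r where "r = min s t"
  have r: "0 < r" "r \<le> s" "r \<le> t" using s t by (auto simp: r_def)
  have scale: "\<phi> (x + r *\<^sub>R k) - \<phi> x \<le> r * c" if "\<phi> (x + u *\<^sub>R k) - \<phi> x \<le> u * c" "r \<le> u" for u k c
  proof -
    have "\<phi> (x + (r/u) *\<^sub>R u *\<^sub>R k) - \<phi> x \<le> (r/u) * (\<phi> (x + u *\<^sub>R k) - \<phi> x)"
      by (rule increment_scale_le[OF cvx]) (use r that in auto)
    also have "\<dots> \<le> (r/u) * (u * c)"
      using that r by (intro mult_left_mono) auto
    finally show ?thesis using that r by simp
  qed
  have "second_diff \<phi> x (r *\<^sub>R h) \<le> e * r"
    using scale[OF t(2) r(3)] scale[OF s(2) r(2)]
    by (simp add: second_diff_def blinfun.minus_right algebra_simps)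
  then show "\<exists>t>0. second_diff \<phi> x (t *\<^sub>R h) \<le> e * t" using r by blast
qed

text \<open>The difference quotients decrease to the one-sided derivative \<open>D\<close>, which is sublinear by
  convexity. Smoothness along \<open>h\<close> says that \<open>D (- h) = - D h\<close>, and an odd sublinear function is linear.\<close>

lemma smooth_imp_gateaux:
  assumes \<phi>: "lipschitz_convex L \<phi>" and smooth: "\<And>h. smooth_along \<phi> x h"
  shows "gateaux_differentiable_at \<phi> x"
proof -
  have cvx: "convex_on UNIV \<phi>" by (rule lipschitz_convexD[OF \<phi>])
  define q where "q h t = (\<phi> (x + t *\<^sub>R h) - \<phi> x) / t" for h t
  have q_mono: "q h s \<le> q h t" if "0 < s" "s \<le> t" for h s t
  proof -
    have "\<phi> (x + (s/t) *\<^sub>R t *\<^sub>R h) - \<phi> x \<le> (s/t) * (\<phi> (x + t *\<^sub>R h) - \<phi> x)"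
      by (rule increment_scale_le[OF cvx]) (use that in auto)
    then show ?thesis using that by (simp add: q_def field_simps)
  qed
  have q_bound: "\<bar>q h t\<bar> \<le> L * norm h" if "t > 0" for h t
  proof -
    have "\<bar>\<phi> (x + t *\<^sub>R h) - \<phi> x\<bar> \<le> L * (t * norm h)"
      using lipschitz_convexD(3)[OF \<phi>, of "x + t *\<^sub>R h" x] that by simp
    then show ?thesis using that by (simp add: q_def field_simps)
  qed
  define D where "D h = (INF t\<in>{0<..}. q h t)" for h
  have bdd: "bdd_below (q h ` {0<..})" for h
  proof (rule bdd_belowI2)
    show "- (L * norm h) \<le> q h t" if "t \<in> {0<..}" for t
      using q_bound[of t h] that by (simp add: abs_le_iff)
  qed
  have D_le: "D h \<le> q h t" if "t > 0" for h t
    unfolding D_def using that by (intro cINF_lower bdd) auto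
  have lim: "(q h \<longlongrightarrow> D h) (at_right 0)" for h
  proof (rule order_tendstoI)
    fix a assume "a < D h"
    then have "a < q h t" if "t > 0" for t using D_le[OF that, of h] by linarith
    then show "\<forall>\<^sub>F t in at_right 0. a < q h t"
      by (auto simp: eventually_at_right_field intro: exI[of _ 1])
  next
    fix a assume "D h < a"
    then obtain t where "t > 0" "q h t < a"
      unfolding D_def using cINF_less_iff[of "{0<..}" "q h" a] bdd by auto
    then have "q h s < a" if "0 < s" "s < t" for s
      using q_mono[of s t h] that by auto
    then show "\<forall>\<^sub>F t in at_right 0. q h t < a"
      using \<open>t > 0\<close> by (auto simp: eventually_at_right_field)
  qed
  have D_minus: "D (- h) = - D h" for h
  proof -
    have "((\<lambda>t. q h t + q (- h) t) \<longlongrightarrow> 0) (at_right 0)"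
    proof (rule tendstoI)
      fix e :: real assume "e > 0"
      obtain d where d: "d > 0" "\<And>t. 0 \<le> t \<Longrightarrow> t \<le> d \<Longrightarrow> second_diff \<phi> x (t *\<^sub>R h) \<le> (e/2) * t"
        using smooth_alongD[OF cvx smooth, of "e/2" h] \<open>e > 0\<close> by auto
      have "dist (q h t + q (- h) t) 0 < e" if "0 < t" "t < d" for t
      proof -
        have "q h t + q (- h) t = second_diff \<phi> x (t *\<^sub>R h) / t"
          using that by (simp add: q_def second_diff_def field_simps)
        moreover have "second_diff \<phi> x (t *\<^sub>R h) / t \<le> e / 2"
          using d(2)[of t] that by (simp add: field_simps)
        moreover have "0 \<le> second_diff \<phi> x (t *\<^sub>R h) / t"
          using second_diff_nonneg[OF cvx] that by simp
        ultimately show ?thesis using \<open>e > 0\<close> unfolding dist_real_def by linarith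
      qed
      then show "\<forall>\<^sub>F t in at_right 0. dist (q h t + q (- h) t) 0 < e"
        using d(1) by (auto simp: eventually_at_right_field)
    qed
    then have "D h + D (- h) = 0"
      using tendsto_unique[OF _ tendsto_add[OF lim lim]] by (metis trivial_limit_at_right_real)
    then show ?thesis by linarith
  qed
  have D_add_le: "D (h + k) \<le> D h + D k" for h k
  proof -
    have "D (h + k) \<le> q h (2 * t) + q k (2 * t)" if "t > 0" for t
    proof -
      have "2 * \<phi> (x + t *\<^sub>R (h + k)) \<le> \<phi> (x + (2 * t) *\<^sub>R h) + \<phi> (x + (2 * t) *\<^sub>R k)"
        using convex_on_UNIV_midpoint[OF cvx, of "x + t *\<^sub>R (h + k)" "t *\<^sub>R (h - k)"]
        by (simp add: algebra_simps flip: scaleR_add_left)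
      then have "0 \<le> (\<phi> (x + (2 * t) *\<^sub>R h) + \<phi> (x + (2 * t) *\<^sub>R k) - 2 * \<phi> (x + t *\<^sub>R (h + k))) / (2 * t)"
        using that by simp
      also have "\<dots> = q h (2 * t) + q k (2 * t) - q (h + k) t"
        using that by (simp add: q_def field_simps)
      finally have "q (h + k) t \<le> q h (2 * t) + q k (2 * t)" by simp
      then show ?thesis using D_le[OF that, of "h + k"] by linarith
    qed
    then have "D (h + k) \<le> q h t + q k t" if "t > 0" for t
      using that by (metis half_gt_zero mult.commute nonzero_eq_divide_eq zero_neq_numeral)
    then have "\<forall>\<^sub>F t in at_right 0. D (h + k) \<le> q h t + q k t"
      by (auto simp: eventually_at_right_field intro: exI[of _ 1])
    then show ?thesis
      by (intro tendsto_lowerbound[OF tendsto_add[OF lim lim]]) auto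
  qed
  have D_add: "D (h + k) = D h + D k" for h k
    using D_add_le[of h k] D_add_le[of "- h" "- k"] D_minus[of "h + k"] D_minus[of h] D_minus[of k]
    by simp
  have D_bound: "\<bar>D h\<bar> \<le> L * norm h" for h
  proof (rule tendsto_upperbound[OF tendsto_rabs[OF lim]])
    show "\<forall>\<^sub>F t in at_right 0. \<bar>q h t\<bar> \<le> L * norm h"
      using q_bound by (auto simp: eventually_at_right_field intro: exI[of _ 1])
  qed auto
  have D_pos: "D (c *\<^sub>R h) = c * D h" if "c > 0" for c h
  proof -
    have "filterlim (\<lambda>t. c * t) (at_right 0) (at_right 0)"
      using filterlim_times_pos[OF filterlim_ident, of c 0] that by simp
    then have "((\<lambda>t. q h (c * t)) \<longlongrightarrow> D h) (at_right 0)"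
      by (rule filterlim_compose[OF lim])
    then have "((\<lambda>t. c * q h (c * t)) \<longlongrightarrow> c * D h) (at_right 0)"
      by (intro tendsto_intros)
    moreover have "c * q h (c * t) = q (c *\<^sub>R h) t" for t
      using that by (simp add: q_def mult.commute)
    ultimately show ?thesis
      using tendsto_unique[OF _ lim] by (metis (lifting) ext trivial_limit_at_right_real)
  qed
  have D_0: "D 0 = 0" using D_add[of 0 0] by simp
  have D_scale: "D (c *\<^sub>R h) = c * D h" for c h
    using D_pos[of c h] D_pos[of "- c" h] D_minus[of "c *\<^sub>R h"] D_0
    by (cases c "0::real" rule: linorder_cases) auto
  have bl: "bounded_linear D"
    by (rule bounded_linear_intro[where K = L])
      (use D_add D_scale D_bound in \<open>auto simp: mult.commute\<close>)
  have app: "blinfun_apply (Blinfun D) = D"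
    by (rule bounded_linear_Blinfun_apply[OF bl])
  have "((\<lambda>t. \<bar>(\<phi> (x + t *\<^sub>R y) - \<phi> x) / t - D y\<bar>) \<longlongrightarrow> 0) (at 0)" for y
  proof -
    have right: "(q y \<longlongrightarrow> D y) (at_right 0)" by (rule lim)
    have "((\<lambda>t. - q (- y) t) \<longlongrightarrow> D y) (at_right 0)"
      using tendsto_minus[OF lim[of "- y"]] D_minus[of y] by simp
    moreover have "- q (- y) t = q y (- t)" for t
      by (simp add: q_def)
    ultimately have "((\<lambda>t. q y (- t)) \<longlongrightarrow> D y) (at_right 0)" by simp
    then have left: "(q y \<longlongrightarrow> D y) (at_left 0)"
      by (simp add: filterlim_at_left_to_right)
    have "(q y \<longlongrightarrow> D y) (at 0)"
      using left right by (simp add: filterlim_split_at)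
    then have "((\<lambda>t. \<bar>q y t - D y\<bar>) \<longlongrightarrow> 0) (at 0)"
      by (intro tendsto_rabs_zero LIM_zero)
    then show ?thesis by (simp add: q_def)
  qed
  then show ?thesis
    unfolding gateaux_differentiable_at_def by (intro exI[of _ "Blinfun D"]) (simp add: app)
qed

lemma gateaux_cong_open:
  assumes "open V" "x \<in> V" "\<And>z. z \<in> V \<Longrightarrow> f z = g z" "gateaux_differentiable_at f x"
  shows "gateaux_differentiable_at g x"
proof -
  obtain df where df: "\<And>y. ((\<lambda>t. \<bar>(f (x + t *\<^sub>R y) - f x) / t - blinfun_apply df y\<bar>) \<longlongrightarrow> 0) (at 0)"
    using assms(4) by (auto simp: gateaux_differentiable_at_def)
  have "((\<lambda>t. \<bar>(g (x + t *\<^sub>R y) - g x) / t - blinfun_apply df y\<bar>) \<longlongrightarrow> 0) (at 0)" for y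
  proof (rule Lim_transform_eventually[OF df[of y]])
    have "((\<lambda>t. x + t *\<^sub>R y) \<longlongrightarrow> x + 0 *\<^sub>R y) (at 0)"
      by (intro tendsto_intros)
    then have "\<forall>\<^sub>F t in at 0. x + t *\<^sub>R y \<in> V"
      using assms(1,2) by (simp add: tendsto_def)
    then show "\<forall>\<^sub>F t in at 0. \<bar>(f (x + t *\<^sub>R y) - f x) / t - blinfun_apply df y\<bar> =
        \<bar>(g (x + t *\<^sub>R y) - g x) / t - blinfun_apply df y\<bar>"
      by eventually_elim (simp add: assms(2,3))
  qed
  then show ?thesis by (auto simp: gateaux_differentiable_at_def)
qed

section \<open>Lipschitz convex functions\<close>

lemma lipschitz_convex_compose_affine:
  assumes \<phi>: "lipschitz_convex L \<phi>" "L \<ge> 0"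
    and T: "\<And>t x y. T ((1 - t) *\<^sub>R x + t *\<^sub>R y) = (1 - t) *\<^sub>R T x + t *\<^sub>R T y"
    and contr: "\<And>x y. norm (T x - T y) \<le> norm (x - y)"
  shows "lipschitz_convex L (\<lambda>x. \<phi> (T x))"
  unfolding lipschitz_convex_def
proof (intro conjI allI)
  show "convex_on UNIV (\<lambda>x. \<phi> (T x))"
    using convex_on_UNIV_combination[OF lipschitz_convexD(1)[OF \<phi>(1)]]
    by (intro convex_onI) (auto simp: T)
  fix x y
  have "\<phi> (T x) - \<phi> (T y) \<le> L * norm (T x - T y)" by (rule lipschitz_convexD(2)[OF \<phi>(1)])
  also have "\<dots> \<le> L * norm (x - y)" using contr \<phi>(2) by (rule mult_left_mono)
  finally show "\<phi> (T x) - \<phi> (T y) \<le> L * norm (x - y)" .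
qed

lemma lipschitz_convex_slice:
  fixes f :: "'a::real_normed_vector \<times> real \<Rightarrow> real"
  assumes "lipschitz_convex L f" "L \<ge> 0"
  shows "lipschitz_convex L (\<lambda>x. f (x + u, y))"
  by (rule lipschitz_convex_compose_affine[OF assms])
    (auto simp: algebra_simps norm_Pair simp flip: scaleR_add_left)

lemma lipschitz_convex_add_const:
  assumes "lipschitz_convex L f"
  shows "lipschitz_convex L (\<lambda>x. f x + c)"
  unfolding lipschitz_convex_def
proof (intro conjI allI)
  show "convex_on UNIV (\<lambda>x. f x + c)"
    using lipschitz_convexD(1)[OF assms] by (intro convex_on_add) (auto simp: convex_on_const)
  show "f x + c - (f y + c) \<le> L * norm (x - y)" for x y
    using lipschitz_convexD(2)[OF assms, of x y] by simp
qed

lemma lipschitz_convex_add: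
  assumes "lipschitz_convex K f" "lipschitz_convex L g"
  shows "lipschitz_convex (K + L) (\<lambda>x. f x + g x)"
  unfolding lipschitz_convex_def
proof (intro conjI allI)
  show "convex_on UNIV (\<lambda>x. f x + g x)"
    using assms by (intro convex_on_add lipschitz_convexD)
  show "f x + g x - (f y + g y) \<le> (K + L) * norm (x - y)" for x y
    using lipschitz_convexD(2)[OF assms(1), of x y] lipschitz_convexD(2)[OF assms(2), of x y]
    by (simp add: algebra_simps)
qed

lemma lipschitz_convex_functional:
  assumes "\<And>x. \<bar>blinfun_apply \<xi> x\<bar> \<le> M * norm x" "N \<ge> 0"
  shows "lipschitz_convex (N * M) (\<lambda>x. N * \<xi> (x - a))"
  unfolding lipschitz_convex_def
proof (intro conjI allI)
  show "convex_on UNIV (\<lambda>x. N * \<xi> (x - a))"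
  proof (rule convex_onI)
    fix t :: real and x y
    have "N * \<xi> ((1 - t) *\<^sub>R x + t *\<^sub>R y - a) = (1 - t) * (N * \<xi> (x - a)) + t * (N * \<xi> (y - a))"
      unfolding blinfun.diff_right blinfun.add_right blinfun.scaleR_right by (simp add: algebra_simps)
    then show "N * \<xi> ((1 - t) *\<^sub>R x + t *\<^sub>R y - a) \<le> (1 - t) * (N * \<xi> (x - a)) + t * (N * \<xi> (y - a))"
      by simp
  qed simp
  fix x y
  have "N * \<xi> (x - a) - N * \<xi> (y - a) = N * \<xi> (x - y)"
    by (simp add: blinfun.diff_right algebra_simps)
  also have "\<dots> \<le> N * (M * norm (x - y))"
    using assms(1)[of "x - y"] assms(2) by (intro mult_left_mono) auto
  finally show "N * \<xi> (x - a) - N * \<xi> (y - a) \<le> N * M * norm (x - y)" by simp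
qed

lemma lipschitz_prod:
  fixes f :: "'a::real_normed_vector \<times> real \<Rightarrow> real"
  assumes "lipschitz_convex L f" "L > 0"
  shows "f (x, y) - f (x', y') \<le> L * (norm (x - x') + \<bar>y - y'\<bar>)"
proof -
  have "f (x, y) - f (x', y') \<le> L * norm ((x, y) - (x', y'))" by (rule lipschitz_convexD(2)[OF assms(1)])
  also have "\<dots> \<le> L * (norm (x - x') + \<bar>y - y'\<bar>)"
    using norm_Pair_le[of "x - x'" "y - y'"] assms(2) by (intro mult_left_mono) auto
  finally show ?thesis .
qed

lemma lipschitz_convex_Sup:
  fixes F :: "'i \<Rightarrow> 'z::real_normed_vector \<Rightarrow> real"
  assumes "I \<noteq> {}" and F: "\<And>i. i \<in> I \<Longrightarrow> lipschitz_convex L (F i)"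
    and bdd: "\<And>x. bdd_above ((\<lambda>i. F i x) ` I)"
  shows "lipschitz_convex L (\<lambda>x. SUP i\<in>I. F i x)"
  unfolding lipschitz_convex_def
proof (intro conjI allI)
  have up: "F i x \<le> (SUP i\<in>I. F i x)" if "i \<in> I" for i x
    using that bdd by (rule cSUP_upper)
  show "convex_on UNIV (\<lambda>x. SUP i\<in>I. F i x)"
  proof (rule convex_onI)
    fix t :: real and x y assume t: "0 < t" "t < 1"
    show "(SUP i\<in>I. F i ((1 - t) *\<^sub>R x + t *\<^sub>R y)) \<le> (1 - t) * (SUP i\<in>I. F i x) + t * (SUP i\<in>I. F i y)"
    proof (rule cSUP_least[OF \<open>I \<noteq> {}\<close>])
      fix i assume "i \<in> I"
      have "F i ((1 - t) *\<^sub>R x + t *\<^sub>R y) \<le> (1 - t) * F i x + t * F i y"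
        using convex_on_UNIV_combination[OF lipschitz_convexD(1)[OF F[OF \<open>i \<in> I\<close>]], of t] t by simp
      also have "\<dots> \<le> (1 - t) * (SUP i\<in>I. F i x) + t * (SUP i\<in>I. F i y)"
        using up[OF \<open>i \<in> I\<close>] t by (intro add_mono mult_left_mono) auto
      finally show "F i ((1 - t) *\<^sub>R x + t *\<^sub>R y) \<le> (1 - t) * (SUP i\<in>I. F i x) + t * (SUP i\<in>I. F i y)" .
    qed
  qed auto
  fix x y
  have "(SUP i\<in>I. F i x) \<le> (SUP i\<in>I. F i y) + L * norm (x - y)"
  proof (rule cSUP_least[OF \<open>I \<noteq> {}\<close>])
    fix i assume "i \<in> I"
    show "F i x \<le> (SUP i\<in>I. F i y) + L * norm (x - y)"
      using lipschitz_convexD(2)[OF F[OF \<open>i \<in> I\<close>], of x y] up[OF \<open>i \<in> I\<close>, of y] by linarith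
  qed
  then show "(SUP i\<in>I. F i x) - (SUP i\<in>I. F i y) \<le> L * norm (x - y)" by linarith
qed

text \<open>On the ball of radius \<open>2 r\<close> the function oscillates by less than \<open>2\<close>. If the segment from \<open>y\<close>
  to \<open>x\<close> is prolonged by the length \<open>r\<close> beyond \<open>x\<close>, convexity bounds the slope from \<open>y\<close> to \<open>x\<close> by the
  slope of the prolonged segment, hence by \<open>2 / r\<close>.\<close>

lemma convex_on_locally_lipschitz:
  fixes f :: "'z::real_normed_vector \<Rightarrow> real"
  assumes cvx: "convex_on U f" and "open U" "continuous_on U f" "p \<in> U"
  obtains r L where "r > 0" "L \<ge> 0" "ball p r \<subseteq> U"
    "\<And>x y. x \<in> ball p r \<Longrightarrow> y \<in> ball p r \<Longrightarrow> f x - f y \<le> L * norm (x - y)"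
proof -
  have "isCont f p"
    using assms(2-4) by (simp add: continuous_on_eq_continuous_at)
  then obtain d where d: "d > 0" "\<And>x. dist x p < d \<Longrightarrow> dist (f x) (f p) < 1"
    unfolding continuous_at_eps_delta by (metis zero_less_one)
  obtain d' where d': "d' > 0" "ball p d' \<subseteq> U"
    using \<open>open U\<close> \<open>p \<in> U\<close> openE by blast
  define r where "r = min d d' / 2"
  have r: "r > 0" "2 * r \<le> d" "2 * r \<le> d'" using d d' by (auto simp: r_def)
  have osc: "f x - f y < 2" if "dist x p < 2 * r" "dist y p < 2 * r" for x y
    using d(2)[of x] d(2)[of y] that r(2) by (simp add: dist_real_def abs_le_iff abs_less_iff)
  have U: "x \<in> U" if "dist x p < 2 * r" for x
    using d'(2) r(3) that by (auto simp: dist_commute)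
  have "f x - f y \<le> (2 / r) * norm (x - y)" if xy: "x \<in> ball p r" "y \<in> ball p r" for x y
  proof (cases "x = y")
    case False
    define n where "n = norm (x - y)"
    have "n > 0" using False by (simp add: n_def)
    define z where "z = x + (r / n) *\<^sub>R (x - y)"
    have "dist z x = r"
      using \<open>n > 0\<close> r(1) by (simp add: z_def dist_norm n_def)
    then have z: "dist z p < 2 * r"
      using dist_triangle[of z p x] xy(1) by (simp add: dist_commute)
    define s where "s = n / (n + r)"
    have s: "0 \<le> s" "s \<le> 1" using \<open>n > 0\<close> r(1) by (simp_all add: s_def)
    have "x = (1 - s) *\<^sub>R y + s *\<^sub>R z"
    proof -
      have "s + s * (r / n) = 1"
        using \<open>n > 0\<close> r(1) by (simp add: s_def add_pos_pos flip: add_divide_distrib)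
      then have e: "s * (r / n) = 1 - s" by linarith
      have "(1 - s) *\<^sub>R y + s *\<^sub>R z = (1 - s) *\<^sub>R y + s *\<^sub>R x + (1 - s) *\<^sub>R (x - y)"
        unfolding z_def scaleR_add_right scaleR_scaleR e by (simp add: add.assoc)
      also have "\<dots> = x" by (simp add: algebra_simps)
      finally show ?thesis by simp
    qed
    then have "f x \<le> (1 - s) * f y + s * f z"
      using convex_onD[OF cvx, of s y z] s U[OF z] U[of y] xy(2) r(1) by (simp add: dist_commute)
    then have "f x - f y \<le> s * (f z - f y)" by (simp add: algebra_simps)
    also have "\<dots> \<le> s * 2"
      using osc[OF z, of y] xy(2) r(1) s by (intro mult_left_mono) (auto simp: dist_commute)
    also have "\<dots> \<le> (2 / r) * n"
      using \<open>n > 0\<close> r(1) by (simp add: s_def field_simps)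
    finally show ?thesis by (simp add: n_def)
  qed simp
  moreover have "ball p r \<subseteq> U" using d'(2) r by auto
  ultimately show ?thesis using that[of r "2 / r"] r(1) by auto
qed

text \<open>The infimal convolution of \<open>f\<close>, restricted to a ball on which it is \<open>L\<close>-Lipschitz, with \<open>L\<close> times
  the norm is convex and \<open>L\<close>-Lipschitz everywhere, and it coincides with \<open>f\<close> on the ball.\<close>

lemma convex_on_extension:
  fixes f :: "'z::real_normed_vector \<Rightarrow> real"
  assumes cvx: "convex_on U f" and "open U" "continuous_on U f" "p \<in> U"
  obtains r L g where "r > 0" "L > 0" "ball p r \<subseteq> U" "lipschitz_convex L g"
    "\<And>x. x \<in> ball p r \<Longrightarrow> g x = f x"
proof -
  obtain r L where r: "r > 0" "L \<ge> 0" "ball p r \<subseteq> U"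
    and lip: "\<And>x y. x \<in> ball p r \<Longrightarrow> y \<in> ball p r \<Longrightarrow> f x - f y \<le> L * norm (x - y)"
    using convex_on_locally_lipschitz[OF assms] by metis
  define B where "B = ball p r"
  define g where "g x = (INF q\<in>B. f q + L * norm (x - q))" for x
  have "p \<in> B" using r by (simp add: B_def)
  have bdd: "bdd_below ((\<lambda>q. f q + L * norm (x - q)) ` B)" for x
  proof (rule bdd_belowI2)
    fix q assume "q \<in> B"
    have "f p - f q \<le> L * norm (p - q)" using lip \<open>p \<in> B\<close> \<open>q \<in> B\<close> by (simp add: B_def)
    also have "\<dots> \<le> L * (norm (x - p) + norm (x - q))"
      using r(2) norm_triangle_ineq[of "p - x" "x - q"]
      by (intro mult_left_mono) (auto simp: norm_minus_commute)
    finally show "f p - L * norm (x - p) \<le> f q + L * norm (x - q)"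
      by (simp add: algebra_simps)
  qed
  have g_le: "g x \<le> f q + L * norm (x - q)" if "q \<in> B" for x q
    unfolding g_def using bdd that by (rule cINF_lower)
  have g_approx: "\<exists>q\<in>B. f q + L * norm (x - q) < g x + e" if "e > 0" for x e
    using cINF_less_iff[of B "\<lambda>q. f q + L * norm (x - q)" "g x + e"] bdd \<open>p \<in> B\<close> that
    by (auto simp: g_def)
  have eq: "g x = f x" if "x \<in> B" for x
  proof (rule antisym)
    show "g x \<le> f x" using g_le[OF that, of x] by simp
    show "f x \<le> g x"
      unfolding g_def using lip that \<open>p \<in> B\<close> 
      by (intro cINF_greatest) (auto simp: B_def diff_le_eq add.commute)
  qed
  have "lipschitz_convex L g"
    unfolding lipschitz_convex_def
  proof (intro conjI allI)
    show "convex_on UNIV g"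
    proof (rule convex_onI)
      fix t :: real and x y assume t: "0 < t" "t < 1"
      show "g ((1 - t) *\<^sub>R x + t *\<^sub>R y) \<le> (1 - t) * g x + t * g y"
      proof (rule field_le_epsilon)
        fix e :: real assume "e > 0"
        obtain a where a: "a \<in> B" "f a + L * norm (x - a) < g x + e" using g_approx \<open>e > 0\<close> by blast
        obtain b where b: "b \<in> B" "f b + L * norm (y - b) < g y + e" using g_approx \<open>e > 0\<close> by blast
        let ?c = "(1 - t) *\<^sub>R a + t *\<^sub>R b"
        have c: "?c \<in> B"
          using a(1) b(1) t convexD_alt[OF convex_ball, of a p r b t] by (simp add: B_def)
        have "(1 - t) *\<^sub>R x + t *\<^sub>R y - ?c = (1 - t) *\<^sub>R (x - a) + t *\<^sub>R (y - b)"
          by (simp add: algebra_simps)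
        then have n: "norm ((1 - t) *\<^sub>R x + t *\<^sub>R y - ?c) \<le> (1 - t) * norm (x - a) + t * norm (y - b)"
          using norm_triangle_ineq[of "(1 - t) *\<^sub>R (x - a)" "t *\<^sub>R (y - b)"] t by simp
        have "a \<in> U" "b \<in> U" using a(1) b(1) r(3) by (auto simp: B_def)
        then have f_c: "f ?c \<le> (1 - t) * f a + t * f b"
          using convex_onD[OF cvx, of t a b] t by simp
        have "g ((1 - t) *\<^sub>R x + t *\<^sub>R y) \<le> f ?c + L * norm ((1 - t) *\<^sub>R x + t *\<^sub>R y - ?c)"
          by (rule g_le[OF c])
        also have "\<dots> \<le> ((1 - t) * f a + t * f b) + L * ((1 - t) * norm (x - a) + t * norm (y - b))"
          using f_c r n by (intro add_mono mult_left_mono) auto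
        also have "\<dots> = (1 - t) * (f a + L * norm (x - a)) + t * (f b + L * norm (y - b))"
          by (simp add: algebra_simps)
        also have "\<dots> \<le> (1 - t) * (g x + e) + t * (g y + e)"
          by (rule add_mono[OF mult_left_mono[OF less_imp_le[OF a(2)]]
              mult_left_mono[OF less_imp_le[OF b(2)]]]) (use t in auto)
        also have "\<dots> = (1 - t) * g x + t * g y + e" by (simp add: algebra_simps)
        finally show "g ((1 - t) *\<^sub>R x + t *\<^sub>R y) \<le> (1 - t) * g x + t * g y + e" .
      qed
    qed auto
    show "g x - g y \<le> L * norm (x - y)" for x y
    proof (rule field_le_epsilon)
      fix e :: real assume "e > 0"
      obtain b where b: "b \<in> B" "f b + L * norm (y - b) < g y + e" using g_approx \<open>e > 0\<close> by blast
      have "g x \<le> f b + L * norm (x - b)" by (rule g_le[OF b(1)])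
      also have "\<dots> \<le> f b + L * (norm (x - y) + norm (y - b))"
        using r(2) norm_triangle_ineq[of "x - y" "y - b"] by (intro add_left_mono mult_left_mono) auto
      finally show "g x - g y \<le> L * norm (x - y) + e"
        using b(2) by (simp add: algebra_simps)
    qed
  qed
  then have "lipschitz_convex (L + 1) g" by (rule lipschitz_convex_mono) simp
  then show ?thesis
    using that[of r "L + 1" g] r eq by (simp add: B_def)
qed

text \<open>A convex function on a line has bounded slopes. If its second differences with step \<open>t\<close> were at
  least \<open>e t\<close> at each of many consecutive points, the slopes would grow by \<open>e\<close> at each of these points
  and so beyond any bound.\<close>

lemma comeagre_smooth_along:
  fixes \<phi> :: "'z::real_normed_vector \<Rightarrow> real"
  assumes \<phi>: "lipschitz_convex L \<phi>"
  shows "comeagre_in UNIV {x. smooth_along \<phi> x v}"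
proof -
  have cvx: "convex_on UNIV \<phi>" by (rule lipschitz_convexD[OF \<phi>])
  define W where "W n = (\<Union>t\<in>{0<..}. {x. second_diff \<phi> x (t *\<^sub>R v) < t / Suc n})" for n :: nat
  have cont: "continuous_on UNIV \<phi>" by (rule lipschitz_convex_continuous[OF \<phi>])
  have "continuous_on UNIV (\<lambda>x. second_diff \<phi> x h)" for h
    unfolding second_diff_def
    by (intro continuous_intros continuous_on_compose2[OF cont]) auto
  then have "open (W n)" for n
    unfolding W_def by (intro open_UN ballI open_Collect_less continuous_intros) auto
  moreover have "UNIV \<subseteq> closure (W n)" for n
  proof
    fix x
    show "x \<in> closure (W n)"
      unfolding closure_approachable
    proof (intro allI impI)
      fix e :: real assume "e > 0"
      show "\<exists>y\<in>W n. dist y x < e"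
      proof (rule ccontr)
        assume contra: "\<not> ?thesis"
        define l where "l = e / 2 / (norm v + 1)"
        have "l > 0" using \<open>e > 0\<close> by (simp add: l_def add_nonneg_pos)
        have lv: "l * norm v < e"
        proof -
          have "l * norm v \<le> l * (norm v + 1)" using \<open>l > 0\<close> by simp
          also have "norm v + 1 \<noteq> 0" using norm_ge_zero[of v] by linarith
          then have "l * (norm v + 1) = e / 2"
            unfolding l_def by (metis nonzero_mult_div_cancel_right times_divide_eq_left)
          finally show ?thesis using \<open>e > 0\<close> by linarith
        qed
        (* With this many equal steps on the segment of length l, the slopes s 0, ..., s m would
           differ by more than twice their bound. *)
        obtain m :: nat where m: "real m > 2 * \<bar>L\<bar> * norm v * real (Suc n)" "m > 0"
          by (metis reals_Archimedean2 gr0I less_trans of_nat_0_less_iff zero_less_one order_le_less_trans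
              abs_ge_zero mult_nonneg_nonneg norm_ge_zero of_nat_0_le_iff zero_le_numeral)
        define t where "t = l / m"
        have t: "t > 0" using \<open>l > 0\<close> m by (simp add: t_def)
        define s where "s i = (\<phi> (x + ((real i + 1) * t) *\<^sub>R v) - \<phi> (x + (real i * t) *\<^sub>R v)) / t" for i :: nat
        have step: "s i + 1 / Suc n \<le> s (Suc i)" if "i < m" for i
        proof -
          let ?y = "x + ((real i + 1) * t) *\<^sub>R v"
          have "(real i + 1) * t \<le> l"
          proof -
            have "real i + 1 \<le> real m" using that by simp
            then have "(real i + 1) * t \<le> real m * t" using t by (simp add: mult_right_mono)
            then show ?thesis using m(2) by (simp add: t_def)
          qed
          then have "(real i + 1) * t * norm v \<le> l * norm v" by (simp add: mult_right_mono)
          then have "dist ?y x < e" using lv t by (simp add: dist_norm abs_mult)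
          then have "?y \<notin> W n" using contra by blast
          have e1: "(real (Suc i) + 1) * t = (real i + 1) * t + t"
            and e2: "real i * t = (real i + 1) * t - t"
            by (simp_all add: algebra_simps)
          have "t / Suc n \<le> second_diff \<phi> ?y (t *\<^sub>R v)"
            using t \<open>?y \<notin> W n\<close> by (force simp: W_def)
          also have "second_diff \<phi> ?y (t *\<^sub>R v) = t * (s (Suc i) - s i)"
          proof -
            have y: "?y + t *\<^sub>R v = x + ((real (Suc i) + 1) * t) *\<^sub>R v" "?y - t *\<^sub>R v = x + (real i * t) *\<^sub>R v"
              by (simp_all only: e1 e2 scaleR_add_left scaleR_diff_left add.assoc add_diff_eq)
            have "t * s (Suc i) = \<phi> (x + ((real (Suc i) + 1) * t) *\<^sub>R v) - \<phi> ?y"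
              using t by (simp add: s_def add.commute)
            moreover have "t * s i = \<phi> ?y - \<phi> (x + (real i * t) *\<^sub>R v)"
              using t by (simp add: s_def)
            ultimately show ?thesis
              unfolding second_diff_def right_diff_distrib y by linarith
          qed
          finally have "t * (1 / Suc n) \<le> t * (s (Suc i) - s i)" by simp
          then have "1 / Suc n \<le> s (Suc i) - s i" using t mult_le_cancel_left_pos by blast
          then show ?thesis by linarith
        qed
        have "s 0 + i / Suc n \<le> s i" if "i \<le> m" for i
          using that
        proof (induction i)
          case (Suc i)
          then show ?case using step[of i] by (simp add: add_divide_distrib)
        qed simp
        then have "m / Suc n \<le> s m - s 0" by force
        have s_bound: "\<bar>s i\<bar> \<le> \<bar>L\<bar> * norm v" for i
        proof -
          have "(real i + 1) * t - real i * t = t" by (simp add: algebra_simps)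
          then have "x + ((real i + 1) * t) *\<^sub>R v - (x + (real i * t) *\<^sub>R v) = t *\<^sub>R v"
            by (simp flip: scaleR_diff_left)
          then have "\<bar>\<phi> (x + ((real i + 1) * t) *\<^sub>R v) - \<phi> (x + (real i * t) *\<^sub>R v)\<bar> \<le> \<bar>L\<bar> * (t * norm v)"
            using lipschitz_convexD(3)[OF lipschitz_convex_mono[OF \<phi>, of "\<bar>L\<bar>"],
                of "x + ((real i + 1) * t) *\<^sub>R v" "x + (real i * t) *\<^sub>R v"] t by simp
          then show ?thesis using t by (simp add: s_def field_simps)
        qed
        have "m / Suc n \<le> s m - s 0" by fact
        moreover have "\<bar>s m\<bar> + \<bar>s 0\<bar> \<le> 2 * \<bar>L\<bar> * norm v"
          using add_mono[OF s_bound[of m] s_bound[of 0]] by simp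
        ultimately have "m / Suc n \<le> 2 * \<bar>L\<bar> * norm v" by linarith
        then have "real m \<le> 2 * \<bar>L\<bar> * norm v * real (Suc n)"
          by (simp add: divide_le_eq del: of_nat_Suc)
        then show False using m(1) by linarith
      qed
    qed
  qed
  moreover have "(\<Inter>n. W n) \<subseteq> {x. smooth_along \<phi> x v}"
  proof
    fix x assume x: "x \<in> (\<Inter>n. W n)"
    show "x \<in> {x. smooth_along \<phi> x v}"
      unfolding smooth_along_def
    proof (intro CollectI allI impI)
      fix e :: real assume "e > 0"
      then obtain n :: nat where n: "1 / Suc n < e"
        using nat_approx_posE by blast
      obtain t where t: "t > 0" "second_diff \<phi> x (t *\<^sub>R v) < t / Suc n"
        using x by (auto simp: W_def)
      have "t / Suc n \<le> e * t"
        using mult_left_mono[of "1 / Suc n" e t] n t(1) by (simp add: mult.commute)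
      then show "\<exists>t>0. second_diff \<phi> x (t *\<^sub>R v) \<le> e * t" using t by (intro exI[of _ t]) auto
    qed
  qed
  ultimately show ?thesis
    unfolding comeagre_in_def by (intro exI[of _ W]) simp
qed

section \<open>Frechet smooth points\<close>

text \<open>A point that lies in these sets for all \<open>e > 0\<close> is Frechet smooth: by convexity the estimate at a
  single radius \<open>d\<close> passes to all smaller radii. The slack between \<open>c\<close> and \<open>e\<close> makes the set open.\<close>

definition nearly_smooth :: "('z::real_normed_vector \<Rightarrow> real) \<Rightarrow> real \<Rightarrow> 'z set"
  where "nearly_smooth \<phi> e = {x. \<exists>d>0. \<exists>c<e. \<forall>h. norm h \<le> d \<longrightarrow> second_diff \<phi> x h \<le> c * d}"

lemma open_nearly_smooth:
  assumes "lipschitz_convex L \<phi>" "L > 0"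
  shows "open (nearly_smooth \<phi> e)"
  unfolding open_dist
proof
  fix x assume "x \<in> nearly_smooth \<phi> e"
  then obtain d c where dc: "d > 0" "c < e" "\<And>h. norm h \<le> d \<Longrightarrow> second_diff \<phi> x h \<le> c * d"
    by (auto simp: nearly_smooth_def)
  define r where "r = (e - c) * d / (8 * L)"
  have "r > 0" using dc assms by (simp add: r_def)
  moreover have "y \<in> nearly_smooth \<phi> e" if "dist y x < r" for y
  proof -
    have "second_diff \<phi> y h \<le> ((c + e) / 2) * d" if "norm h \<le> d" for h
    proof -
      have "second_diff \<phi> y h \<le> second_diff \<phi> x h + 4 * L * norm (y - x)"
        by (rule second_diff_perturb[OF assms(1)])
      also have "\<dots> \<le> c * d + 4 * L * r"
        using dc(3)[OF that] \<open>dist y x < r\<close> \<open>L > 0\<close>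
        by (intro add_mono mult_left_mono) (auto simp: dist_norm)
      also have "\<dots> = ((c + e) / 2) * d"
        using \<open>L > 0\<close> by (simp add: r_def field_simps)
      finally show ?thesis .
    qed
    then show ?thesis
      using dc(1,2) unfolding nearly_smooth_def
      by (intro CollectI exI[of _ d] conjI exI[of _ "(c + e) / 2"]) auto
  qed
  ultimately show "\<exists>r>0. \<forall>y. dist y x < r \<longrightarrow> y \<in> nearly_smooth \<phi> e" by blast
qed

lemma nearly_smooth_imp_smooth_along:
  assumes cvx: "convex_on UNIV \<phi>" and x: "\<And>n::nat. x \<in> nearly_smooth \<phi> (1 / Suc n)"
  shows "smooth_along \<phi> x h"
  unfolding smooth_along_def
proof (intro allI impI)
  fix e :: real assume "e > 0"
  show "\<exists>t>0. second_diff \<phi> x (t *\<^sub>R h) \<le> e * t"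
  proof (cases "h = 0")
    case True
    then show ?thesis using \<open>e > 0\<close> by (intro exI[of _ 1]) (simp add: second_diff_def)
  next
    case False
    then obtain n :: nat where n: "1 / Suc n < e / norm h"
      using nat_approx_posE[of "e / norm h"] \<open>e > 0\<close> by auto
    obtain d c where dc: "d > 0" "c < 1 / Suc n" "\<And>h. norm h \<le> d \<Longrightarrow> second_diff \<phi> x h \<le> c * d"
      using x[of n] by (auto simp: nearly_smooth_def)
    have "second_diff \<phi> x ((d / norm h) *\<^sub>R h) \<le> c * d"
      using False dc(1) by (intro dc(3)) simp
    also have "\<dots> \<le> (e / norm h) * d"
      using dc n by (intro mult_right_mono) auto
    finally have "second_diff \<phi> x ((d / norm h) *\<^sub>R h) \<le> e * (d / norm h)" by simp
    then show ?thesis using False dc(1) by (intro exI[of _ "d / norm h"]) auto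
  qed
qed

lemma nearly_smoothD:
  assumes cvx: "convex_on UNIV \<phi>" and "x \<in> nearly_smooth \<phi> e"
  obtains d0 where "d0 > 0" "\<And>d h. 0 < d \<Longrightarrow> d \<le> d0 \<Longrightarrow> norm h \<le> d \<Longrightarrow> second_diff \<phi> x h \<le> e * d"
proof -
  obtain d0 c where dc: "d0 > 0" "c < e" "\<And>h. norm h \<le> d0 \<Longrightarrow> second_diff \<phi> x h \<le> c * d0"
    using assms(2) by (auto simp: nearly_smooth_def)
  have "second_diff \<phi> x h \<le> e * d" if d: "0 < d" "d \<le> d0" "norm h \<le> d" for d h
  proof -
    have n: "norm ((d0 / d) *\<^sub>R h) \<le> d0"
      using d dc(1) by (simp add: pos_divide_le_eq mult.commute)
    have "second_diff \<phi> x ((d / d0) *\<^sub>R (d0 / d) *\<^sub>R h) \<le> (d / d0) * second_diff \<phi> x ((d0 / d) *\<^sub>R h)"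
      by (rule second_diff_scale_le[OF cvx]) (use d in auto)
    also have "\<dots> \<le> (d / d0) * (c * d0)"
      using d dc(1) by (intro mult_left_mono dc(3) n) auto
    also have "\<dots> = c * d" using dc(1) by simp
    also have "\<dots> \<le> e * d" using dc(2) d(1) by (simp add: mult_right_mono)
    finally show ?thesis using d dc(1) by simp
  qed
  then show ?thesis using that dc(1) by blast
qed

text \<open>Let \<open>g x\<close> be the maximum over \<open>y\<close> near \<open>y0\<close> of \<open>f (x, y) - K (y - y0)^2\<close>, let \<open>x\<close> be Frechet smooth for \<open>g\<close>
  and let \<open>y\<close> be maximising. The horizontal second differences of \<open>f\<close> at \<open>(x, y)\<close> are at most those of \<open>g\<close>
  at \<open>x\<close>, and the vertical ones at most those of the parabola, hence quadratically small. Such points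
  \<open>(x, y)\<close> are dense since a large \<open>K\<close> keeps \<open>y\<close> near \<open>y0\<close>. Density is all that is needed, as
  \<open>nearly_smooth f \<epsilon>\<close> is open.\<close>

lemma comeagre_smooth_of_frechet:
  fixes f :: "'a::real_normed_vector \<times> real \<Rightarrow> real"
  assumes frechet: "\<And>(\<phi> :: 'a \<Rightarrow> real) L V. lipschitz_convex L \<phi> \<Longrightarrow> L > 0 \<Longrightarrow> open V \<Longrightarrow> V \<noteq> {} \<Longrightarrow>
      \<exists>x\<in>V. \<forall>e>0. x \<in> nearly_smooth \<phi> e"
    and f: "lipschitz_convex L f" "L > 0"
  shows "comeagre_in UNIV {p. \<forall>h. smooth_along f p h}"
proof -
  have cvx: "convex_on UNIV f" by (rule lipschitz_convexD[OF f(1)])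
  have dense: "UNIV \<subseteq> closure (nearly_smooth f \<epsilon>)" if "\<epsilon> > 0" for \<epsilon>
  proof
    fix p :: "'a \<times> real"
    obtain x0 y0 where p: "p = (x0, y0)" by (cases p)
    show "p \<in> closure (nearly_smooth f \<epsilon>)"
      unfolding closure_approachable
    proof (intro allI impI)
      fix e :: real assume "e > 0"
      (* The maximising y satisfies K * \<bar>y - y0\<bar> \<le> L. This K makes it an interior point of the
         interval of radius 1 and brings it within e / 2 of y0. *)
      define K where "K = L * (1 + 2 / e)"
      have K: "K > 0" "L < K" "L < K * (e / 2)"
        using \<open>e > 0\<close> f(2) by (simp_all add: K_def field_simps add_pos_pos)
      define I where "I = {y0 - 1 .. y0 + 1}"
      define F where "F y x = f (x, y) - K * (y - y0)\<^sup>2" for y x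
      define g where "g x = (SUP y\<in>I. F y x)" for x
      have contF: "continuous_on I (\<lambda>y. F y x)" for x
        unfolding F_def
        by (intro continuous_intros continuous_on_compose2[OF lipschitz_convex_continuous[OF f(1), of UNIV]]) auto
      have att: "\<exists>y\<in>I. \<forall>y'\<in>I. F y' x \<le> F y x" for x
        by (rule continuous_attains_sup[OF _ _ contF]) (auto simp: I_def)
      have bdd: "bdd_above ((\<lambda>y. F y x) ` I)" for x
        using att[of x] by (auto intro: bdd_aboveI2)
      have "lipschitz_convex L g"
        unfolding g_def
      proof (rule lipschitz_convex_Sup[OF _ _ bdd])
        show "lipschitz_convex L (F y)" for y
          using lipschitz_convex_add_const[OF lipschitz_convex_slice[OF f(1), of 0 y], of "- K * (y - y0)\<^sup>2"] f(2)
          by (simp add: F_def[abs_def])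
      qed (auto simp: I_def)
      then obtain x where x: "x \<in> ball x0 (e / 2)" "\<And>e. e > 0 \<Longrightarrow> x \<in> nearly_smooth g e"
        using frechet[of L g "ball x0 (e / 2)"] f(2) \<open>e > 0\<close> by auto
      have cvxg: "convex_on UNIV g" by (rule lipschitz_convexD[OF \<open>lipschitz_convex L g\<close>])
      obtain y where y: "y \<in> I" "\<And>y'. y' \<in> I \<Longrightarrow> F y' x \<le> F y x" using att[of x] by blast
      have gy: "g x = F y x"
        unfolding g_def using y by (intro cSup_eq_maximum) auto
      have ge: "F y' z \<le> g z" if "y' \<in> I" for y' z
        unfolding g_def using bdd that by (intro cSUP_upper) auto
      have near: "K * \<bar>y - y0\<bar> \<le> L"
      proof (cases "y = y0")
        case False
        have "F y0 x \<le> F y x" by (rule y(2)) (simp add: I_def)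
        then have "K * (y - y0)\<^sup>2 \<le> f (x, y) - f (x, y0)" by (simp add: F_def)
        also have "\<dots> \<le> L * \<bar>y - y0\<bar>"
          using lipschitz_convexD(2)[OF f(1), of "(x, y)" "(x, y0)"] by (simp add: norm_Pair)
        finally have "(K * \<bar>y - y0\<bar>) * \<bar>y - y0\<bar> \<le> L * \<bar>y - y0\<bar>"
          by (simp add: power2_eq_square mult.assoc flip: abs_mult)
        then show ?thesis using False by simp
      qed (use f(2) in simp)
      have "K * \<bar>y - y0\<bar> < K * 1" "K * \<bar>y - y0\<bar> < K * (e / 2)"
        using near K by linarith+
      then have y_near: "\<bar>y - y0\<bar> < 1" "\<bar>y - y0\<bar> < e / 2"
        using K(1) mult_less_cancel_left_pos by blast+
      have "dist (x, y) p < e"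
        using x(1) y_near(2) norm_Pair_le[of "x - x0" "y - y0"]
        by (simp add: p dist_norm norm_minus_commute)
      moreover have "(x, y) \<in> nearly_smooth f \<epsilon>"
      proof -
        obtain d0 where d0: "d0 > 0"
          "\<And>d h. 0 < d \<Longrightarrow> d \<le> d0 \<Longrightarrow> norm h \<le> d \<Longrightarrow> second_diff g x h \<le> (\<epsilon> / 4) * d"
          using nearly_smoothD[OF cvxg x(2)[of "\<epsilon> / 4"]] \<open>\<epsilon> > 0\<close> by auto
        define d where "d = min (d0 / 2) (min ((1 - \<bar>y - y0\<bar>) / 2) (\<epsilon> / (16 * K)))"
        have d: "0 < d" "2 * d \<le> d0" "2 * d \<le> 1 - \<bar>y - y0\<bar>" "4 * K * d \<le> \<epsilon> / 4"
        proof -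
          have "d \<le> \<epsilon> / (16 * K)" by (simp add: d_def)
          then show "4 * K * d \<le> \<epsilon> / 4" using K(1) by (simp add: field_simps)
          have "d \<le> (1 - \<bar>y - y0\<bar>) / 2"
            unfolding d_def by (rule order_trans[OF min.cobounded2 min.cobounded1])
          moreover have "d \<le> d0 / 2"
            unfolding d_def by (rule min.cobounded1)
          ultimately show "2 * d \<le> 1 - \<bar>y - y0\<bar>" "2 * d \<le> d0" by simp_all
        qed (use d0 y_near K \<open>\<epsilon> > 0\<close> in \<open>auto simp: d_def\<close>)
        have "second_diff f (x, y) k \<le> (\<epsilon> / 2) * d" if k: "norm k \<le> d" for k
        proof -
          obtain h s where hs: "k = (h, s)" by (cases k)
          have h: "norm h \<le> d" and s: "\<bar>s\<bar> \<le> d"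
            using k norm_fst_le[of h s] norm_snd_le[of s h] by (simp_all add: hs)
          have "second_diff f (x, y) (2 *\<^sub>R (h, 0)) \<le> second_diff g x (2 *\<^sub>R h)"
            using ge[OF y(1), of "x + 2 *\<^sub>R h"] ge[OF y(1), of "x - 2 *\<^sub>R h"] gy
            by (simp add: second_diff_def F_def)
          also have "\<dots> \<le> (\<epsilon> / 4) * (2 * d)"
            using d h by (intro d0(2)) auto
          finally have 1: "second_diff f (x, y) (2 *\<^sub>R (h, 0)) \<le> (\<epsilon> / 2) * d" by simp
          have in_I: "y + 2 * s \<in> I" "y - 2 * s \<in> I"
            using d(3) s by (auto simp: I_def)
          have "second_diff f (x, y) (2 *\<^sub>R (0, s)) \<le>
              K * (y + 2 * s - y0)\<^sup>2 + K * (y - 2 * s - y0)\<^sup>2 - 2 * (K * (y - y0)\<^sup>2)"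
            using y(2)[OF in_I(1)] y(2)[OF in_I(2)] by (simp add: second_diff_def F_def)
          also have "\<dots> = 8 * K * s\<^sup>2" by (simp add: power2_eq_square algebra_simps)
          also have "\<dots> \<le> 8 * K * (d * d)"
            using K(1) abs_le_square_iff[of s d] s d(1) by (simp add: power2_eq_square)
          also have "\<dots> = 2 * (4 * K * d) * d" by simp
          also have "\<dots> \<le> 2 * (\<epsilon> / 4) * d" using d(1,4) by (intro mult_right_mono) auto
          finally have 2: "second_diff f (x, y) (2 *\<^sub>R (0, s)) \<le> (\<epsilon> / 2) * d" by simp
          have "second_diff f (x, y) ((h, 0) + (0, s)) \<le>
              (second_diff f (x, y) (2 *\<^sub>R (h, 0)) + second_diff f (x, y) (2 *\<^sub>R (0, s))) / 2"
            by (rule second_diff_add_le[OF cvx])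
          also have "\<dots> \<le> ((\<epsilon> / 2) * d + (\<epsilon> / 2) * d) / 2"
            using 1 2 by (intro divide_right_mono add_mono) simp_all
          finally have "second_diff f (x, y) ((h, 0) + (0, s)) \<le> (\<epsilon> / 2) * d" by simp
          then show ?thesis by (simp add: hs)
        qed
        then show ?thesis
          using d(1) \<open>\<epsilon> > 0\<close> unfolding nearly_smooth_def
          by (intro CollectI exI[of _ d] conjI exI[of _ "\<epsilon> / 2"]) auto
      qed
      ultimately show "\<exists>q\<in>nearly_smooth f \<epsilon>. dist q p < e" by blast
    qed
  qed
  show ?thesis
    unfolding comeagre_in_def
  proof (intro exI[of _ "\<lambda>n. nearly_smooth f (1 / Suc n)"] conjI allI)
    show "open (nearly_smooth f (1 / real (Suc n)))" for n
      by (rule open_nearly_smooth[OF f])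
    show "UNIV \<subseteq> closure (nearly_smooth f (1 / real (Suc n)))" for n
      by (rule dense) simp
    show "UNIV \<inter> (\<Inter>n. nearly_smooth f (1 / real (Suc n))) \<subseteq> {p. \<forall>h. smooth_along f p h}"
      using nearly_smooth_imp_smooth_along[OF cvx] by blast
  qed
qed

text \<open>If the open sets \<open>nearly_smooth \<phi> (1 / Suc n)\<close> were all dense in \<open>V\<close>, Baire's theorem would
  provide a Frechet smooth point in \<open>V\<close>. So one of them misses a ball, and there the second
  differences are large at every radius.\<close>

lemma rough_ball:
  fixes \<phi> :: "'a::banach \<Rightarrow> real"
  assumes \<phi>: "lipschitz_convex L \<phi>" "L > 0" and V: "open V" "V \<noteq> {}"
    and no: "\<And>x. x \<in> V \<Longrightarrow> \<exists>e>0. x \<notin> nearly_smooth \<phi> e"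
  obtains a r e where "r > 0" "e > 0"
    "\<And>x d. x \<in> ball a r \<Longrightarrow> d > 0 \<Longrightarrow> \<exists>h. norm h \<le> d \<and> e * d < second_diff \<phi> x h"
proof -
  have "\<exists>n::nat. \<not> V \<subseteq> closure (nearly_smooth \<phi> (1 / Suc n))"
  proof (rule ccontr)
    assume "\<not> ?thesis"
    then have "V \<subseteq> closure (V \<inter> (\<Inter>n::nat. nearly_smooth \<phi> (1 / Suc n)))"
      by (intro Baire_dense_sequence V open_nearly_smooth[OF \<phi>]) blast
    then have "V \<inter> (\<Inter>n::nat. nearly_smooth \<phi> (1 / Suc n)) \<noteq> {}"
      using V(2) closure_empty by (metis subset_empty)
    then obtain x where x: "x \<in> V" "\<And>n::nat. x \<in> nearly_smooth \<phi> (1 / Suc n)"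
      by blast
    then obtain e where e: "e > 0" "x \<notin> nearly_smooth \<phi> e" using no by blast
    then obtain n :: nat where "1 / Suc n < e" using nat_approx_posE by blast
    then have "x \<in> nearly_smooth \<phi> e"
      using x(2)[of n] unfolding nearly_smooth_def by (smt (verit) mem_Collect_eq)
    then show False using e by blast
  qed
  then obtain n :: nat and a where a: "a \<in> V" "a \<notin> closure (nearly_smooth \<phi> (1 / Suc n))" by blast
  then have "open (- closure (nearly_smooth \<phi> (1 / Suc n)))" "a \<in> - closure (nearly_smooth \<phi> (1 / Suc n))"
    by auto
  then obtain r where r: "r > 0" "ball a r \<subseteq> - closure (nearly_smooth \<phi> (1 / Suc n))"
    by (meson openE)
  define e where "e = 1 / real (Suc n)"
  have "e > 0" by (simp add: e_def)
  have "\<exists>h. norm h \<le> d \<and> (e / 2) * d < second_diff \<phi> x h" if "x \<in> ball a r" "d > 0" for x d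
  proof (rule ccontr)
    assume "\<not> ?thesis"
    then have "0 < d \<and> (\<exists>c<e. \<forall>h. norm h \<le> d \<longrightarrow> second_diff \<phi> x h \<le> c * d)"
      using \<open>d > 0\<close> \<open>e > 0\<close> by (intro conjI exI[of _ "e / 2"]) (auto simp: not_less)
    then have "x \<in> nearly_smooth \<phi> e" unfolding nearly_smooth_def by blast
    then show False using that(1) r(2) closure_subset unfolding e_def by blast
  qed
  then show ?thesis using that[of r "e / 2" a] r(1) \<open>e > 0\<close> by auto
qed

section \<open>Separating a new gradient from finitely many old ones\<close>

text \<open>The set of all pairs \<open>(u x, v x)\<close> is convex and does not meet the open positive quadrant. A
  separating line has a normal with nonnegative coordinates; scaled to sum \<open>1\<close>, these are the weights.\<close>

lemma two_functional_minimax: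
  fixes u v :: "'a::real_vector \<Rightarrow> real"
  assumes "convex A"
    and u: "\<And>t x y. u ((1 - t) *\<^sub>R x + t *\<^sub>R y) = (1 - t) * u x + t * u y"
    and v: "\<And>t x y. v ((1 - t) *\<^sub>R x + t *\<^sub>R y) = (1 - t) * v x + t * v y"
    and small: "\<And>x. x \<in> A \<Longrightarrow> u x \<le> 0 \<or> v x \<le> 0"
  obtains s where "0 \<le> s" "s \<le> 1" "\<And>x. x \<in> A \<Longrightarrow> (1 - s) * u x + s * v x \<le> 0"
proof (cases "A = {}")
  case True
  then show ?thesis using that[of 0] by simp
next
  case False
  define S where "S = (\<lambda>x. (u x, v x)) ` A"
  define Q where "Q = {(s, t). (0::real) < s \<and> (0::real) < t}"
  have "convex S"
    unfolding convex_alt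
  proof (intro ballI allI impI)
    fix p q and t :: real assume "p \<in> S" "q \<in> S" and t: "0 \<le> t \<and> t \<le> 1"
    then obtain x y where xy: "x \<in> A" "y \<in> A" "p = (u x, v x)" "q = (u y, v y)" by (auto simp: S_def)
    have "(1 - t) *\<^sub>R x + t *\<^sub>R y \<in> A" using convexD_alt[OF \<open>convex A\<close> xy(1,2)] t by simp
    moreover have "(1 - t) *\<^sub>R p + t *\<^sub>R q =
        (u ((1 - t) *\<^sub>R x + t *\<^sub>R y), v ((1 - t) *\<^sub>R x + t *\<^sub>R y))"
      by (simp add: xy u v)
    ultimately show "(1 - t) *\<^sub>R p + t *\<^sub>R q \<in> S" by (auto simp: S_def)
  qed
  moreover have "Q = {0<..} \<times> {0<..}" by (auto simp: Q_def)
  then have "convex Q" by (simp add: convex_Times)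
  moreover have "(1, 1) \<in> Q" by (simp add: Q_def)
  moreover have "S \<inter> Q = {}" using small by (force simp: S_def Q_def)
  moreover have "S \<noteq> {}" using False by (simp add: S_def)
  ultimately obtain a b where a: "a \<noteq> 0" "\<And>p. p \<in> S \<Longrightarrow> inner a p \<le> b" "\<And>p. p \<in> Q \<Longrightarrow> b \<le> inner a p"
    using separating_hyperplane_sets[of S Q] by blast
  obtain \<alpha> \<beta> where ab: "a = (\<alpha>, \<beta>)" by (cases a)
  have Q: "b \<le> \<alpha> * s + \<beta> * t" if "s > 0" "t > 0" for s t
    using a(3)[of "(s, t)"] that by (simp add: Q_def ab)
  have "b \<le> 0"
  proof (rule field_le_epsilon)
    fix e :: real assume "e > 0"
    define s where "s = e / (\<bar>\<alpha>\<bar> + \<bar>\<beta>\<bar> + 1)"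
    have "s > 0" using \<open>e > 0\<close> by (simp add: s_def add_nonneg_pos)
    have "b \<le> \<alpha> * s + \<beta> * s" by (rule Q) fact+
    also have "\<dots> \<le> (\<bar>\<alpha>\<bar> + \<bar>\<beta>\<bar> + 1) * s"
      using \<open>s > 0\<close> by (simp add: mult_right_mono flip: distrib_right)
    also have "\<dots> = e"
      unfolding s_def by (simp add: add_nonneg_eq_0_iff)
    finally show "b \<le> 0 + e" by simp
  qed
  have nonneg: "0 \<le> \<gamma>" if "\<And>s. s > 0 \<Longrightarrow> b \<le> \<gamma> * s + \<delta>" for \<gamma> \<delta> :: real
  proof (rule ccontr)
    assume "\<not> 0 \<le> \<gamma>"
    define s where "s = (\<bar>\<delta>\<bar> + \<bar>b\<bar> + 1) / (- \<gamma>)"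
    have "s > 0" unfolding s_def using \<open>\<not> 0 \<le> \<gamma>\<close> by (intro divide_pos_pos add_nonneg_pos) auto
    have "\<gamma> * s = - (\<bar>\<delta>\<bar> + \<bar>b\<bar> + 1)" using \<open>\<not> 0 \<le> \<gamma>\<close> by (simp add: s_def)
    then show False using that[OF \<open>s > 0\<close>] by linarith
  qed
  have "0 \<le> \<alpha>" using Q[of _ 1] by (intro nonneg[of \<alpha> "\<beta> * 1"]) auto
  moreover have "0 \<le> \<beta>" using Q[of 1] by (intro nonneg[of \<beta> "\<alpha> * 1"]) (auto simp: add.commute)
  moreover have "\<alpha> \<noteq> 0 \<or> \<beta> \<noteq> 0" using a(1) by (auto simp: ab zero_prod_def)
  ultimately have pos: "\<alpha> + \<beta> > 0" by linarith
  define s where "s = \<beta> / (\<alpha> + \<beta>)"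
  have s1: "1 - s = \<alpha> / (\<alpha> + \<beta>)" using pos by (simp add: s_def field_simps)
  have "0 \<le> s" "s \<le> 1" using \<open>0 \<le> \<alpha>\<close> \<open>0 \<le> \<beta>\<close> pos by (simp_all add: s_def)
  moreover have "(1 - s) * u x + s * v x \<le> 0" if "x \<in> A" for x
  proof -
    have "\<alpha> * u x + \<beta> * v x \<le> 0"
      using a(2)[of "(u x, v x)"] that \<open>b \<le> 0\<close> by (simp add: S_def ab)
    then have "(\<alpha> * u x + \<beta> * v x) / (\<alpha> + \<beta>) \<le> 0"
      using pos by (simp add: divide_nonpos_pos)
    then show ?thesis by (simp add: s1 add_divide_distrib) (simp add: s_def)
  qed
  ultimately show ?thesis using that by blast
qed

text \<open>The minimax theorem for finitely many functionals, in which the set \<open>A\<close> is merely convex. In the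
  induction the remaining functionals take care of the part of \<open>A\<close> where \<open>\<zeta>1\<close> fails, which is convex; the
  single functional found for it is then combined with \<open>\<zeta>1\<close>.\<close>

lemma finite_functional_minimax:
  fixes \<xi> :: "'a::real_normed_vector \<Rightarrow>\<^sub>L real" and \<Xi> :: "('a \<Rightarrow>\<^sub>L real) set"
  assumes "finite \<Xi>" "\<Xi> \<noteq> {}" "convex A" "\<And>x. x \<in> A \<Longrightarrow> \<exists>\<zeta>\<in>\<Xi>. \<xi> x \<le> \<zeta> x + b"
  shows "\<exists>\<zeta>\<in>convex hull \<Xi>. \<forall>x\<in>A. \<xi> x \<le> \<zeta> x + b"
  using assms
proof (induction \<Xi> arbitrary: A rule: finite_ne_induct)
  case (singleton \<zeta>)
  then show ?case by auto
next
  case (insert \<zeta>1 \<Xi>)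
  define A' where "A' = A \<inter> {x. (\<zeta>1 - \<xi>) x < - b}"
  have "convex A'"
    unfolding A'_def
  proof (intro convex_Int insert.prems(1))
    show "convex {x. blinfun_apply (\<zeta>1 - \<xi>) x < - b}"
      unfolding convex_alt
    proof (intro ballI allI impI, clarify)
      fix x y t assume x: "blinfun_apply (\<zeta>1 - \<xi>) x < - b" and y: "blinfun_apply (\<zeta>1 - \<xi>) y < - b"
        and t: "0 \<le> t" "t \<le> (1::real)"
      have "blinfun_apply (\<zeta>1 - \<xi>) ((1 - t) *\<^sub>R x + t *\<^sub>R y) =
          (1 - t) * blinfun_apply (\<zeta>1 - \<xi>) x + t * blinfun_apply (\<zeta>1 - \<xi>) y"
        by (simp add: blinfun.add_right blinfun.scaleR_right)
      also have "\<dots> < - b"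
        using convex_bound_lt[OF x y, of "1 - t" t] t by simp
      finally show "blinfun_apply (\<zeta>1 - \<xi>) ((1 - t) *\<^sub>R x + t *\<^sub>R y) < - b" .
    qed
  qed
  moreover have "\<exists>\<zeta>\<in>\<Xi>. \<xi> x \<le> \<zeta> x + b" if "x \<in> A'" for x
  proof -
    have "\<not> \<xi> x \<le> \<zeta>1 x + b" using that by (simp add: A'_def blinfun.diff_left)
    then show ?thesis using insert.prems(2)[of x] that by (auto simp: A'_def)
  qed
  ultimately obtain \<zeta>2 where \<zeta>2: "\<zeta>2 \<in> convex hull \<Xi>" "\<And>x. x \<in> A' \<Longrightarrow> \<xi> x \<le> \<zeta>2 x + b"
    using insert.IH by metis
  define u where "u \<zeta> x = \<xi> x - blinfun_apply \<zeta> x - b" for \<zeta> x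
  have aff: "u \<zeta> ((1 - t) *\<^sub>R x + t *\<^sub>R y) = (1 - t) * u \<zeta> x + t * u \<zeta> y" for \<zeta> t x y
    unfolding u_def blinfun.add_right blinfun.scaleR_right by (simp add: algebra_simps)
  have "u \<zeta>1 x \<le> 0 \<or> u \<zeta>2 x \<le> 0" if "x \<in> A" for x
  proof (cases "x \<in> A'")
    case True
    then show ?thesis using \<zeta>2(2)[of x] by (simp add: u_def)
  next
    case False
    then have "\<not> \<zeta>1 x - \<xi> x < - b" using that by (simp add: A'_def blinfun.diff_left)
    then show ?thesis unfolding u_def by linarith
  qed
  then obtain s where s: "0 \<le> s" "s \<le> 1" "\<And>x. x \<in> A \<Longrightarrow> (1 - s) * u \<zeta>1 x + s * u \<zeta>2 x \<le> 0"
    using two_functional_minimax[of A "u \<zeta>1" "u \<zeta>2", OF insert.prems(1) aff aff] by metis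
  define \<zeta> where "\<zeta> = (1 - s) *\<^sub>R \<zeta>1 + s *\<^sub>R \<zeta>2"
  have "\<zeta>1 \<in> convex hull insert \<zeta>1 \<Xi>" "\<zeta>2 \<in> convex hull insert \<zeta>1 \<Xi>"
    using \<zeta>2(1) hull_mono[of \<Xi> "insert \<zeta>1 \<Xi>" convex] by (auto intro: hull_inc)
  then have "\<zeta> \<in> convex hull insert \<zeta>1 \<Xi>"
    unfolding \<zeta>_def using s convexD_alt[OF convex_convex_hull] by metis
  moreover have "\<xi> x \<le> \<zeta> x + b" if "x \<in> A" for x
  proof -
    have "(1 - s) * u \<zeta>1 x + s * u \<zeta>2 x = \<xi> x - \<zeta> x - b"
      unfolding u_def \<zeta>_def blinfun.add_left blinfun.scaleR_left by (simp add: algebra_simps)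
    then show ?thesis using s(3)[OF that] by simp
  qed
  ultimately show ?case by blast
qed

text \<open>Finitely many nowhere dense sets do not cover a nonempty open set. This is used in place of Baire's
  theorem for the set of points of Gateaux differentiability, which is merely dense.\<close>

lemma finite_closed_cover_interior:
  fixes S :: "'i \<Rightarrow> 'z::topological_space set"
  assumes "finite C" "open W" "W \<noteq> {}" "W \<subseteq> (\<Union>i\<in>C. closure (S i))"
  shows "\<exists>i\<in>C. \<exists>W'. open W' \<and> W' \<noteq> {} \<and> W' \<subseteq> W \<and> W' \<subseteq> closure (S i)"
  using assms
proof (induction C arbitrary: W)
  case (insert i C)
  show ?case
  proof (cases "W \<subseteq> closure (S i)")
    case True
    then show ?thesis using insert.prems by blast
  next
    case False
    have "open (W - closure (S i))" using insert.prems by (simp add: open_Diff)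
    moreover have "W - closure (S i) \<noteq> {}" using False by blast
    moreover have "W - closure (S i) \<subseteq> (\<Union>i\<in>C. closure (S i))" using insert.prems(3) by blast
    ultimately show ?thesis using insert.IH[of "W - closure (S i)"] by blast
  qed
qed simp

text \<open>Otherwise, for each gradient \<open>\<xi>\<close> at a point of \<open>W\<close>, minimax gives an element of the convex hull of
  \<open>\<Xi>\<close> that is smaller than \<open>\<xi>\<close> by at most \<open>c\<close> on the unit ball. The hull is compact, hence up to another
  \<open>c\<close> finitely many \<open>\<zeta>\<close> suffice for all gradients, and one of them serves a dense set of points of some
  open \<open>W'\<close>. The subgradient inequality turns this into \<open>\<phi> y - \<phi> x \<le> \<zeta> (y - x) + 2 c \<parallel>y - x\<parallel>\<close> for all
  \<open>y \<in> W'\<close>, which contradicts the roughness of \<open>\<phi>\<close> in \<open>W'\<close>.\<close>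

lemma separated_gradient:
  fixes \<phi> :: "'a::real_normed_vector \<Rightarrow> real"
  assumes \<phi>: "lipschitz_convex M \<phi>"
    and grad: "\<And>W. open W \<Longrightarrow> W \<noteq> {} \<Longrightarrow> \<exists>x\<in>W. \<exists>\<xi>. gradient_at \<phi> x \<xi>"
    and rough: "\<And>x d. x \<in> B \<Longrightarrow> d > 0 \<Longrightarrow> \<exists>h. norm h \<le> d \<and> 4 * c * d < second_diff \<phi> x h"
    and "c > 0" and W: "open W" "W \<noteq> {}" "W \<subseteq> B"
    and \<Xi>: "finite \<Xi>" "\<Xi> \<noteq> {}"
  shows "\<exists>x\<in>W. \<exists>\<xi> h. gradient_at \<phi> x \<xi> \<and> norm h \<le> 1 \<and> (\<forall>\<zeta>\<in>\<Xi>. c \<le> (\<xi> - \<zeta>) h)"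
proof (rule ccontr)
  assume contra: "\<not> ?thesis"
  define S where "S \<zeta> = {x \<in> W. \<exists>\<xi>. gradient_at \<phi> x \<xi> \<and> (\<forall>h. \<xi> h \<le> blinfun_apply \<zeta> h + 2 * c * norm h)}" for \<zeta>
  have "compact (convex hull \<Xi>)" by (rule finite_imp_compact_convex_hull[OF \<Xi>(1)])
  then obtain C where C: "finite C" "convex hull \<Xi> \<subseteq> (\<Union>\<zeta>\<in>C. ball \<zeta> c)"
    using \<open>c > 0\<close> unfolding compact_eq_totally_bounded by blast
  have in_S: "\<exists>\<zeta>\<in>C. x \<in> S \<zeta>" if "x \<in> W" "gradient_at \<phi> x \<xi>" for x \<xi>
  proof -
    have "\<exists>\<zeta>\<in>\<Xi>. \<xi> h \<le> \<zeta> h + c" if "h \<in> cball 0 1" for h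
    proof -
      have "norm h \<le> 1" using that by simp
      then obtain \<zeta> where "\<zeta> \<in> \<Xi>" "\<not> c \<le> (\<xi> - \<zeta>) h" using contra \<open>x \<in> W\<close> \<open>gradient_at \<phi> x \<xi>\<close> by blast
      then show ?thesis by (intro bexI[of _ \<zeta>]) (auto simp: blinfun.diff_left)
    qed
    then obtain \<zeta>0 where \<zeta>0: "\<zeta>0 \<in> convex hull \<Xi>" "\<And>h. h \<in> cball 0 1 \<Longrightarrow> \<xi> h \<le> \<zeta>0 h + c"
      using finite_functional_minimax[OF \<Xi> convex_cball, of 0 1 \<xi> c] by blast
    obtain \<zeta> where \<zeta>: "\<zeta> \<in> C" "dist \<zeta> \<zeta>0 < c" using C(2) \<zeta>0(1) by auto
    have "\<xi> h \<le> \<zeta> h + 2 * c * norm h" for h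
    proof (cases "h = 0")
      case False
      have "\<xi> ((1 / norm h) *\<^sub>R h) \<le> \<zeta>0 ((1 / norm h) *\<^sub>R h) + c"
        by (rule \<zeta>0(2)) (use False in simp)
      then have "\<xi> h / norm h \<le> \<zeta>0 h / norm h + c"
        by (simp add: blinfun.scaleR_right)
      then have "\<xi> h \<le> \<zeta>0 h + c * norm h"
        using False by (simp add: field_simps)
      moreover have "\<bar>(\<zeta>0 - \<zeta>) h\<bar> \<le> norm (\<zeta>0 - \<zeta>) * norm h"
        using norm_blinfun[of "\<zeta>0 - \<zeta>" h] by simp
      moreover have "norm (\<zeta>0 - \<zeta>) * norm h \<le> c * norm h"
        using \<zeta>(2) by (intro mult_right_mono) (auto simp: dist_norm norm_minus_commute)
      ultimately show ?thesis by (simp add: blinfun.diff_left)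
    qed simp
    then have "x \<in> S \<zeta>" using that by (auto simp: S_def)
    then show ?thesis using \<zeta>(1) by blast
  qed
  have "W \<subseteq> closure (\<Union>\<zeta>\<in>C. S \<zeta>)"
  proof (rule ccontr)
    assume "\<not> ?thesis"
    then have "W - closure (\<Union>\<zeta>\<in>C. S \<zeta>) \<noteq> {}" by blast
    then obtain x \<xi> where "x \<in> W - closure (\<Union>\<zeta>\<in>C. S \<zeta>)" "gradient_at \<phi> x \<xi>"
      using grad[of "W - closure (\<Union>\<zeta>\<in>C. S \<zeta>)"] W(1) by (auto simp: open_Diff)
    then show False using in_S[of x \<xi>] closure_subset[of "\<Union>\<zeta>\<in>C. S \<zeta>"] by blast
  qed
  moreover have "closure (\<Union>\<zeta>\<in>C. S \<zeta>) \<subseteq> (\<Union>\<zeta>\<in>C. closure (S \<zeta>))"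
  proof (rule closure_minimal)
    show "(\<Union>\<zeta>\<in>C. S \<zeta>) \<subseteq> (\<Union>\<zeta>\<in>C. closure (S \<zeta>))"
      using closure_subset by (rule UN_mono[OF order_refl])
    show "closed (\<Union>\<zeta>\<in>C. closure (S \<zeta>))"
      using C(1) by (intro closed_UN) auto
  qed
  ultimately have "W \<subseteq> (\<Union>\<zeta>\<in>C. closure (S \<zeta>))"
    by (rule subset_trans)
  from finite_closed_cover_interior[OF C(1) W(1,2) this]
  obtain \<zeta> W' where W': "open W'" "W' \<noteq> {}" "W' \<subseteq> W" "W' \<subseteq> closure (S \<zeta>)"
    by blast
  have upper: "\<phi> y - \<phi> x \<le> \<zeta> (y - x) + 2 * c * norm (y - x)" if "y \<in> W'" for x y
  proof -
    let ?T = "{y. \<phi> y - \<phi> x \<le> \<zeta> (y - x) + 2 * c * norm (y - x)}"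
    have "closed ?T"
      by (intro closed_Collect_le continuous_intros lipschitz_convex_continuous[OF \<phi>])
    moreover have "S \<zeta> \<subseteq> ?T"
    proof
      fix z assume "z \<in> S \<zeta>"
      then obtain \<xi> where \<xi>: "gradient_at \<phi> z \<xi>" "\<And>h. \<xi> h \<le> \<zeta> h + 2 * c * norm h" by (auto simp: S_def)
      have "\<phi> z + \<xi> (x - z) \<le> \<phi> x" using \<xi>(1) by (simp add: gradient_at_def)
      moreover have "\<xi> (x - z) = - \<xi> (z - x)" by (metis blinfun.minus_right minus_diff_eq)
      ultimately show "z \<in> ?T" using \<xi>(2)[of "z - x"] by simp
    qed
    ultimately have "closure (S \<zeta>) \<subseteq> ?T" by (rule closure_minimal[rotated])
    then show ?thesis using W'(4) that by blast
  qed
  obtain x where "x \<in> W'" using W'(2) by blast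
  then obtain \<rho> where \<rho>: "\<rho> > 0" "ball x \<rho> \<subseteq> W'" using W'(1) openE by blast
  have "x \<in> B" using \<open>x \<in> W'\<close> W'(3) W(3) by blast
  then obtain h where h: "norm h \<le> \<rho> / 2" "4 * c * (\<rho> / 2) < second_diff \<phi> x h"
    using rough[of x "\<rho> / 2"] \<rho>(1) by auto
  have "x + h \<in> W'" "x - h \<in> W'"
    using h(1) \<rho> by (auto simp: dist_norm intro!: subsetD[OF \<rho>(2)])
  then have "second_diff \<phi> x h \<le> 4 * c * norm h"
    using upper[of "x + h" x] upper[of "x - h" x]
    by (simp add: second_diff_def blinfun.minus_right)
  also have "\<dots> \<le> 4 * c * (\<rho> / 2)" using h(1) \<open>c > 0\<close> by simp
  finally show False using h(2) by simp
qed

text \<open>Gradients are norm to weak-star continuous at a point of Gateaux differentiability.\<close>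

lemma gradient_near:
  assumes \<phi>: "lipschitz_convex M \<phi>" and \<xi>: "gradient_at \<phi> x \<xi>" and "e > 0"
  obtains d where "d > 0"
    "\<And>x' \<xi>'. norm (x' - x) < d \<Longrightarrow> gradient_at \<phi> x' \<xi>' \<Longrightarrow> \<bar>(\<xi>' - \<xi>) h\<bar> < e"
proof -
  obtain C where C: "C > 0" "M \<le> C"
    by (metis gt_ex less_eq_real_def max.strict_boundedE)
  have one_sided: "\<exists>d>0. \<forall>x' \<xi>'. norm (x' - x) < d \<longrightarrow> gradient_at \<phi> x' \<xi>' \<longrightarrow> \<xi>' k < \<xi> k + e" for k
  proof -
    obtain t where t: "t > 0" "\<phi> (x + t *\<^sub>R k) - \<phi> x \<le> t * (\<xi> k + e / 2)"
      using \<xi> \<open>e > 0\<close> unfolding gradient_at_def by (meson half_gt_zero)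
    define d where "d = t * (e / 2) / (2 * C)"
    have "d > 0" using t(1) \<open>e > 0\<close> C by (simp add: d_def)
    have d2: "(2 * C) * d = t * (e / 2)" using C by (simp add: d_def)
    have "\<xi>' k < \<xi> k + e" if "norm (x' - x) < d" "gradient_at \<phi> x' \<xi>'" for x' \<xi>'
    proof -
      have lip: "\<bar>\<phi> (x' + y) - \<phi> (x + y)\<bar> \<le> C * norm (x' - x)" for y
        using lipschitz_convexD(3)[OF lipschitz_convex_mono[OF \<phi> C(2)], of "x' + y" "x + y"] by simp
      have "\<phi> x' + \<xi>' (x' + t *\<^sub>R k - x') \<le> \<phi> (x' + t *\<^sub>R k)"
        using that(2) unfolding gradient_at_def by blast
      then have "t * \<xi>' k \<le> \<phi> (x' + t *\<^sub>R k) - \<phi> x'"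
        by (simp add: blinfun.scaleR_right)
      also have "\<dots> \<le> \<phi> (x + t *\<^sub>R k) - \<phi> x + 2 * C * norm (x' - x)"
        using lip[of "t *\<^sub>R k"] lip[of 0] by (simp add: abs_le_iff)
      also have "\<dots> < \<phi> (x + t *\<^sub>R k) - \<phi> x + 2 * C * d"
        using that(1) by (intro add_strict_left_mono mult_strict_left_mono) (use C in auto)
      also have "\<dots> \<le> t * (\<xi> k + e / 2) + t * (e / 2)"
        using t(2) d2 by linarith
      also have "\<dots> = t * (\<xi> k + e)" by (simp add: algebra_simps)
      finally show ?thesis using t(1) mult_less_cancel_left_pos by blast
    qed
    then show ?thesis using \<open>d > 0\<close> by blast
  qed
  obtain d1 where d1: "d1 > 0" "\<And>x' \<xi>'. norm (x' - x) < d1 \<Longrightarrow> gradient_at \<phi> x' \<xi>' \<Longrightarrow> \<xi>' h < \<xi> h + e"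
    using one_sided[of h] by blast
  obtain d2 where d2: "d2 > 0" "\<And>x' \<xi>'. norm (x' - x) < d2 \<Longrightarrow> gradient_at \<phi> x' \<xi>' \<Longrightarrow> \<xi>' (- h) < \<xi> (- h) + e"
    using one_sided[of "- h"] by blast
  have "\<bar>(\<xi>' - \<xi>) h\<bar> < e" if "norm (x' - x) < min d1 d2" "gradient_at \<phi> x' \<xi>'" for x' \<xi>'
    using d1(2)[of x' \<xi>'] d2(2)[of x' \<xi>'] that
    by (simp add: blinfun.diff_left blinfun.minus_right abs_less_iff)
  then show ?thesis using that[of "min d1 d2"] d1(1) d2(1) by auto
qed

lemma gradient_near_finite:
  assumes \<phi>: "lipschitz_convex M \<phi>" and \<xi>: "gradient_at \<phi> x \<xi>" and "e > 0" and "finite H"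
  obtains d where "d > 0"
    "\<And>x' \<xi>' h. norm (x' - x) < d \<Longrightarrow> gradient_at \<phi> x' \<xi>' \<Longrightarrow> h \<in> H \<Longrightarrow> \<bar>(\<xi>' - \<xi>) h\<bar> < e"
proof -
  have "\<exists>d>0. \<forall>x' \<xi>' h. norm (x' - x) < d \<longrightarrow> gradient_at \<phi> x' \<xi>' \<longrightarrow> h \<in> H \<longrightarrow> \<bar>(\<xi>' - \<xi>) h\<bar> < e"
    using \<open>finite H\<close>
  proof (induction H)
    case empty
    then show ?case by (intro exI[of _ 1]) auto
  next
    case (insert k H)
    then obtain d where d: "d > 0"
      "\<And>x' \<xi>' h. norm (x' - x) < d \<Longrightarrow> gradient_at \<phi> x' \<xi>' \<Longrightarrow> h \<in> H \<Longrightarrow> \<bar>(\<xi>' - \<xi>) h\<bar> < e" by blast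
    obtain d' where d': "d' > 0"
      "\<And>x' \<xi>'. norm (x' - x) < d' \<Longrightarrow> gradient_at \<phi> x' \<xi>' \<Longrightarrow> \<bar>(\<xi>' - \<xi>) k\<bar> < e"
      using gradient_near[OF \<phi> \<xi> \<open>e > 0\<close>, of k] by blast
    show ?case
      using d d' by (intro exI[of _ "min d d'"]) auto
  qed
  then show ?thesis using that by blast
qed

section \<open>Trees of gradients\<close>

text \<open>Each node has infinitely many children, one for every value of the second component of the
  decoded pair. That component is available for labelling the children.\<close>

definition par :: "nat \<Rightarrow> nat"
  where "par j = (case j of 0 \<Rightarrow> 0 | Suc m \<Rightarrow> fst (prod_decode m))"

definition descends :: "nat \<Rightarrow> nat \<Rightarrow> bool"
  where "descends w j \<longleftrightarrow> (\<exists>n. (par ^^ n) w = j)"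

lemma par_0 [simp]: "par 0 = 0" by (simp add: par_def)

lemma par_less: "j > 0 \<Longrightarrow> par j < j"
proof (cases j)
  case (Suc m)
  have "fst (prod_decode m) \<le> prod_encode (prod_decode m)"
    by (metis le_prod_encode_1 prod.collapse)
  then show ?thesis using Suc by (simp add: par_def)
qed simp

lemma descends_refl [simp]: "descends j j"
  unfolding descends_def by (rule exI[of _ 0]) simp

lemma descends_par_iff: "descends w j \<longleftrightarrow> w = j \<or> (w > 0 \<and> descends (par w) j)"
proof
  assume "descends w j"
  then obtain n where n: "(par ^^ n) w = j" by (auto simp: descends_def)
  show "w = j \<or> (w > 0 \<and> descends (par w) j)"
  proof (cases n)
    case (Suc m)
    then have "descends (par w) j" using n by (auto simp: descends_def funpow_swap1 simp del: funpow.simps)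
       (metis funpow_simps_right(2) comp_apply)
    moreover have "w = j" if "w = 0"
    proof -
      have "(par ^^ k) 0 = 0" for k by (induction k) auto
      then show ?thesis using n that by simp
    qed
    ultimately show ?thesis by auto
  qed (use n in simp)
next
  assume "w = j \<or> (w > 0 \<and> descends (par w) j)"
  then show "descends w j"
  proof
    assume "w > 0 \<and> descends (par w) j"
    then obtain n where "(par ^^ n) (par w) = j" by (auto simp: descends_def)
    then have "(par ^^ Suc n) w = j" by (metis funpow_simps_right(2) comp_apply)
    then show ?thesis unfolding descends_def by blast
  qed simp
qed

lemma descends_0 [simp]: "descends w 0"
proof (induction w rule: less_induct)
  case (less w)
  then show ?case using par_less[of w] descends_par_iff[of w 0] by auto
qed

text \<open>The labels increase strictly along a path, so the bounds on the steps form part of a geometric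
  series. The subtracted power of \<open>w\<close> makes the estimate inductive.\<close>

lemma descends_telescope:
  fixes \<delta> :: "nat \<Rightarrow> nat \<Rightarrow> real"
  assumes tri: "\<And>i. \<delta> i i = 0" "\<And>i l m. \<delta> i m \<le> \<delta> i l + \<delta> l m"
    and step: "\<And>i. j < i \<Longrightarrow> \<delta> i (par i) \<le> \<kappa> * (1/2) ^ i"
    and "\<kappa> \<ge> 0" "descends w j"
  shows "j \<le> w \<and> \<delta> w j \<le> \<kappa> * ((1/2) ^ j - (1/2) ^ w)"
  using \<open>descends w j\<close>
proof (induction w rule: less_induct)
  case (less w)
  show ?case
  proof (cases "w = j")
    case False
    then have w: "w > 0" "descends (par w) j" using less.prems descends_par_iff[of w j] by auto
    have IH: "j \<le> par w" "\<delta> (par w) j \<le> \<kappa> * ((1/2) ^ j - (1/2) ^ par w)"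
      using less.IH[OF par_less[OF w(1)] w(2)] by auto
    have "j < w" using IH(1) par_less[OF w(1)] by simp
    have "(1/2 :: real) ^ w \<le> (1/2) ^ Suc (par w)"
      using par_less[OF w(1)] by (intro power_decreasing) auto
    then have "\<kappa> * ((1/2) ^ w + (1/2) ^ w) \<le> \<kappa> * (1/2) ^ par w"
      using \<open>\<kappa> \<ge> 0\<close> by (intro mult_left_mono) auto
    then have "\<delta> w j \<le> \<kappa> * ((1/2) ^ j - (1/2) ^ w)"
      using tri(2)[of w j "par w"] step[OF \<open>j < w\<close>] IH(2) by (simp add: algebra_simps)
    then show ?thesis using \<open>j < w\<close> by simp
  qed (use tri in simp)
qed

text \<open>The path from \<open>w\<close> towards the root avoids \<open>j\<close>, so it passes only labels above \<open>j\<close> before it arrives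
  at a label \<open>i\<close> below \<open>j\<close>; these steps add up to at most \<open>\<kappa> (1/2)^j\<close>.\<close>

lemma not_descends_telescope:
  fixes \<delta> :: "nat \<Rightarrow> nat \<Rightarrow> real"
  assumes tri: "\<And>i. \<delta> i i = 0" "\<And>i l m. \<delta> i m \<le> \<delta> i l + \<delta> l m"
    and step: "\<And>i. j < i \<Longrightarrow> \<delta> i (par i) \<le> \<kappa> * (1/2) ^ i"
    and "\<kappa> \<ge> 0" "\<not> descends w j"
  shows "\<exists>i<j. \<delta> w i \<le> \<kappa> * (1/2) ^ j"
proof -
  have "\<exists>i<j. \<delta> w i \<le> \<kappa> * ((1/2) ^ j - (if w < j then 0 else (1/2) ^ w))"
    using \<open>\<not> descends w j\<close>
  proof (induction w rule: less_induct)
    case (less w)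
    then have "w \<noteq> j" by auto
    show ?case
    proof (cases "w < j")
      case True
      then show ?thesis using tri \<open>\<kappa> \<ge> 0\<close> by (intro exI[of _ w]) auto
    next
      case False
      then have w: "j < w" "w > 0" using \<open>w \<noteq> j\<close> by auto
      then have "\<not> descends (par w) j" using less.prems descends_par_iff[of w j] by auto
      then obtain i where i: "i < j" "\<delta> (par w) i \<le> \<kappa> * ((1/2) ^ j - (if par w < j then 0 else (1/2) ^ par w))"
        using less.IH[OF par_less[OF w(2)]] by auto
      have pw: "\<delta> w (par w) \<le> \<kappa> * (1/2) ^ w" using step w(1) .
      show ?thesis
      proof (cases "par w < j")
        case True
        have "(1/2 :: real) ^ w \<le> (1/2) ^ Suc j"
          using w(1) by (intro power_decreasing) auto
        then have "\<kappa> * ((1/2) ^ w + (1/2) ^ w) \<le> \<kappa> * (1/2) ^ j"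
          using \<open>\<kappa> \<ge> 0\<close> by (intro mult_left_mono) auto
        then show ?thesis
          using True pw False by (intro exI[of _ "par w"]) (simp add: algebra_simps)
      next
        case False
        have "(1/2 :: real) ^ w \<le> (1/2) ^ Suc (par w)"
          using par_less[OF w(2)] by (intro power_decreasing) auto
        then have "\<kappa> * ((1/2) ^ w + (1/2) ^ w) \<le> \<kappa> * (1/2) ^ par w"
          using \<open>\<kappa> \<ge> 0\<close> by (intro mult_left_mono) auto
        then have "\<delta> w i \<le> \<kappa> * ((1/2) ^ j - (1/2) ^ w)"
          using tri(2)[of w i "par w"] pw i(2) False by (simp add: algebra_simps)
        then show ?thesis using i(1) w(1) by (intro exI[of _ i]) simp
      qed
    qed
  qed
  then obtain i where i: "i < j" "\<delta> w i \<le> \<kappa> * ((1/2) ^ j - (if w < j then 0 else (1/2) ^ w))" by blast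
  note i(2)
  also have "\<kappa> * ((1/2) ^ j - (if w < j then 0 else (1/2) ^ w)) \<le> \<kappa> * (1/2) ^ j"
    using \<open>\<kappa> \<ge> 0\<close> by (intro mult_left_mono) auto
  finally show ?thesis using i(1) by blast
qed

text \<open>The vector \<open>h j\<close> tells \<open>\<xi> j\<close> from all functionals outside the subtree of \<open>j\<close>, but hardly
  from those inside. By the last assumption the children of \<open>i\<close>, together with their whole subtrees,
  converge to \<open>\<xi> i\<close> weakly-star.\<close>

locale gradient_tree =
  fixes \<xi> :: "nat \<Rightarrow> 'a::real_normed_vector \<Rightarrow>\<^sub>L real" and h :: "nat \<Rightarrow> 'a" and M c :: real
  assumes norm_\<xi>: "\<bar>\<xi> j x\<bar> \<le> M * norm x" and norm_h: "norm (h j) \<le> 1"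
    and c_pos: "c > 0" and M_pos: "M > 0"
    and separated: "\<not> descends w j \<Longrightarrow> c \<le> (\<xi> j - \<xi> w) (h j)"
    and coherent: "descends w j \<Longrightarrow> j > 0 \<Longrightarrow> \<bar>(\<xi> w - \<xi> j) (h j)\<bar> \<le> (1/2) ^ j"
    and convergent: "e > 0 \<Longrightarrow> \<exists>J. \<forall>j\<ge>J. par j = i \<longrightarrow> (\<forall>w. descends w j \<longrightarrow> \<bar>(\<xi> w - \<xi> i) x\<bar> < e)"

text \<open>The gradients \<open>\<xi> j\<close> at points \<open>x j\<close> are chosen one after the other. The point \<open>x j\<close> is close to
  \<open>x (par j)\<close>, and so, by weak-star continuity, \<open>\<xi> j\<close> nearly agrees with \<open>\<xi> (par j)\<close> on all previous
  vectors \<open>h m\<close>; at the same time \<open>separated_gradient\<close> provides \<open>h j\<close> on which \<open>\<xi> j\<close> exceeds all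
  previous gradients by \<open>c\<close>. A later node \<open>w\<close> outside the subtree of \<open>j\<close> takes its value at \<open>h j\<close>, up to
  small errors, from a node that precedes \<open>j\<close>, and is thus separated from \<open>\<xi> j\<close> as well.\<close>

lemma gradient_tree_exists:
  fixes \<phi> :: "'a::real_normed_vector \<Rightarrow> real"
  assumes \<phi>: "lipschitz_convex M \<phi>" "M > 0"
    and grad: "\<And>W. open W \<Longrightarrow> W \<noteq> {} \<Longrightarrow> \<exists>x\<in>W. \<exists>\<xi>. gradient_at \<phi> x \<xi>"
    and rough: "\<And>x d. x \<in> ball a r \<Longrightarrow> d > 0 \<Longrightarrow> \<exists>h. norm h \<le> d \<and> 4 * c * d < second_diff \<phi> x h"
    and "c > 0" "r > 0"
  obtains \<xi> :: "nat \<Rightarrow> 'a \<Rightarrow>\<^sub>L real" and h where "gradient_tree \<xi> h M (c / 2)"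
proof -
  (* The accumulated errors on h j stay below \<kappa>, so that c / 2 of the separation c survives. *)
  define \<kappa> where "\<kappa> = min 1 (c / 2)"
  have \<kappa>: "\<kappa> > 0" "\<kappa> \<le> 1" "\<kappa> \<le> c / 2" using \<open>c > 0\<close> by (auto simp: \<kappa>_def)
  define P where "P f j t \<longleftrightarrow> (case t of (x, \<xi>, h) \<Rightarrow> gradient_at \<phi> x \<xi> \<and> x \<in> ball a r \<and> norm h \<le> 1 \<and>
      (j > 0 \<longrightarrow> norm (x - fst (f (par j))) \<le> (1/2) ^ j \<and>
        (\<forall>m<j. \<bar>(\<xi> - fst (snd (f (par j)))) (snd (snd (f m)))\<bar> \<le> \<kappa> * (1/2) ^ j \<and>
          c \<le> (\<xi> - fst (snd (f m))) h)))"
    for f and j :: nat and t :: "'a \<times> ('a \<Rightarrow>\<^sub>L real) \<times> 'a"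
  have "\<exists>f. \<forall>j. P f j (f j)"
  proof (rule dependent_wellorder_choice)
    fix t and f g :: "nat \<Rightarrow> 'a \<times> ('a \<Rightarrow>\<^sub>L real) \<times> 'a" and j :: nat assume eq: "\<And>i. i < j \<Longrightarrow> f i = g i"
    show "P f j t = P g j t"
      using eq eq[OF par_less[of j]] by (auto simp: P_def split: prod.splits)
  next
    fix j :: nat and f :: "nat \<Rightarrow> 'a \<times> ('a \<Rightarrow>\<^sub>L real) \<times> 'a" assume IH: "\<And>i. i < j \<Longrightarrow> P f i (f i)"
    show "\<exists>t. P f j t"
    proof (cases "j = 0")
      case True
      obtain x \<xi> where "x \<in> ball a r" "gradient_at \<phi> x \<xi>"
        using grad[of "ball a r"] \<open>r > 0\<close> by auto
      then show ?thesis using True by (intro exI[of _ "(x, \<xi>, 0)"]) (simp add: P_def)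
    next
      case False
      then have "par j < j" by (simp add: par_less)
      define x0 where "x0 = fst (f (par j))"
      define \<xi>0 where "\<xi>0 = fst (snd (f (par j)))"
      have x0: "gradient_at \<phi> x0 \<xi>0" "x0 \<in> ball a r"
        using IH[OF \<open>par j < j\<close>] by (auto simp: P_def x0_def \<xi>0_def split: prod.splits)
      obtain d where d: "d > 0" "\<And>x' \<xi>' h. norm (x' - x0) < d \<Longrightarrow> gradient_at \<phi> x' \<xi>' \<Longrightarrow>
          h \<in> (\<lambda>m. snd (snd (f m))) ` {..<j} \<Longrightarrow> \<bar>(\<xi>' - \<xi>0) h\<bar> < \<kappa> * (1/2) ^ j"
        using gradient_near_finite[OF \<phi>(1) x0(1), of "\<kappa> * (1/2) ^ j" "(\<lambda>m. snd (snd (f m))) ` {..<j}"] \<kappa>(1)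
        by auto
      define W where "W = ball x0 (min d ((1/2) ^ j)) \<inter> ball a r"
      have "x0 \<in> W" using d(1) x0(2) by (simp add: W_def)
      then have "W \<noteq> {}" by blast
      moreover have "open W" "W \<subseteq> ball a r" by (simp_all add: W_def open_Int)
      ultimately have W: "open W" "W \<noteq> {}" "W \<subseteq> ball a r" by simp_all
      have \<Xi>: "finite ((\<lambda>m. fst (snd (f m))) ` {..<j})" "(\<lambda>m. fst (snd (f m))) ` {..<j} \<noteq> {}"
        using False by auto
      obtain x \<xi> h where x: "x \<in> W" "gradient_at \<phi> x \<xi>" "norm h \<le> 1"
        "\<And>m. m < j \<Longrightarrow> c \<le> (\<xi> - fst (snd (f m))) h"
        using separated_gradient[OF \<phi>(1) grad rough \<open>c > 0\<close> W \<Xi>] by auto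
      have "norm (x - x0) < d" "norm (x - x0) \<le> (1/2) ^ j"
        using x(1) by (simp_all add: W_def dist_norm norm_minus_commute)
      then have "P f j (x, \<xi>, h)"
        using x d(2)[of x \<xi>] W(3) False
        unfolding P_def x0_def \<xi>0_def by (auto intro!: less_imp_le)
      then show ?thesis by blast
    qed
  qed
  then obtain f where f: "\<And>j. P f j (f j)" by blast
  define x where "x j = fst (f j)" for j
  define \<xi> where "\<xi> j = fst (snd (f j))" for j
  define h where "h j = snd (snd (f j))" for j
  have grad\<xi>: "gradient_at \<phi> (x j) (\<xi> j)" and norm_h: "norm (h j) \<le> 1" for j
    using f[of j] by (auto simp: P_def x_def \<xi>_def h_def split: prod.splits)
  have x_step: "norm (x j - x (par j)) \<le> (1/2) ^ j"
    and \<xi>_step: "m < j \<Longrightarrow> \<bar>(\<xi> j - \<xi> (par j)) (h m)\<bar> \<le> \<kappa> * (1/2) ^ j"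
    and \<xi>_sep: "m < j \<Longrightarrow> c \<le> (\<xi> j - \<xi> m) (h j)" if "j > 0" for j m
    using f[of j] that by (auto simp: P_def x_def \<xi>_def h_def split: prod.splits)
  have \<xi>_tri: "\<bar>(\<xi> i - \<xi> m) y\<bar> \<le> \<bar>(\<xi> i - \<xi> l) y\<bar> + \<bar>(\<xi> l - \<xi> m) y\<bar>" for i l m y
    by (simp add: blinfun.diff_left)
  have x_tri: "norm (x i - x m) \<le> norm (x i - x l) + norm (x l - x m)" for i l m
    using norm_triangle_ineq[of "x i - x l" "x l - x m"] by simp
  have "gradient_tree \<xi> h M (c / 2)"
  proof
    fix j y
    have "\<phi> (x j) + \<xi> j (x j + y - x j) \<le> \<phi> (x j + y)" "\<phi> (x j) + \<xi> j (x j - y - x j) \<le> \<phi> (x j - y)"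
      using grad\<xi>[of j] unfolding gradient_at_def by blast+
    then show "\<bar>\<xi> j y\<bar> \<le> M * norm y"
      using lipschitz_convexD(2)[OF \<phi>(1), of "x j + y" "x j"] lipschitz_convexD(2)[OF \<phi>(1), of "x j - y" "x j"]
      by (simp add: blinfun.minus_right abs_le_iff)
  next
    fix w j assume w: "\<not> descends w j"
    then have "j > 0" by (cases j) auto
    obtain i where i: "i < j" "\<bar>(\<xi> w - \<xi> i) (h j)\<bar> \<le> \<kappa> * (1/2) ^ j"
      using not_descends_telescope[of "\<lambda>i l. \<bar>(\<xi> i - \<xi> l) (h j)\<bar>" j \<kappa> w] \<xi>_tri \<xi>_step w \<kappa>(1) by auto
    have "\<kappa> * (1/2) ^ j \<le> \<kappa> * 1" using \<kappa>(1) by (intro mult_left_mono power_le_one) auto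
    then show "c / 2 \<le> (\<xi> j - \<xi> w) (h j)"
      using i(2) \<xi>_sep[OF \<open>j > 0\<close> i(1)] \<kappa>(3) by (simp add: blinfun.diff_left abs_le_iff)
  next
    fix w j :: nat assume w: "descends w j" "j > 0"
    have "\<bar>(\<xi> w - \<xi> j) (h j)\<bar> \<le> \<kappa> * ((1/2) ^ j - (1/2) ^ w)"
      using descends_telescope[of "\<lambda>i l. \<bar>(\<xi> i - \<xi> l) (h j)\<bar>" j \<kappa> w] \<xi>_tri \<xi>_step w \<kappa>(1) by auto
    also have "\<dots> \<le> \<kappa> * (1/2) ^ j" using \<kappa>(1) by (intro mult_left_mono) auto
    also have "\<dots> \<le> 1 * (1/2) ^ j" using \<kappa>(2) by (intro mult_right_mono) auto
    finally show "\<bar>(\<xi> w - \<xi> j) (h j)\<bar> \<le> (1/2) ^ j" by simp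
  next
    fix e :: real and i y assume "e > 0"
    obtain d where d: "d > 0" "\<And>x' \<xi>'. norm (x' - x i) < d \<Longrightarrow> gradient_at \<phi> x' \<xi>' \<Longrightarrow> \<bar>(\<xi>' - \<xi> i) y\<bar> < e"
      using gradient_near[OF \<phi>(1) grad\<xi> \<open>e > 0\<close>] by metis
    obtain J where J: "(1/2 :: real) ^ J < d / 2" 
      using real_arch_pow_inv[of "d / 2" "1/2"] d(1) by auto
    have "\<bar>(\<xi> w - \<xi> i) y\<bar> < e" if j: "j \<ge> Suc J" "par j = i" "descends w j" for j w
    proof -
      have False: "j > 0" using j(1) by simp
      define E :: real where "E = (1/2) ^ J"
      have jE: "(1/2 :: real) ^ j \<le> E" using j(1) unfolding E_def by (intro power_decreasing) auto
      have "norm (x w - x j) \<le> 1 * ((1/2) ^ j - (1/2) ^ w)"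
        using descends_telescope[of "\<lambda>i l. norm (x i - x l)" j 1 w] x_tri x_step j(3) by auto
      also have "\<dots> \<le> (1/2) ^ j" by simp
      finally have "norm (x w - x j) \<le> E" using jE by (rule order_trans)
      moreover have "norm (x j - x i) \<le> E" using x_step[of j] False j(2) jE by auto
      moreover have "E < d / 2" using J by (simp add: E_def)
      ultimately have "norm (x w - x i) < d" using x_tri[of w i j] by linarith
      then show ?thesis using d(2) grad\<xi> by blast
    qed
    then show "\<exists>J. \<forall>j\<ge>J. par j = i \<longrightarrow> (\<forall>w. descends w j \<longrightarrow> \<bar>(\<xi> w - \<xi> i) y\<bar> < e)" by blast
  qed (use norm_h \<phi>(2) \<open>c > 0\<close> in auto)
  then show ?thesis using that by blast
qed

section \<open>The competition between shifted copies\<close>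

text \<open>The label of a child codes a triple of a counter, a horizontal size and a vertical rise. The
  counter is ignored, so that each option is taken by infinitely many children of a node; the maximum
  ensures that no rise exceeds the size.\<close>

definition size_of :: "nat \<Rightarrow> real"
  where "size_of j = (if j = 0 then 0 else
    case from_nat (snd (prod_decode (j - 1))) :: nat \<times> rat \<times> rat of
      (_, q, a) \<Rightarrow> max \<bar>of_rat q\<bar> \<bar>of_rat a\<bar>)"

definition rise_of :: "nat \<Rightarrow> real"
  where "rise_of j = (if j = 0 then 0 else
    case from_nat (snd (prod_decode (j - 1))) :: nat \<times> rat \<times> rat of (_, q, a) \<Rightarrow> of_rat a)"

lemma child_exists:
  assumes "\<bar>of_rat a :: real\<bar> \<le> of_rat q"
  obtains j where "j \<ge> J" "j > 0" "par j = i" "size_of j = of_rat q" "rise_of j = of_rat a"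
proof -
  define code where "code n = to_nat (n, q, a)" for n :: nat
  have "inj code" by (auto simp: inj_def code_def)
  then have "infinite (range code)" by (rule range_inj_infinite)
  then obtain n where n: "code n \<ge> J" by (auto simp: infinite_nat_iff_unbounded_le)
  define j where "j = Suc (prod_encode (i, code n))"
  have "J \<le> j" using n le_prod_encode_2[of "code n" i] by (simp add: j_def)
  moreover have "par j = i" by (simp add: j_def par_def)
  moreover have "(0 :: real) \<le> of_rat q" using assms by linarith
  then have "size_of j = of_rat q" "rise_of j = of_rat a"
    using assms by (simp_all add: size_of_def rise_of_def j_def code_def)
  ultimately show ?thesis using that[of j] by (simp add: j_def)
qed

lemma rise_le_size: "\<bar>rise_of j\<bar> \<le> size_of j"
  by (auto simp: rise_of_def size_of_def split: prod.splits)

lemma size_of_nonneg: "0 \<le> size_of j"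
  using rise_le_size[of j] by linarith

function path_sum :: "(nat \<Rightarrow> 'b::comm_monoid_add) \<Rightarrow> nat \<Rightarrow> 'b"
  where "path_sum \<phi> j = (if j = 0 then 0 else path_sum \<phi> (par j) + \<phi> j)"
  by pat_completeness auto
termination by (relation "Wellfounded.measure snd") (auto simp: par_less)

declare path_sum.simps [simp del]

lemma path_sum_0 [simp]: "path_sum \<phi> 0 = 0"
  by (simp add: path_sum.simps)

lemma path_sum_child: "j > 0 \<Longrightarrow> path_sum \<phi> j = path_sum \<phi> (par j) + \<phi> j"
  by (simp add: path_sum.simps)

lemma path_sum_diff_le:
  fixes \<phi> :: "nat \<Rightarrow> 'b::real_normed_vector"
  assumes "descends w j" "\<And>i. norm (\<phi> i) \<le> \<psi> i"
  shows "norm (path_sum \<phi> w - path_sum \<phi> j) \<le> path_sum \<psi> w - path_sum \<psi> j"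
  using assms(1)
proof (induction w rule: less_induct)
  case (less w)
  show ?case
  proof (cases "w = j")
    case False
    then have w: "w > 0" "descends (par w) j" using less.prems descends_par_iff[of w j] by auto
    have "path_sum \<phi> w - path_sum \<phi> j = (path_sum \<phi> (par w) - path_sum \<phi> j) + \<phi> w"
      using path_sum_child[OF w(1), of \<phi>] by simp
    then have "norm (path_sum \<phi> w - path_sum \<phi> j) \<le> norm (path_sum \<phi> (par w) - path_sum \<phi> j) + norm (\<phi> w)"
      by (metis norm_triangle_ineq)
    then show ?thesis
      using less.IH[OF par_less[OF w(1)] w(2)] assms(2)[of w] path_sum_child[OF w(1), of \<psi>] by linarith
  qed simp
qed

text \<open>The copy of \<open>f\<close> at the node \<open>v\<close> is displaced from the copy at its parent by \<open>- size_of v *\<^sub>R h v\<close>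
  horizontally and by \<open>rise_of v\<close> vertically; the displacements add up along the path from the root.
  The slope \<open>N\<close> is such that, at the distance \<open>r\<close> in the direction \<open>h j\<close>, the node \<open>j\<close> gains at least
  \<open>N * (r * c) = 12 * L * r\<close> over all nodes outside its subtree. This outweighs the cost \<open>3 * L * r\<close> of
  a displacement of size \<open>r\<close> and the Lipschitz errors. The cost in turn outweighs what \<open>f\<close> can change
  under such a displacement, which is at most \<open>2 * L * r\<close>.\<close>

locale competition = gradient_tree \<xi> h M c
  for \<xi> :: "nat \<Rightarrow> 'a::banach \<Rightarrow>\<^sub>L real" and h M c +
  fixes f :: "'a \<times> real \<Rightarrow> real" and L :: real and x0 :: 'a and y0 :: real
  assumes f: "lipschitz_convex L f" and L_pos: "L > 0"
begin

definition N :: real where "N = 12 * L / c"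
definition cost where "cost = path_sum size_of"
definition shift where "shift = path_sum (\<lambda>j. - (size_of j *\<^sub>R h j))"
definition level where "level = path_sum rise_of"
definition F where "F v x = f (x + shift v, y0 + level v) + N * \<xi> v (x - x0) - 3 * L * cost v"
definition g where "g x = (SUP v. F v x)"
definition \<Lambda> where "\<Lambda> = L + N * M"

lemma N_pos: "N > 0" using L_pos c_pos by (simp add: N_def)

lemma \<Lambda>_pos: "\<Lambda> > 0" using L_pos N_pos M_pos by (simp add: \<Lambda>_def add_pos_pos)

lemma shift_diff: "descends w v \<Longrightarrow> norm (shift w - shift v) \<le> cost w - cost v"
  unfolding shift_def cost_def
proof (rule path_sum_diff_le)
  show "norm (- (size_of i *\<^sub>R h i)) \<le> size_of i" for i
    using mult_left_mono[OF norm_h[of i] size_of_nonneg[of i]] size_of_nonneg[of i] by simp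
qed

lemma level_diff: "descends w v \<Longrightarrow> \<bar>level w - level v\<bar> \<le> cost w - cost v"
  unfolding level_def cost_def
  using path_sum_diff_le[of w v rise_of size_of] rise_le_size by simp

lemma F_lipschitz: "lipschitz_convex \<Lambda> (F v)"
proof -
  have "lipschitz_convex \<Lambda> (\<lambda>x. f (x + shift v, y0 + level v) + N * \<xi> v (x - x0))"
    unfolding \<Lambda>_def using f L_pos N_pos norm_\<xi>
    by (intro lipschitz_convex_add lipschitz_convex_slice lipschitz_convex_functional) auto
  from lipschitz_convex_add_const[OF this, of "- 3 * L * cost v"]
  show ?thesis by (simp add: F_def[abs_def])
qed

text \<open>The displacement changes \<open>f\<close> by at most \<open>2 * L\<close> times the additional cost, while \<open>3 * L\<close> times
  that cost is charged. So a descendant that almost wins cannot be displaced much.\<close>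

lemma F_descendant_le:
  assumes "descends w v"
  shows "F w x \<le> F v x + N * (\<xi> w - \<xi> v) (x - x0) - L * (cost w - cost v)"
proof -
  have "f (x + shift w, y0 + level w) - f (x + shift v, y0 + level v)
      \<le> L * (norm (shift w - shift v) + \<bar>level w - level v\<bar>)"
    using lipschitz_prod[OF f L_pos, of "x + shift w" "y0 + level w" "x + shift v" "y0 + level v"] by simp
  also have "\<dots> \<le> L * (2 * (cost w - cost v))"
    using shift_diff[OF assms] level_diff[OF assms] L_pos by (intro mult_left_mono) auto
  finally show ?thesis
    by (simp add: F_def blinfun.diff_left algebra_simps)
qed

lemma cost_nonneg: "0 \<le> cost v"
  using shift_diff[of v 0] norm_ge_zero[of "shift v - shift 0"] unfolding cost_def by (simp del: norm_ge_zero)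

lemma root_values: "cost 0 = 0" "shift 0 = 0" "level 0 = 0"
  by (simp_all add: cost_def shift_def level_def)

lemma F_bdd: "bdd_above (range (\<lambda>v. F v x))"
proof (rule bdd_aboveI2)
  fix v
  have "(\<xi> v - \<xi> 0) (x - x0) \<le> 2 * M * norm (x - x0)"
    using norm_\<xi>[of v "x - x0"] norm_\<xi>[of 0 "x - x0"] by (simp add: blinfun.diff_left abs_le_iff)
  then have "N * (\<xi> v - \<xi> 0) (x - x0) \<le> N * (2 * M * norm (x - x0))"
    using N_pos by (intro mult_left_mono) auto
  moreover have "0 \<le> L * cost v" using L_pos cost_nonneg by simp
  ultimately show "F v x \<le> F 0 x + N * (2 * M * norm (x - x0))"
    using F_descendant_le[of v 0 x] by (simp add: root_values)
qed

lemma F_le_g: "F v x \<le> g x"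
  unfolding g_def using F_bdd by (intro cSUP_upper) auto

lemma g_approx: "e > 0 \<Longrightarrow> \<exists>v. F v x > g x - e"
  using less_cSUP_iff[of UNIV "\<lambda>v. F v x" "g x - e"] F_bdd by (auto simp: g_def)

lemma g_lipschitz: "lipschitz_convex \<Lambda> g"
  unfolding g_def[abs_def] by (rule lipschitz_convex_Sup) (use F_lipschitz F_bdd in auto)

text \<open>The affine terms vanish at \<open>x0\<close>, where only the costs count.\<close>

lemma root_wins_at_centre: "g x0 = F 0 x0"
proof (rule antisym)
  have "F v x0 \<le> F 0 x0" for v
    using F_descendant_le[of v 0 x0] mult_nonneg_nonneg[OF less_imp_le[OF L_pos] cost_nonneg[of v]]
    by (simp add: root_values)
  then show "g x0 \<le> F 0 x0" unfolding g_def by (intro cSUP_least) auto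
qed (rule F_le_g)

text \<open>Targets that are within \<open>aperture * \<tau>\<close> of the point visited by a nearly winning copy can be reached
  by a child: at this scale the Lipschitz errors are small compared with \<open>L * \<tau>\<close>.\<close>

definition aperture :: real where "aperture = L / (8 * \<Lambda>)"

lemma aperture_pos: "aperture > 0" using L_pos \<Lambda>_pos by (simp add: aperture_def)

lemma aperture_bounds: "2 * (L + N * M) * aperture = L / 4" "aperture \<le> 1 / 8"
proof -
  show "2 * (L + N * M) * aperture = L / 4"
    using \<Lambda>_pos by (simp add: aperture_def flip: \<Lambda>_def)
  have "L \<le> \<Lambda>" using N_pos M_pos by (simp add: \<Lambda>_def)
  then show "aperture \<le> 1 / 8" using \<Lambda>_pos by (simp add: aperture_def divide_le_eq)
qed

text \<open>Let the copy \<open>v\<close> almost win at \<open>z\<close>, and let \<open>(x', y')\<close> be close to the point that it puts over \<open>z\<close>.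
  A child \<open>j\<close> of \<open>v\<close> with size \<open>r\<close> and the appropriate rise puts \<open>(x', y')\<close> over \<open>x2 = u + r *\<^sub>R h j\<close>, where
  \<open>u\<close> is the point over which \<open>v\<close> itself puts \<open>x'\<close>. At \<open>x2\<close> the separation of \<open>\<xi> j\<close> on \<open>h j\<close> makes \<open>j\<close> beat
  all copies outside its subtree. Inside the subtree the affine terms hardly differ at \<open>x2\<close>, so the cost
  decides, and the copies that almost win are hardly displaced from \<open>j\<close>. By Lipschitz continuity all
  this persists on a ball around \<open>x2\<close>.\<close>

lemma steer:
  assumes \<tau>: "\<tau> > 0" and v: "F v z > g z - L * \<tau> / 4"
    and x': "norm (x' - z - shift v) < aperture * \<tau>" and y': "\<bar>y' - y0 - level v\<bar> < aperture * \<tau>"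
    and "tol > 0"
  obtains x2 \<theta> d where "x2 \<in> ball z \<tau>" "\<theta> > 0" "d > 0"
    "\<And>x w. x \<in> ball x2 d \<Longrightarrow> F w x > g x - \<theta> \<Longrightarrow>
       norm (x + shift w - x') < tol \<and> \<bar>y0 + level w - y'\<bar> < tol"
proof -
  define \<rho> where "\<rho> = aperture * \<tau>"
  have \<rho>: "\<rho> > 0" "\<rho> \<le> \<tau> / 8" "2 * (L + N * M) * \<rho> = L * \<tau> / 4"
    using aperture_pos aperture_bounds \<tau> by (simp_all add: \<rho>_def)
  (* The size r is large enough for the gain proportional to L * r to compensate the deficit
     L * \<tau> / 4 of v at z, and small enough for x2 to stay in the ball around z. *)
  obtain q :: rat where q: "\<tau> / 4 < of_rat q" "of_rat q < \<tau> / 2"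
    using of_rat_dense[of "\<tau> / 4" "\<tau> / 2"] \<tau> by auto
  define r :: real where "r = of_rat q"
  have r: "\<tau> / 4 < r" "r < \<tau> / 2" "r > 0" using q \<tau> unfolding r_def by linarith+
  define t where "t = y' - y0 - level v"
  obtain a :: rat where "max (- \<rho>) (t - tol / 2) < of_rat a" "of_rat a < min \<rho> (t + tol / 2)"
    using of_rat_dense[of "max (- \<rho>) (t - tol / 2)" "min \<rho> (t + tol / 2)"] y' \<rho>(1) \<open>tol > 0\<close>
    by (auto simp: t_def \<rho>_def abs_less_iff)
  then have a: "\<bar>of_rat a\<bar> < \<rho>" "\<bar>of_rat a - t\<bar> < tol / 2"
    unfolding max_less_iff_conj min_less_iff_conj by linarith+
  define u where "u = x' - shift v"
  have uz: "norm (u - z) < \<rho>" using x' by (simp add: u_def \<rho>_def algebra_simps)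
  (* By weak-star convergence a child with a large label, and with it its whole subtree, differs
     from v by less than \<eta> at u; the other condition on the label makes the variation of the subtree
     on h j negligible. *)
  define \<eta> where "\<eta> = min (L * r) (L * tol / 32) / N"
  have \<eta>: "\<eta> > 0" "N * \<eta> \<le> L * r" "N * \<eta> \<le> L * tol / 32"
    using L_pos N_pos r \<open>tol > 0\<close> by (simp_all add: \<eta>_def)
  obtain J1 where J1: "\<And>j w. j \<ge> J1 \<Longrightarrow> par j = v \<Longrightarrow> descends w j \<Longrightarrow> \<bar>(\<xi> w - \<xi> v) (u - x0)\<bar> < \<eta>"
    using convergent[OF \<eta>(1), of v "u - x0"] by blast
  have "L * tol / (16 * N * r) > 0" using L_pos N_pos r \<open>tol > 0\<close> by simp
  then obtain J2 where J2: "(1/2 :: real) ^ J2 < L * tol / (16 * N * r)"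
    using real_arch_pow_inv[of _ "1/2"] by auto
  have "\<bar>of_rat a :: real\<bar> \<le> of_rat q" using a(1) \<rho>(2) r(1) \<tau> by (simp add: r_def)
  then obtain j where j: "j \<ge> max J1 J2" "j > 0" "par j = v" "size_of j = r" "rise_of j = of_rat a"
    using child_exists[of a q "max J1 J2" v] unfolding r_def by metis
  have "N * r * (1/2) ^ j \<le> N * r * (1/2) ^ J2"
    using j(1) N_pos r by (intro mult_left_mono power_decreasing) auto
  also have "\<dots> \<le> L * tol / 16" using J2 N_pos r by (simp add: field_simps)
  finally have Nr: "N * r * (1/2) ^ j \<le> L * tol / 16" .
  have child: "shift j = shift v - r *\<^sub>R h j" "level j = level v + of_rat a" "cost j = cost v + r"
    using path_sum_child[OF j(2), of "\<lambda>j. - (size_of j *\<^sub>R h j)"] path_sum_child[OF j(2), of rise_of]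
      path_sum_child[OF j(2), of size_of] j(3-5) by (simp_all add: shift_def level_def cost_def)
  define x2 where "x2 = u + r *\<^sub>R h j"
  have rh: "norm (r *\<^sub>R h j) \<le> r" using norm_h[of j] r(3) by simp
  have x2: "x2 + shift j = x'" "x2 - z = (u - z) + r *\<^sub>R h j" "x2 - x0 = (u - x0) + r *\<^sub>R h j"
    by (simp_all add: x2_def child u_def)
  have x2z: "norm (x2 - z) \<le> \<rho> + r"
    unfolding x2(2) using norm_triangle_ineq[of "u - z" "r *\<^sub>R h j"] rh uz by linarith
  then have "x2 \<in> ball z \<tau>" using \<rho>(2) r(2) \<tau> by (simp add: dist_norm norm_minus_commute)
  (* The values F w x2, F w z, F v z and F j x2 are compared in turn; the affine terms are
     collected, and r * (\<xi> j - \<xi> w) (h j) is the one that decides. *)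
  have outsider: "F w x2 \<le> F j x2 - L * r" if w: "\<not> descends w j" for w
  proof -
    have 1: "F w x2 - F w z \<le> L * (\<rho> + r) + N * \<xi> w (x2 - z)"
    proof -
      have "f (x2 + shift w, y0 + level w) - f (z + shift w, y0 + level w) \<le> L * norm (x2 - z)"
        using lipschitz_prod[OF f L_pos, of "x2 + shift w" "y0 + level w" "z + shift w" "y0 + level w"] by simp
      also have "\<dots> \<le> L * (\<rho> + r)" using x2z L_pos by simp
      finally show ?thesis by (simp add: F_def blinfun.diff_right algebra_simps)
    qed
    have 2: "F w z < F v z + L * \<tau> / 4" using F_le_g[of w z] v by linarith
    have 3: "F v z - F j x2 \<le> L * (2 * \<rho>) + N * \<xi> v (z - x0) - N * \<xi> j (x2 - x0) + 3 * L * r"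
    proof -
      have eqs: "z + shift v - (x2 + shift j) = z - u" "\<bar>y0 + level v - (y0 + level j)\<bar> = \<bar>of_rat a\<bar>"
        unfolding x2(1) by (simp_all add: u_def child)
      have "f (z + shift v, y0 + level v) - f (x2 + shift j, y0 + level j) \<le> L * (norm (z - u) + \<bar>of_rat a\<bar>)"
        using lipschitz_prod[OF f L_pos, of "z + shift v" "y0 + level v" "x2 + shift j" "y0 + level j"]
        by (simp only: eqs)
      also have "\<dots> \<le> L * (2 * \<rho>)"
        using uz a(1) L_pos by (intro mult_left_mono) (auto simp: norm_minus_commute)
      finally show ?thesis by (simp add: F_def child algebra_simps)
    qed
    have 4: "N * \<xi> w (x2 - z) + N * \<xi> v (z - x0) - N * \<xi> j (x2 - x0)
        \<le> N * \<eta> + 2 * (N * M) * \<rho> - 12 * L * r"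
    proof -
      have "\<xi> w (x2 - z) + \<xi> v (z - x0) - \<xi> j (x2 - x0) =
          - (\<xi> j - \<xi> v) (u - x0) + (\<xi> w - \<xi> v) (u - z) - r * (\<xi> j - \<xi> w) (h j)"
        unfolding x2(2,3) blinfun.diff_left blinfun.diff_right blinfun.add_right blinfun.scaleR_right
        by (simp add: algebra_simps)
      moreover have "- (\<xi> j - \<xi> v) (u - x0) \<le> \<eta>"
        using J1[of j j] j(1,3) by (simp add: abs_less_iff)
      moreover have "(\<xi> w - \<xi> v) (u - z) \<le> 2 * M * \<rho>"
      proof -
        have "(\<xi> w - \<xi> v) (u - z) \<le> 2 * (M * norm (u - z))"
          using norm_\<xi>[of w "u - z"] norm_\<xi>[of v "u - z"] by (simp add: blinfun.diff_left abs_le_iff)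
        also have "\<dots> \<le> 2 * (M * \<rho>)" using uz M_pos by simp
        finally show ?thesis by simp
      qed
      moreover have "r * c \<le> r * (\<xi> j - \<xi> w) (h j)"
        using separated[OF w] r(3) by (intro mult_left_mono) auto
      ultimately have "\<xi> w (x2 - z) + \<xi> v (z - x0) - \<xi> j (x2 - x0) \<le> \<eta> + 2 * M * \<rho> - r * c"
        by linarith
      then have "N * (\<xi> w (x2 - z) + \<xi> v (z - x0) - \<xi> j (x2 - x0)) \<le> N * (\<eta> + 2 * M * \<rho> - r * c)"
        using N_pos by (intro mult_left_mono) auto
      moreover have "N * c = 12 * L" using c_pos by (simp add: N_def)
      then have "N * (r * c) = 12 * L * r" by (metis mult.assoc mult.commute)
      moreover have "N * (2 * M * \<rho>) = 2 * (N * M) * \<rho>" by simp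
      ultimately show ?thesis
        unfolding right_diff_distrib distrib_left by linarith
    qed
    have "L * \<tau> / 4 \<le> L * r" using r(1) L_pos by simp
    moreover have "L * \<rho> \<le> L * (r / 2)" using \<rho>(2) r(1) L_pos by (intro mult_left_mono) auto
    moreover have "2 * (N * M) * \<rho> \<le> L * \<tau> / 4" using \<rho>(3) mult_pos_pos[OF L_pos \<rho>(1)] by (simp add: distrib_right distrib_left) 
    moreover have "L * (\<rho> + r) = L * \<rho> + L * r" "L * (2 * \<rho>) = 2 * (L * \<rho>)" "L * (r / 2) = (L * r) / 2"
      by (simp_all add: algebra_simps)
    moreover have "0 < L * r" using L_pos r(3) by simp
    ultimately show ?thesis using 1 2 3 4 \<eta>(2) by linarith
  qed
  have insider: "F w x2 \<le> F j x2 + 2 * (N * \<eta>) + N * r * (1/2) ^ j - L * (cost w - cost j)"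
    if w: "descends w j" for w
  proof -
    have "(\<xi> w - \<xi> j) (x2 - x0) = (\<xi> w - \<xi> v) (u - x0) - (\<xi> j - \<xi> v) (u - x0) + r * (\<xi> w - \<xi> j) (h j)"
      unfolding x2(3) blinfun.diff_left blinfun.add_right blinfun.scaleR_right by (simp add: algebra_simps)
    moreover have "(\<xi> w - \<xi> v) (u - x0) < \<eta>" "- (\<xi> j - \<xi> v) (u - x0) < \<eta>"
      using J1[of j w] J1[of j j] j(1,3) w by (simp_all add: abs_less_iff)
    moreover have "r * (\<xi> w - \<xi> j) (h j) \<le> r * (1/2) ^ j"
      using coherent[OF w j(2)] r(3) by (intro mult_left_mono) auto
    ultimately have "(\<xi> w - \<xi> j) (x2 - x0) \<le> 2 * \<eta> + r * (1/2) ^ j" by linarith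
    then have "N * (\<xi> w - \<xi> j) (x2 - x0) \<le> N * (2 * \<eta> + r * (1/2) ^ j)"
      using N_pos by (intro mult_left_mono) auto
    then show ?thesis using F_descendant_le[OF w, of x2] by (simp add: algebra_simps)
  qed
  define \<theta> where "\<theta> = min (L * r) (L * tol / 16)"
  have \<theta>: "\<theta> > 0" "\<theta> \<le> L * r" "\<theta> \<le> L * tol / 16" using L_pos r \<open>tol > 0\<close> by (auto simp: \<theta>_def)
  have near: "descends w j \<and> cost w - cost j < tol / 4" if "F w x2 > g x2 - \<theta>" for w
  proof
    have Fj: "F w x2 > F j x2 - \<theta>" using that F_le_g[of j x2] by linarith
    show w: "descends w j" using outsider[of w] Fj \<theta>(2) by fastforce
    have "L * (cost w - cost j) < L * tol / 16 + L * tol / 16 + L * tol / 16"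
      using insider[OF w] Fj \<theta>(3) \<eta>(3) Nr by linarith
    also have "\<dots> \<le> L * (tol / 4)" using L_pos \<open>tol > 0\<close> by simp
    finally show "cost w - cost j < tol / 4" using L_pos mult_less_cancel_left_pos by blast
  qed
  define d where "d = min (\<theta> / (4 * \<Lambda>)) (tol / 4)"
  have d: "d > 0" "\<Lambda> * d \<le> \<theta> / 4" "d \<le> tol / 4"
  proof -
    have "d \<le> \<theta> / (4 * \<Lambda>)" by (simp add: d_def)
    then show "\<Lambda> * d \<le> \<theta> / 4" using \<Lambda>_pos by (simp add: field_simps)
  qed (use \<theta> \<Lambda>_pos \<open>tol > 0\<close> in \<open>auto simp: d_def\<close>)
  have "norm (x + shift w - x') < tol \<and> \<bar>y0 + level w - y'\<bar> < tol"
    if x: "x \<in> ball x2 d" and w: "F w x > g x - \<theta> / 2" for x w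
  proof -
    have xx2: "norm (x - x2) < d" using x by (simp add: dist_norm norm_minus_commute)
    then have "\<Lambda> * norm (x - x2) \<le> \<theta> / 4" using d(2) \<Lambda>_pos
      by (meson less_imp_le mult_left_mono order_trans)
    then have "F w x2 > g x2 - \<theta>"
      using w lipschitz_convexD(3)[OF F_lipschitz, of w x x2] lipschitz_convexD(3)[OF g_lipschitz, of x x2]
      by (simp add: abs_le_iff)
    then have w: "descends w j" "cost w - cost j < tol / 4" using near by auto
    have "x + shift w - x' = (x - x2) + (shift w - shift j)" using x2(1) by (simp add: algebra_simps)
    then have "norm (x + shift w - x') \<le> norm (x - x2) + norm (shift w - shift j)"
      by (metis norm_triangle_ineq)
    moreover have "y0 + level w - y' = (level w - level j) + (of_rat a - t)"
      by (simp add: child t_def)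
    then have "\<bar>y0 + level w - y'\<bar> \<le> \<bar>level w - level j\<bar> + \<bar>of_rat a - t\<bar>"
      by (metis abs_triangle_ineq)
    ultimately show ?thesis
      using shift_diff[OF w(1)] level_diff[OF w(1)] w(2) xx2 d(3) a(2) \<open>tol > 0\<close> by linarith
  qed
  then show ?thesis
    using that[of x2 "\<theta> / 2" d] \<open>x2 \<in> ball z \<tau>\<close> \<theta>(1) d(1) by auto
qed

text \<open>A position \<open>(n, z, \<tau>, v)\<close> of the game consists of the round, a ball in \<open>X\<close> to which further play is
  confined, and a copy that almost wins at its centre. It controls the points of the product that are
  near the point put over \<open>z\<close> by that copy.\<close>

definition window :: "nat \<times> 'a \<times> real \<times> nat \<Rightarrow> ('a \<times> real) set"
  where "window s = (case s of (n, z, \<tau>, v) \<Rightarrow>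
    {p. norm (fst p - z - shift v) < aperture * \<tau> \<and> \<bar>snd p - y0 - level v\<bar> < aperture * \<tau>})"

lemma open_window: "open (window s)"
  unfolding window_def
  by (cases s) (auto intro!: open_Collect_conj open_Collect_less continuous_intros)

lemma second_diff_F: "second_diff (F v) x k = second_diff f (x + shift v, y0 + level v) (k, 0)"
  by (simp add: second_diff_def F_def blinfun.diff_right blinfun.add_right algebra_simps)

text \<open>Since \<open>F v \<le> g\<close>, the second differences of \<open>F v\<close> at \<open>x\<close> exceed those of \<open>g\<close> by at most
  \<open>2 * (g x - F v x)\<close>, and they are horizontal second differences of \<open>f\<close> because the remaining terms of
  \<open>F v\<close> are affine.\<close>

lemma smooth_along_limit:
  assumes g: "smooth_along g x k"
    and win: "(\<lambda>n. F (v n) x) \<longlonglongrightarrow> g x" and p: "(\<lambda>n. (x + shift (v n), y0 + level (v n))) \<longlonglongrightarrow> p"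
  shows "smooth_along f p (k, 0)"
  unfolding smooth_along_def
proof (intro allI impI)
  fix e :: real assume "e > 0"
  then obtain t where t: "t > 0" "second_diff g x (t *\<^sub>R k) \<le> e * t"
    using g by (auto simp: smooth_along_def)
  define P where "P n = (x + shift (v n), y0 + level (v n))" for n
  have "second_diff f p (t *\<^sub>R (k, 0)) \<le> e * t + 2 * (g x - F (v n) x) + 4 * L * norm (p - P n)" for n
  proof -
    have "second_diff f p (t *\<^sub>R (k, 0)) \<le> second_diff f (P n) (t *\<^sub>R (k, 0)) + 4 * L * norm (p - P n)"
      by (rule second_diff_perturb[OF f])
    moreover have "second_diff f (P n) (t *\<^sub>R (k, 0)) = second_diff (F (v n)) x (t *\<^sub>R k)"
      by (simp add: second_diff_F P_def)
    moreover have "second_diff (F (v n)) x (t *\<^sub>R k) \<le> second_diff g x (t *\<^sub>R k) + 2 * (g x - F (v n) x)"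
      using F_le_g[of "v n" "x + t *\<^sub>R k"] F_le_g[of "v n" "x - t *\<^sub>R k"] by (simp add: second_diff_def)
    ultimately show ?thesis using t(2) by linarith
  qed
  moreover have "(\<lambda>n. e * t + 2 * (g x - F (v n) x) + 4 * L * norm (p - P n)) \<longlonglongrightarrow>
      e * t + 2 * (g x - g x) + 4 * L * norm (p - p)"
    unfolding P_def by (intro tendsto_intros win p)
  ultimately have "second_diff f p (t *\<^sub>R (k, 0)) \<le> e * t + 2 * (g x - g x) + 4 * L * norm (p - p)"
    by (intro LIMSEQ_le_const) auto
  then have "second_diff f p (t *\<^sub>R (k, 0)) \<le> e * t" by simp
  then show "\<exists>t>0. second_diff f p (t *\<^sub>R (k, 0)) \<le> e * t" using t(1) by blast
qed

text \<open>In round \<open>n\<close> the opponent's open set is entered with \<open>steer\<close>, and the new ball is placed inside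
  the dense open set \<open>O' n\<close>. The balls shrink to a point \<open>x\<close> at which \<open>g\<close> is smooth, the copies played
  win at \<open>x\<close> in the limit, and the points that they put over \<open>x\<close> converge to the outcome of the play.\<close>

lemma comeagre_smooth_horizontally:
  fixes O' :: "nat \<Rightarrow> 'a set"
  assumes O': "\<And>n. open (O' n)" "\<And>n. closure (O' n) = UNIV"
    and smooth: "\<And>x k. x \<in> (\<Inter>n. O' n) \<Longrightarrow> smooth_along g x k"
  shows "comeagre_in (window (0, x0, 1, 0)) {p. \<forall>k. smooth_along f p (k, 0)}"
proof -
  define ok where "ok s = (case s of (n, z, \<tau>, v) \<Rightarrow> \<tau> > 0 \<and> F v z > g z - L * \<tau> / 4)"
    for s :: "nat \<times> 'a \<times> real \<times> nat"
  define move where "move s s' = (case s of (n, z, \<tau>, v) \<Rightarrow> case s' of (n', z', \<tau>', v') \<Rightarrow>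
      n' = Suc n \<and> cball z' \<tau>' \<subseteq> ball z \<tau> \<inter> O' n \<and> \<tau>' \<le> \<tau> / 2)"
    for s s' :: "nat \<times> 'a \<times> real \<times> nat"
  show ?thesis
  proof (rule comeagre_in_by_play[of ok "(0, x0, 1, 0)" window move])
    show "ok (0, x0, 1, 0)" using root_wins_at_centre L_pos by (simp add: ok_def)
  next
    fix s assume "ok s"
    obtain n z \<tau> v where s: "s = (n, z, \<tau>, v)" by (cases s)
    have "(z + shift v, y0 + level v) \<in> window s"
      using \<open>ok s\<close> aperture_pos by (simp add: s ok_def window_def)
    then show "open (window s) \<and> window s \<noteq> {}" using open_window by blast
  next
    fix s W assume s_ok: "ok s" and W: "open W" "W \<noteq> {}" "W \<subseteq> window s"
    obtain n z \<tau> v where s: "s = (n, z, \<tau>, v)" by (cases s)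
    have \<tau>: "\<tau> > 0" "F v z > g z - L * \<tau> / 4" using s_ok by (simp_all add: s ok_def)
    obtain x' y' where p: "(x', y') \<in> W" using W(2) by auto
    obtain e where e: "e > 0" "ball (x', y') e \<subseteq> W" using W(1) p openE by blast
    have "(x', y') \<in> window s" using p W(3) by blast
    then have "norm (x' - z - shift v) < aperture * \<tau>" "\<bar>y' - y0 - level v\<bar> < aperture * \<tau>"
      by (simp_all add: window_def s)
    then obtain x2 \<theta> d where x2: "x2 \<in> ball z \<tau>" "\<theta> > 0" "d > 0"
      and steered: "\<And>x w. x \<in> ball x2 d \<Longrightarrow> F w x > g x - \<theta> \<Longrightarrow>
          norm (x + shift w - x') < e / 4 \<and> \<bar>y0 + level w - y'\<bar> < e / 4"
      using steer[OF \<tau>, of x' y' "e / 4"] e(1) by (metis divide_pos_pos zero_less_numeral)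
    define Q where "Q = O' n \<inter> (ball x2 d \<inter> ball z \<tau>)"
    have "x2 \<in> ball x2 d \<inter> ball z \<tau>" using x2 by simp
    then have "ball x2 d \<inter> ball z \<tau> \<noteq> {}" by blast
    moreover have "open (ball x2 d \<inter> ball z \<tau>)" by (simp add: open_Int)
    ultimately have "Q \<noteq> {}"
      using O'(2)[of n] open_Int_closure_eq_empty[of "ball x2 d \<inter> ball z \<tau>" "O' n"]
      by (auto simp: Q_def Int_commute)
    then obtain z' where "z' \<in> Q" by blast
    moreover have "open Q" using O'(1) by (auto simp: Q_def)
    ultimately obtain \<delta> where \<delta>: "\<delta> > 0" "cball z' \<delta> \<subseteq> Q" using open_contains_cball by blast
    (* Any copy that almost wins at z' up to L * \<tau>' / 4 is steered to within e / 4 of the target,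
       and its window has radius at most e / 4. *)
    define \<tau>' where "\<tau>' = min \<delta> (min (\<tau> / 2) (min (4 * \<theta> / L) (e / (4 * aperture))))"
    have "\<tau>' > 0" using \<delta> \<tau> x2 L_pos e aperture_pos by (simp add: \<tau>'_def)
    have \<tau>': "\<tau>' \<le> \<delta>" "\<tau>' \<le> \<tau> / 2" "\<tau>' \<le> 4 * \<theta> / L" "\<tau>' \<le> e / (4 * aperture)"
      unfolding \<tau>'_def by (auto intro: min.coboundedI1 min.coboundedI2)
    have small: "L * \<tau>' / 4 \<le> \<theta>" "aperture * \<tau>' \<le> e / 4"
      using \<tau>'(3,4) L_pos aperture_pos by (simp_all add: field_simps)
    obtain v' where v': "F v' z' > g z' - L * \<tau>' / 4"
      using g_approx[of "L * \<tau>' / 4" z'] L_pos \<open>\<tau>' > 0\<close> by auto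
    have "z' \<in> ball x2 d" using \<open>z' \<in> Q\<close> by (simp add: Q_def)
    then have near: "norm (z' + shift v' - x') < e / 4" "\<bar>y0 + level v' - y'\<bar> < e / 4"
      using steered[of z' v'] v' small(1) by auto
    have "window (Suc n, z', \<tau>', v') \<subseteq> ball (x', y') e"
    proof
      fix q assume q: "q \<in> window (Suc n, z', \<tau>', v')"
      obtain a b where ab: "q = (a, b)" by (cases q)
      have q1: "norm (a - z' - shift v') < e / 4" "\<bar>b - y0 - level v'\<bar> < e / 4"
        using q small(2) by (auto simp: window_def ab)
      have "norm (a - x') \<le> norm (a - z' - shift v') + norm (z' + shift v' - x')"
        using norm_triangle_ineq[of "a - z' - shift v'" "z' + shift v' - x'"] by simp
      moreover have "\<bar>b - y'\<bar> \<le> \<bar>b - y0 - level v'\<bar> + \<bar>y0 + level v' - y'\<bar>" by simp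
      moreover have "norm ((a, b) - (x', y')) \<le> norm (a - x') + \<bar>b - y'\<bar>"
        using norm_Pair_le[of "a - x'" "b - y'"] by simp
      ultimately have "norm ((a, b) - (x', y')) < e" using q1 near by linarith
      then show "q \<in> ball (x', y') e"
        by (metis ab dist_commute dist_norm mem_ball)
    qed
    moreover have "cball z' \<tau>' \<subseteq> ball z \<tau> \<inter> O' n"
      using \<delta>(2) \<tau>'(1) subset_cball[OF \<tau>'(1), of z'] by (auto simp: Q_def)
    ultimately show "\<exists>s'. ok s' \<and> move s s' \<and> window s' \<subseteq> W"
      using \<open>\<tau>' > 0\<close> v' \<tau>'(2) e(2)
      by (intro exI[of _ "(Suc n, z', \<tau>', v')"]) (auto simp: ok_def move_def s)
  next
    fix \<sigma> p assume \<sigma>0: "\<sigma> 0 = (0, x0, 1, 0)" and ok: "\<And>n. ok (\<sigma> n)"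
      and moves: "\<And>n. move (\<sigma> n) (\<sigma> (Suc n))" and p: "\<And>n. p \<in> window (\<sigma> n)"
    define z where "z n = fst (snd (\<sigma> n))" for n
    define \<tau> where "\<tau> n = fst (snd (snd (\<sigma> n)))" for n
    define v where "v n = snd (snd (snd (\<sigma> n)))" for n
    have \<sigma>: "\<sigma> n = (n, z n, \<tau> n, v n)" for n
    proof (induction n)
      case (Suc n)
      then show ?case using moves[of n] by (auto simp: move_def z_def \<tau>_def v_def split: prod.splits)
    qed (simp add: \<sigma>0 z_def \<tau>_def v_def)
    have \<tau>_pos: "\<tau> n > 0" and near: "F (v n) (z n) > g (z n) - L * \<tau> n / 4" for n
      using ok[of n] by (simp_all add: \<sigma> ok_def)
    have shrink: "cball (z (Suc n)) (\<tau> (Suc n)) \<subseteq> ball (z n) (\<tau> n) \<inter> O' n" "\<tau> (Suc n) \<le> \<tau> n / 2" for n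
      using moves[of n] by (simp_all add: \<sigma> move_def)
    have "\<tau> n \<le> (1/2) ^ n" for n
    proof (induction n)
      case (Suc n)
      then show ?case using shrink(2)[of n] by simp
    qed (simp add: \<tau>_def \<sigma>0)
    then have \<tau>_lim: "\<tau> \<longlonglongrightarrow> 0"
      using \<tau>_pos LIMSEQ_power_zero[of "1/2 :: real"]
      by (intro tendsto_sandwich[of "\<lambda>_. 0" \<tau> sequentially "\<lambda>n. (1/2) ^ n"]) (auto intro: less_imp_le always_eventually)
    have nested: "cball (z m) (\<tau> m) \<subseteq> cball (z n) (\<tau> n)" if "n \<le> m" for m n
      using that
    proof (induction m rule: dec_induct)
      case (step m)
      then show ?case using shrink(1)[of m]
          ball_subset_cball[of "z m" "\<tau> m"] by blast
    qed simp
    have "\<exists>x. \<forall>n. x \<in> cball (z n) (\<tau> n)"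
    proof -
      have "\<exists>a. \<Inter>(range (\<lambda>n. cball (z n) (\<tau> n))) = {a}"
      proof (rule decreasing_closed_nest_sing)
        show "\<exists>n. \<forall>x\<in>cball (z n) (\<tau> n). \<forall>y\<in>cball (z n) (\<tau> n). dist x y < e" if "e > 0" for e
        proof -
          obtain n where n: "\<tau> n < e / 2"
            using order_tendstoD(2)[OF \<tau>_lim, of "e / 2"] \<open>e > 0\<close> by (auto simp: eventually_sequentially)
          have "dist x y < e" if "x \<in> cball (z n) (\<tau> n)" "y \<in> cball (z n) (\<tau> n)" for x y
            using that n dist_triangle2[of x y "z n"] by (simp add: dist_commute)
          then show ?thesis by blast
        qed
      next
        show "cball (z n) (\<tau> n) \<noteq> {}" for n using \<tau>_pos[of n] by simp
        show "cball (z n) (\<tau> n) \<subseteq> cball (z m) (\<tau> m)" if "m \<le> n" for m n using nested[OF that] .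
      qed simp
      then show ?thesis by blast
    qed
    then obtain x where x: "\<And>n. x \<in> cball (z n) (\<tau> n)" by blast
    have "x \<in> (\<Inter>n. O' n)"
      using x[of "Suc _"] shrink(1) by blast
    have dist_x: "norm (x - z n) \<le> \<tau> n" for n
      using x[of n] by (simp add: dist_norm norm_minus_commute)
    have win: "(\<lambda>n. F (v n) x) \<longlonglongrightarrow> g x"
    proof (rule tendsto_sandwich[where h = "\<lambda>_. g x"])
      show "\<forall>\<^sub>F n in sequentially. g x - (L / 4 + 2 * \<Lambda>) * \<tau> n \<le> F (v n) x"
      proof (rule always_eventually, rule allI)
        fix n
        have "\<Lambda> * norm (x - z n) \<le> \<Lambda> * \<tau> n" using dist_x \<Lambda>_pos by simp
        then show "g x - (L / 4 + 2 * \<Lambda>) * \<tau> n \<le> F (v n) x"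
          using near[of n] lipschitz_convexD(3)[OF F_lipschitz, of "v n" x "z n"]
            lipschitz_convexD(3)[OF g_lipschitz, of x "z n"] by (simp add: abs_le_iff algebra_simps)
      qed
      show "(\<lambda>n. g x - (L / 4 + 2 * \<Lambda>) * \<tau> n) \<longlonglongrightarrow> g x"
        using tendsto_diff[OF tendsto_const tendsto_mult[OF tendsto_const \<tau>_lim], of "g x" "L / 4 + 2 * \<Lambda>"] by simp
    qed (use F_le_g in \<open>auto intro: always_eventually\<close>)
    have "(\<lambda>n. (x + shift (v n), y0 + level (v n))) \<longlonglongrightarrow> p"
    proof (rule LIM_zero_cancel, rule tendsto_norm_zero_cancel, rule tendsto_sandwich[where f = "\<lambda>_. 0"])
      show "\<forall>\<^sub>F n in sequentially. norm ((x + shift (v n), y0 + level (v n)) - p) \<le> (1 + 2 * aperture) * \<tau> n"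
      proof (rule always_eventually, rule allI)
        fix n
        obtain a b where ab: "p = (a, b)" by (cases p)
        have q: "norm (a - z n - shift (v n)) < aperture * \<tau> n" "\<bar>b - y0 - level (v n)\<bar> < aperture * \<tau> n"
          using p[of n] by (simp_all add: \<sigma> window_def ab)
        have "norm (x + shift (v n) - a) \<le> norm (x - z n) + norm (a - z n - shift (v n))"
          using norm_triangle_ineq4[of "x - z n" "a - z n - shift (v n)"] by (simp add: algebra_simps)
        moreover have "\<bar>y0 + level (v n) - b\<bar> < aperture * \<tau> n" using q(2) by linarith
        moreover have "norm ((x + shift (v n), y0 + level (v n)) - p) \<le> norm (x + shift (v n) - a) + \<bar>y0 + level (v n) - b\<bar>"
          using norm_Pair_le[of "x + shift (v n) - a" "y0 + level (v n) - b"] by (simp add: ab)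
        ultimately show "norm ((x + shift (v n), y0 + level (v n)) - p) \<le> (1 + 2 * aperture) * \<tau> n"
          using q(1) dist_x[of n] by (simp add: algebra_simps)
      qed
      show "(\<lambda>n. (1 + 2 * aperture) * \<tau> n) \<longlonglongrightarrow> 0"
        using tendsto_mult[OF tendsto_const \<tau>_lim, of "1 + 2 * aperture"] by simp
    qed auto
    then show "p \<in> {p. \<forall>k. smooth_along f p (k, 0)}"
      using smooth_along_limit[OF smooth[OF \<open>x \<in> (\<Inter>n. O' n)\<close>] win] by blast
  qed
qed

end

section \<open>The product with the real line\<close>

lemma weak_asplund_open_dense:
  fixes \<phi> :: "'a::banach \<Rightarrow> real"
  assumes "weak_asplund TYPE('a)" "lipschitz_convex L \<phi>"
  obtains O' :: "nat \<Rightarrow> 'a set" where "\<And>n. open (O' n)" "\<And>n. closure (O' n) = UNIV"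
    "\<And>x. x \<in> (\<Inter>n. O' n) \<Longrightarrow> gateaux_differentiable_at \<phi> x"
    "closure (\<Inter>n. O' n) = UNIV"
proof -
  have "UNIV \<noteq> ({} :: 'a set) \<and> open (UNIV :: 'a set) \<and> convex (UNIV :: 'a set) \<and>
      continuous_on UNIV \<phi> \<and> convex_on UNIV \<phi>"
    using lipschitz_convex_continuous[OF assms(2)] lipschitz_convexD(1)[OF assms(2)] by simp
  then obtain G where G: "gdelta_in (top_of_set UNIV) G" "UNIV \<subseteq> closure G"
      "\<And>x. x \<in> G \<Longrightarrow> gateaux_differentiable_at \<phi> x"
    using assms(1) unfolding weak_asplund_def by metis
  then show ?thesis
    using dense_gdelta_imp_open_sequence[of G] that by (metis subtopology_UNIV top.extremum_unique)
qed

text \<open>The two cases of the dichotomy. In the second one the competition has to be set up anew around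
  each point of the product, since it yields a comeagre set only in a window around its centre.\<close>

lemma comeagre_gateaux_product:
  fixes f :: "'a::banach \<times> real \<Rightarrow> real"
  assumes X: "weak_asplund TYPE('a)" and f: "lipschitz_convex L f" "L > 0"
  shows "comeagre_in UNIV {p. gateaux_differentiable_at f p}"
proof (cases "\<forall>(\<phi> :: 'a \<Rightarrow> real) M V. lipschitz_convex M \<phi> \<longrightarrow> M > 0 \<longrightarrow> open V \<longrightarrow> V \<noteq> {} \<longrightarrow>
    (\<exists>x\<in>V. \<forall>e>0. x \<in> nearly_smooth \<phi> e)")
  case True
  have "comeagre_in UNIV {p. \<forall>h. smooth_along f p h}"
    by (rule comeagre_smooth_of_frechet[OF _ f]) (use True in blast)
  then show ?thesis
    by (rule comeagre_in_mono) (auto intro: smooth_imp_gateaux[OF f(1)])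
next
  case False
  then obtain \<phi> :: "'a \<Rightarrow> real" and M V where \<phi>: "lipschitz_convex M \<phi>" "M > 0"
    and V: "open V" "V \<noteq> {}" and no: "\<not> (\<exists>x\<in>V. \<forall>e>0. x \<in> nearly_smooth \<phi> e)"
    unfolding not_all not_imp by (elim exE conjE) (rule that; assumption)
  have V_rough: "\<exists>e>0. x \<notin> nearly_smooth \<phi> e" if "x \<in> V" for x
    using no that by blast
  obtain a r e where r: "r > 0" "e > 0"
    and rough: "\<And>x d. x \<in> ball a r \<Longrightarrow> d > 0 \<Longrightarrow> \<exists>h. norm h \<le> d \<and> e * d < second_diff \<phi> x h"
    using rough_ball[OF \<phi> V V_rough] by metis
  have grad: "\<exists>x\<in>W. \<exists>\<xi>. gradient_at \<phi> x \<xi>" if W: "open W" "W \<noteq> {}" for W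
  proof -
    obtain O' :: "nat \<Rightarrow> 'a set" where O': "\<And>x. x \<in> (\<Inter>n. O' n) \<Longrightarrow> gateaux_differentiable_at \<phi> x"
        "closure (\<Inter>n. O' n) = UNIV"
      using weak_asplund_open_dense[OF X \<phi>(1)] by metis
    then have "W \<inter> (\<Inter>n. O' n) \<noteq> {}"
      using open_Int_closure_eq_empty[OF W(1), of "\<Inter>n. O' n"] W(2) by simp
    then obtain x where "x \<in> W" "x \<in> (\<Inter>n. O' n)" by blast
    then show ?thesis
      using gateaux_imp_gradient[OF lipschitz_convexD(1)[OF \<phi>(1)] O'(1)] by metis
  qed
  obtain \<xi> :: "nat \<Rightarrow> 'a \<Rightarrow>\<^sub>L real" and h c where tree: "gradient_tree \<xi> h M c"
    by (rule gradient_tree_exists[OF \<phi> grad, of a r "e / 4"]) (use rough r in auto)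
  have "comeagre_in UNIV {p. \<forall>k. smooth_along f p (k, 0)}"
  proof (rule comeagre_in_local)
    fix p :: "'a \<times> real"
    obtain x0 y0 where p: "p = (x0, y0)" by (cases p)
    interpret competition \<xi> h M c f L x0 y0
      using tree f by (simp add: competition_def competition_axioms_def)
    obtain O' :: "nat \<Rightarrow> 'a set" where O': "\<And>n. open (O' n)" "\<And>n. closure (O' n) = UNIV"
        "\<And>x. x \<in> (\<Inter>n. O' n) \<Longrightarrow> gateaux_differentiable_at g x"
      using weak_asplund_open_dense[OF X g_lipschitz] by metis
    have "smooth_along g x k" if "x \<in> (\<Inter>n. O' n)" for x k
      using gateaux_imp_gradient[OF lipschitz_convexD(1)[OF g_lipschitz] O'(3)[OF that]]
        gradient_imp_smooth_along[OF lipschitz_convexD(1)[OF g_lipschitz]] by metis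
    then have "comeagre_in (window (0, x0, 1, 0)) {p. \<forall>k. smooth_along f p (k, 0)}"
      by (rule comeagre_smooth_horizontally[OF O'(1,2)])
    moreover have "p \<in> window (0, x0, 1, 0)"
      using aperture_pos by (simp add: window_def p root_values)
    ultimately show "\<exists>V. open V \<and> p \<in> V \<and> comeagre_in V {p. \<forall>k. smooth_along f p (k, 0)}"
      using open_window by blast
  qed simp
  then have "comeagre_in UNIV ({p. \<forall>k. smooth_along f p (k, 0)} \<inter> {p. smooth_along f p (0, 1)})"
    by (rule comeagre_in_Int[OF _ comeagre_smooth_along[OF f(1)]])
  moreover have "gateaux_differentiable_at f p"
    if "\<And>k. smooth_along f p (k, 0)" "smooth_along f p (0, 1)" for p
  proof (rule smooth_imp_gateaux[OF f(1)])
    fix q :: "'a \<times> real"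
    have "smooth_along f p ((fst q, 0) + snd q *\<^sub>R (0, 1))"
      by (intro smooth_along_add smooth_along_scaleR that lipschitz_convexD(1)[OF f(1)])
    then show "smooth_along f p q" by simp
  qed
  ultimately show ?thesis
    by (elim comeagre_in_mono) auto
qed

lemma weak_asplund_prod_real:
  assumes "weak_asplund TYPE('a::banach)"
  shows "weak_asplund TYPE('a::banach \<times> real)"
  unfolding weak_asplund_def
proof (intro allI impI, elim conjE)
  fix U :: "('a \<times> real) set" and f
  assume U: "open U" and f: "continuous_on U f" "convex_on U f"
  have "comeagre_in U {p. gateaux_differentiable_at f p}"
  proof (rule comeagre_in_local[OF U])
    fix p assume "p \<in> U"
    obtain r L g where r: "r > 0" "L > 0" "lipschitz_convex L g" "\<And>x. x \<in> ball p r \<Longrightarrow> g x = f x"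
      using convex_on_extension[OF f(2) U f(1) \<open>p \<in> U\<close>] by metis
    have "comeagre_in (ball p r) {p. gateaux_differentiable_at f p}"
      by (rule comeagre_in_mono[OF comeagre_gateaux_product[OF assms r(3,2)]])
        (auto intro: gateaux_cong_open[of "ball p r" _ g f] simp: r(4))
    then show "\<exists>V. open V \<and> p \<in> V \<and> comeagre_in V {p. gateaux_differentiable_at f p}"
      using r(1) by (intro exI[of _ "ball p r"]) simp
  qed
  then obtain G where "gdelta_in (top_of_set U) G" "U \<subseteq> closure G" "G \<subseteq> {p. gateaux_differentiable_at f p}"
    using comeagre_in_imp_dense_gdelta[OF U] by metis
  then show "\<exists>G. gdelta_in (top_of_set U) G \<and> U \<subseteq> closure G \<and> (\<forall>x\<in>G. gateaux_differentiable_at f x)"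
    by blast
qed

text \<open>Linear homeomorphisms preserve convexity and Gateaux differentiability, so being a weak Asplund
  space does not depend on the choice of an equivalent norm.\<close>

lemma weak_asplund_isomorphic:
  fixes S :: "'a::banach \<Rightarrow> 'b::banach" and T :: "'b \<Rightarrow> 'a"
  assumes X: "weak_asplund TYPE('a)" and S: "bounded_linear S" and T: "bounded_linear T"
    and ST: "\<And>y. S (T y) = y" and TS: "\<And>x. T (S x) = x"
  shows "weak_asplund TYPE('b)"
  unfolding weak_asplund_def
proof (intro allI impI, elim conjE)
  fix U :: "'b set" and f
  assume U: "U \<noteq> {}" "open U" "convex U" and f: "continuous_on U f" "convex_on U f"
  interpret S: bounded_linear S by (rule S)
  interpret T: bounded_linear T by (rule T)
  have contS: "continuous_on A S" and contT: "continuous_on B T" for A B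
    using S.continuous_on[OF continuous_on_id] T.continuous_on[OF continuous_on_id] by simp_all
  define V where "V = S -` U"
  have "open V"
    unfolding V_def using U(2) contS by (rule open_vimage)
  moreover have "convex V"
    unfolding V_def using U(3) S.linear by (rule convex_linear_vimage[rotated])
  moreover have "V \<noteq> {}" using U(1) ST by (auto simp: V_def)
  moreover have "continuous_on V (f \<circ> S)"
    unfolding comp_def by (rule continuous_on_compose2[OF f(1) contS]) (auto simp: V_def)
  moreover have "convex_on V (f \<circ> S)"
  proof (rule convex_onI)
    fix t :: real and x y assume "0 < t" "t < 1" "x \<in> V" "y \<in> V"
    then show "(f \<circ> S) ((1 - t) *\<^sub>R x + t *\<^sub>R y) \<le> (1 - t) * (f \<circ> S) x + t * (f \<circ> S) y"
      using convex_onD[OF f(2), of t "S x" "S y"] by (simp add: V_def S.add S.scaleR)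
  qed fact
  ultimately obtain G where G: "gdelta_in (top_of_set V) G" "V \<subseteq> closure G"
      "\<And>x. x \<in> G \<Longrightarrow> gateaux_differentiable_at (f \<circ> S) x"
    using X unfolding weak_asplund_def by metis
  obtain C :: "nat \<Rightarrow> 'a set" where C: "\<And>n. openin (top_of_set V) (C n)" "(\<Inter>n. C n) = G"
    using G(1) by (auto simp: gdelta_in_descending)
  have "openin (top_of_set U) (T -` C n)" for n
  proof -
    have "open (C n)" "C n \<subseteq> V" using C(1)[of n] \<open>open V\<close> by (simp_all add: openin_open_eq)
    moreover have "T -` C n \<subseteq> U"
      using \<open>C n \<subseteq> V\<close> ST by (auto simp: V_def)
    ultimately show ?thesis using U(2) contT by (simp add: openin_open_eq open_vimage)
  qed
  then have "gdelta_in (top_of_set U) (\<Inter>n. T -` C n)"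
    by (intro gdelta_in_Inter) (auto intro: open_imp_gdelta_in)
  moreover have "(\<Inter>n. T -` C n) = T -` G" using C(2) by auto
  moreover have "U \<subseteq> closure (T -` G)"
  proof
    fix y assume "y \<in> U"
    then have "T y \<in> closure G" using G(2) ST by (auto simp: V_def)
    then have "S (T y) \<in> closure (S ` G)"
      using image_closure_subset[of G S "closure (S ` G)"] contS closure_subset by blast
    moreover have "S ` G \<subseteq> T -` G" using TS by auto
    ultimately show "y \<in> closure (T -` G)" using closure_mono ST by (metis subsetD)
  qed
  moreover have "gateaux_differentiable_at f y" if "y \<in> T -` G" for y
  proof -
    have "gateaux_differentiable_at (f \<circ> S) (T y)" using G(3) that by simp
    then obtain df where df: "\<And>k. ((\<lambda>t. \<bar>((f \<circ> S) (T y + t *\<^sub>R k) - (f \<circ> S) (T y)) / t - blinfun_apply df k\<bar>) \<longlongrightarrow> 0) (at 0)"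
      unfolding gateaux_differentiable_at_def by blast
    have df_T: "blinfun_apply (df o\<^sub>L Blinfun T) k = df (T k)" for k
      by (simp add: bounded_linear_Blinfun_apply[OF T])
    have "S (T y + t *\<^sub>R T k) = y + t *\<^sub>R k" for t k
      by (simp add: S.add S.scaleR ST)
    then have "((\<lambda>t. \<bar>(f (y + t *\<^sub>R k) - f y) / t - (df o\<^sub>L Blinfun T) k\<bar>) \<longlongrightarrow> 0) (at 0)" for k
      using df[of "T k"] unfolding df_T by (simp add: ST)
    then show ?thesis
      unfolding gateaux_differentiable_at_def by blast
  qed
  ultimately show "\<exists>G. gdelta_in (top_of_set U) G \<and> U \<subseteq> closure G \<and> (\<forall>x\<in>G. gateaux_differentiable_at f x)"
    by (intro exI[of _ "T -` G"]) auto
qed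

theorem theorem2p1:
  assumes "weak_asplund TYPE('a::banach)"
  shows "weak_asplund TYPE(('a, real) max_prod)"
  by (rule weak_asplund_isomorphic[OF weak_asplund_prod_real[OF assms] bounded_linear_MaxProd bounded_linear_pair_of])
    (simp_all add: pair_of_inverse MaxProd_inverse)

end
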